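(* Let $Y(t)$, $t\ge 0$, be a critical Markov branching process with non-homogeneous Poisson immigration, with offspring p.g.f. $f(s)=s+(1-s)^{\gamma+1}L(1/(1-s))$, $s\in[0,1)$, $\gamma\in(0,1]$, immigrant p.g.f. $g(s)=1-(1-s)^{\alpha}l(1/(1-s))$, $\alpha\in(0,1]$, and Poisson intensity $r(t)=t^{-\theta}L_R(t)$, $\theta>0$, where $L,l,L_R$ are slowly varying at infinity. (i) If $\theta\ge1$ and $0<\alpha/\gamma<1$, then for every $x\ge0$ $$\mathbf{P}\{Y(t)/W(\mu t)\le x\mid Y(t)>0\}\to D(\alpha,\gamma;x),\qquad t\to\infty,$$ where $D(\alpha,\gamma;\cdot)$ is the distribution function on $[0,\infty)$ with Laplace transform $$\int_0^\infty e^{-\lambda x}\,\mathrm{d}D(\alpha,\gamma;x)=1-\frac{\lambda^{\alpha}}{(1+\lambda^{\gamma})^{\alpha/\gamma}},\qquad \lambda>0 .$$ (ii) If $0<\theta<1$ and $\alpha/\gamma\ge1$ with $Q=\int_0^\infty q(u)\,du<\infty$, then for $s\in[0,1)$ $$\mathbf{E}[s^{Y(t)}\mid Y(t)>0]\to 1-\frac{\Delta(s)}{Q},\qquad t\to\infty .$$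
   Context: Model. In a Markov branching process each particle, independently of all others, lives an exponentially distributed time with parameter $\mu>0$ and at its death produces a random number $\xi\ge 0$ of new particles of the same type; $f(s)=\mathbf{E}[s^{\xi}]$ is the offspring p.g.f. Let $Z(t)$ be the number of particles at time $t$ and $F(t;s)=\mathbf{E}[s^{Z(t)}\mid Z(0)=1]$, so $\partial F(t;s)/\partial t=\mu[f(F(t;s))-F(t;s)]$, $F(0;s)=s$. Let $\nu(t)$ be a non-homogeneous Poisson process with intensity $r(t)$, mean measure $R(t)=\int_0^t r(u)\,du$ (finite for each $t$), and jump points $0=S_0<S_1<S_2<\cdots$. At each $S_k$, $k\ge1$, $I_k$ new particles immigrate, where $I_1,I_2,\dots$ are i.i.d. non-negative integer-valued with p.g.f. $g(s)=\mathbf{E}[s^{I_k}]$. The Markov branching process with non-homogeneous Poisson immigration is $$Y(t)=\sum_{k=1}^{\nu(t)}\sum_{j=1}^{I_k}Z^{(k,j)}(t-S_k),\qquad t\ge 0,$$ where $Z^{(k,j)}$ are i.i.d. copies of $Z$ started from one particle; the processes $Z^{(k,j)}$, the variables $I_k$ and the Poisson process $\nu$ are independent. Notation. $q(t;s)=1-g(F(t;s))$, $q(t)=q(t;0)$, $\Delta(s)=\int_0^\infty q(u;s)\,du$ (when it converges). $V(x)=\int_0^{1-1/x}\frac{du}{f(u)-u}=\int_1^x\frac{u^{\gamma-1}}{L(u)}\,du$ for $x\ge1$, which is increasing from $[1,\infty)$ onto $[0,\infty)$, and $W:[0,\infty)\to[1,\infty)$ is the inverse function of $V$. *)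

theory Defs
  imports "HOL-Probability.Probability"
begin

definition slowly_varying :: "(real \<Rightarrow> real) \<Rightarrow> bool" where
  "slowly_varying L \<longleftrightarrow>
     (\<exists>a. L \<in> borel_measurable (lebesgue_on {a..}) \<and> (\<forall>x\<ge>a. L x > 0)) \<and>
     (\<forall>c>0. ((\<lambda>x. L (c * x) / L x) \<longlongrightarrow> 1) at_top)"

definition pgf :: "nat pmf \<Rightarrow> real \<Rightarrow> real" where
  "pgf p s = measure_pmf.expectation p (\<lambda>n. s ^ n)"


subsection \<open>Markov branching processes\<close>

text \<open>
  The family tree of one initial particle is coded by giving every potential particle
  \<open>v :: nat list\<close> a lifetime \<open>fst (G v)\<close> and a number of children \<open>snd (G v)\<close>. The root is
  \<open>[]\<close>, and \<open>i # v\<close> is the \<open>i\<close>-th child of \<open>v\<close> (counting from 0). A particle is born at the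
  moment its parent dies.
\<close>

type_synonym genealogy = "nat list \<Rightarrow> real \<times> nat"

primrec realised :: "genealogy \<Rightarrow> nat list \<Rightarrow> bool" where
  "realised G [] \<longleftrightarrow> True"
| "realised G (i # v) \<longleftrightarrow> realised G v \<and> i < snd (G v)"

primrec birth_time :: "genealogy \<Rightarrow> nat list \<Rightarrow> real" where
  "birth_time G [] = 0"
| "birth_time G (i # v) = birth_time G v + fst (G v)"

text \<open>
  The population size at time \<open>t\<close>. The set below is almost surely finite for critical
  offspring laws; on the exceptional null set \<^const>\<open>card\<close> may return the junk value 0.
\<close>

definition population :: "genealogy \<Rightarrow> real \<Rightarrow> nat" where
  "population G t =
     card {v. realised G v \<and> birth_time G v \<le> t \<and> t < birth_time G v + fst (G v)}"

text \<open>
  All lifetimes are exponential with parameter \<open>\<mu>\<close>, all offspring numbers have law \<open>p\<close>, and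
  everything is independent. The process \<open>Z\<close> is \<^const>\<open>population\<close> under this law.
\<close>

definition genealogy_law :: "real \<Rightarrow> nat pmf \<Rightarrow> genealogy measure" where
  "genealogy_law \<mu> p =
     PiM UNIV (\<lambda>_. density lborel (exponential_density \<mu>) \<Otimes>\<^sub>M measure_pmf p)"

definition mbp_F :: "real \<Rightarrow> nat pmf \<Rightarrow> real \<Rightarrow> real \<Rightarrow> real" where
  "mbp_F \<mu> p t s = (LINT G|genealogy_law \<mu> p. s ^ population G t)"


subsection \<open>Non-homogeneous Poisson immigration\<close>

definition mean_measure :: "(real \<Rightarrow> real) \<Rightarrow> real \<Rightarrow> real" where
  "mean_measure r t = integral {0..t} r"

text \<open>
  Poisson process with intensity \<open>r\<close>. Nothing is required of \<open>r 0\<close>, since an intensity such as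
  \<open>t powr (-\<theta>) * c\<close> need not be meaningful at the origin.
\<close>

locale nonhomogeneous_poisson_process = prob_space M
  for M :: "'a measure" and r :: "real \<Rightarrow> real" and \<nu> :: "real \<Rightarrow> 'a \<Rightarrow> nat" +
  assumes intensity_nonneg: "\<And>u. u > 0 \<Longrightarrow> r u \<ge> 0"
    and intensity_integrable: "\<And>t. t \<ge> 0 \<Longrightarrow> r integrable_on {0..t}"
    and measurable_count: "\<And>t. t \<ge> 0 \<Longrightarrow> \<nu> t \<in> measurable M (count_space UNIV)"
    and count_0: "\<And>\<omega>. \<omega> \<in> space M \<Longrightarrow> \<nu> 0 \<omega> = 0"
    and count_mono: "\<And>\<omega>. \<omega> \<in> space M \<Longrightarrow> mono_on {0..} (\<lambda>t. \<nu> t \<omega>)"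
    and count_right_continuous:
      "\<And>\<omega> t. \<omega> \<in> space M \<Longrightarrow> t \<ge> 0 \<Longrightarrow> eventually (\<lambda>u. \<nu> u \<omega> = \<nu> t \<omega>) (at_right t)"
    and poisson_increment:
      "\<And>s t n. 0 \<le> s \<Longrightarrow> s \<le> t \<Longrightarrow>
         prob {\<omega> \<in> space M. \<nu> t \<omega> - \<nu> s \<omega> = n} =
           (mean_measure r t - mean_measure r s) ^ n / fact n *
             exp (- (mean_measure r t - mean_measure r s))"
    and independent_increments:
      "\<And>(\<tau> :: nat \<Rightarrow> real) m. 0 \<le> \<tau> 0 \<Longrightarrow> mono \<tau> \<Longrightarrow>
         indep_vars (\<lambda>_. count_space UNIV) (\<lambda>i \<omega>. \<nu> (\<tau> (Suc i)) \<omega> - \<nu> (\<tau> i) \<omega>) {..<m}"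

text \<open>
  The \<open>k\<close>-th jump point counting from 0, so this is \<open>S\<^sub>k\<^sub>+\<^sub>1\<close> in the usual numbering. It is
  meaningful only if the process has more than \<open>k\<close> jumps; there may be only finitely many.
\<close>

definition jump_point :: "(real \<Rightarrow> 'a \<Rightarrow> nat) \<Rightarrow> nat \<Rightarrow> 'a \<Rightarrow> real" where
  "jump_point \<nu> k \<omega> = Inf {u. 0 \<le> u \<and> k < \<nu> u \<omega>}"

text \<open>
  Immigration waves, and particles within a wave, are numbered from 0. As the three components
  take values in different spaces, their mutual independence is expressed by saying that the
  joint law is the product of the marginal laws.
\<close>

locale mbp_with_immigration = nonhomogeneous_poisson_process M r \<nu>
  for M :: "'a measure" and r :: "real \<Rightarrow> real" and \<nu> :: "real \<Rightarrow> 'a \<Rightarrow> nat" +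
  fixes \<mu> :: real and offspring immigrants :: "nat pmf"
    and I :: "nat \<Rightarrow> 'a \<Rightarrow> nat" and G :: "nat \<times> nat \<Rightarrow> 'a \<Rightarrow> genealogy"
  assumes \<mu>_pos: "\<mu> > 0"
    and I_indep: "indep_vars (\<lambda>_. count_space UNIV) I UNIV"
    and I_law: "\<And>k. distr M (count_space UNIV) (I k) = measure_pmf immigrants"
    and G_indep: "indep_vars (\<lambda>_. genealogy_law \<mu> offspring) G UNIV"
    and G_law: "\<And>kj. distr M (genealogy_law \<mu> offspring) (G kj) = genealogy_law \<mu> offspring"
    and components_indep:
      "(let A = PiM {0..} (\<lambda>_. count_space UNIV);
            B = PiM UNIV (\<lambda>_. count_space UNIV);
            C = PiM UNIV (\<lambda>_. genealogy_law \<mu> offspring);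
            X = (\<lambda>\<omega>. \<lambda>t\<in>{0..}. \<nu> t \<omega>); Y = (\<lambda>\<omega> k. I k \<omega>); Z = (\<lambda>\<omega> kj. G kj \<omega>)
        in distr M (A \<Otimes>\<^sub>M (B \<Otimes>\<^sub>M C)) (\<lambda>\<omega>. (X \<omega>, Y \<omega>, Z \<omega>)) =
             distr M A X \<Otimes>\<^sub>M (distr M B Y \<Otimes>\<^sub>M distr M C Z))"

definition total_population ::
    "(real \<Rightarrow> 'a \<Rightarrow> nat) \<Rightarrow> (nat \<Rightarrow> 'a \<Rightarrow> nat) \<Rightarrow> (nat \<times> nat \<Rightarrow> 'a \<Rightarrow> genealogy) \<Rightarrow>
     real \<Rightarrow> 'a \<Rightarrow> nat" where
  "total_population \<nu> I G t \<omega> =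
     (\<Sum>k<\<nu> t \<omega>. \<Sum>j<I k \<omega>. population (G (k, j) \<omega>) (t - jump_point \<nu> k \<omega>))"


subsection \<open>Auxiliary functions\<close>

definition mbp_q :: "real \<Rightarrow> nat pmf \<Rightarrow> nat pmf \<Rightarrow> real \<Rightarrow> real \<Rightarrow> real" where
  "mbp_q \<mu> offspring immigrants t s = 1 - pgf immigrants (mbp_F \<mu> offspring t s)"

definition mbp_Delta :: "real \<Rightarrow> nat pmf \<Rightarrow> nat pmf \<Rightarrow> real \<Rightarrow> real" where
  "mbp_Delta \<mu> offspring immigrants s = integral {0..} (\<lambda>u. mbp_q \<mu> offspring immigrants u s)"

definition mbp_V :: "nat pmf \<Rightarrow> real \<Rightarrow> real" where
  "mbp_V offspring x = integral {0..1 - 1 / x} (\<lambda>u. 1 / (pgf offspring u - u))"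

definition mbp_W :: "nat pmf \<Rightarrow> real \<Rightarrow> real" where
  "mbp_W offspring = inv_into {1..} (mbp_V offspring)"

definition D_law :: "real \<Rightarrow> real \<Rightarrow> real measure \<Rightarrow> bool" where
  "D_law \<alpha> \<gamma> D \<longleftrightarrow>
     real_distribution D \<and> measure D {..<0} = 0 \<and>
     (\<forall>u>0. (LINT x|D. exp (- u * x)) =
        1 - u powr \<alpha> / (1 + u powr \<gamma>) powr (\<alpha> / \<gamma>))"

end

theory Submission
  imports Defs "HOL-Complex_Analysis.Complex_Analysis" "HOL-Real_Asymp.Real_Asymp"
begin

text \<open>
  Write \<open>f\<close> and \<open>g\<close> for the offspring and immigrant generating functions, \<open>F(t;s)\<close> for the generating
  function of the branching process, \<open>q(t;s) = 1 - g(F(t;s))\<close>, and \<open>V\<close>, \<open>W\<close> for the scale functions. The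
  proof rests on two exact formulas.

  The first one is \<open>V(1 / (1 - F(t;s))) = \<mu> t + V(1 / (1 - s))\<close> (\<open>mbp_V_mbp_F\<close>). It integrates the
  differential equation \<open>F' = \<mu> (f(F) - F)\<close>, which follows from the renewal equation obtained by
  conditioning a genealogy on its root. The formula says that \<open>q(t;s)\<close> is \<open>q(\<cdot>;0)\<close> evaluated with a delay:
  \<open>q(t;s) = q(t + V(1 / (1 - s)) / \<mu>; 0)\<close>. As \<open>V\<close> is regularly varying with index \<open>\<gamma>\<close>, its inverse \<open>W\<close>
  has index \<open>1 / \<gamma>\<close>, and \<open>q(t;0)\<close> is decreasing with index \<open>- \<alpha> / \<gamma>\<close>.

  The second one is \<open>E s\<^sup>Y\<^sup>(\<^sup>t\<^sup>) = exp (- J(t,s))\<close>, where \<open>J(t,s)\<close> is the integral of \<open>r(u) q(t - u;s)\<close> over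
  \<open>[0, t]\<close> (\<open>expectation_total_population\<close>). Given the Poisson process, the waves are independent and each
  jump point \<open>u\<close> contributes the factor \<open>g(F(t - u;s))\<close>; the expectation of a product over the points of
  a Poisson process is found by discretising time (\<open>poisson_functional\<close>).

  Since \<open>E[s\<^sup>Y | Y > 0] = 1 - (1 - E s\<^sup>Y) / (1 - P(Y = 0))\<close> and \<open>J(t,0)\<close> tends to 0 in both regimes, only
  the limit of \<open>J(t,s) / J(t,0)\<close> is needed.

  For \<open>\<theta> \<ge> 1\<close> one has \<open>t r(t) = o(R(t))\<close> with \<open>R\<close> the integral of \<open>r\<close>: on the scale \<open>t\<close> almost all
  immigration takes place at the very beginning, and \<open>J(t,s)\<close> is asymptotic to \<open>R(t) q(t;s)\<close>
  (\<open>convolution_asymptotics\<close>; here \<open>\<alpha> / \<gamma> < 1\<close> makes the contribution of late immigrants negligible). At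
  \<open>s = exp (- \<lambda> / W(\<mu> t))\<close> the delay is asymptotic to \<open>\<lambda> powr (- \<gamma>) * t\<close>, whence the ratio tends to
  \<open>(1 + \<lambda> powr (- \<gamma>)) powr (- \<alpha> / \<gamma>)\<close>. The continuity theorem for Laplace transforms
  (\<open>laplace_continuity\<close>) turns this into convergence in law and at the same time provides the limit law
  \<open>D\<close>. Convergence holds at every point because \<open>D\<close> has no atoms: its transform extends to a half-plane
  and vanishes at infinity along a vertical line (\<open>D_law_no_atoms\<close>).

  For \<open>\<theta> < 1\<close> and integrable \<open>q(\<cdot>;0)\<close> only recent immigrants matter: \<open>J(t,s)\<close> is asymptotic to \<open>r(t)\<close> times
  the integral of \<open>q(\<cdot>;s)\<close> over the half-line (\<open>convolution_integrable_asymptotics\<close>).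

  The slowly varying factor of \<open>r\<close> is merely measurable, so all estimates of \<open>r\<close> depend on the uniform
  convergence theorem (\<open>slowly_varying_uniform\<close>). The functions \<open>V\<close>, \<open>W\<close> and \<open>q(\<cdot>;0)\<close> are monotone, for which
  regular variation is automatically locally uniform (\<open>regularly_varying_mono_tendsto\<close>).
\<close>


section \<open>The family tree of a Markov branching process\<close>

definition particle_law :: "real \<Rightarrow> nat pmf \<Rightarrow> (real \<times> nat) measure" where
  "particle_law \<mu> p = density lborel (exponential_density \<mu>) \<Otimes>\<^sub>M measure_pmf p"

text \<open>
  An address lists the most recent branch first, so that the first generation is found at its end:
  descending into a child of the root means appending on the right.
\<close>

definition child :: "genealogy \<Rightarrow> nat \<Rightarrow> genealogy" where
  "child G i = (\<lambda>v. G (v @ [i]))"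

definition alive :: "genealogy \<Rightarrow> real \<Rightarrow> nat list set" where
  "alive G t = {v. realised G v \<and> birth_time G v \<le> t \<and> t < birth_time G v + fst (G v)}"

lemma population_eq_card_alive: "population G t = card (alive G t)"
  by (simp add: population_def alive_def)

lemma realised_snoc: "realised G (v @ [i]) \<longleftrightarrow> realised (child G i) v \<and> i < snd (G [])"
  by (induction v) (auto simp: child_def)

lemma birth_time_snoc: "birth_time G (v @ [i]) = birth_time (child G i) v + fst (G [])"
  by (induction v) (auto simp: child_def)

text \<open>
  A particle other than the root has exactly one ancestor in the first generation, and it sees time
  shifted by the lifetime of the root.
\<close>

lemma alive_decomposition:
  "alive G t = (if 0 \<le> t \<and> t < fst (G []) then {[]} else {}) \<union>
     (\<Union>i<snd (G []). (\<lambda>v. v @ [i]) ` alive (child G i) (t - fst (G [])))" (is "?A = ?B")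
proof (intro set_eqI)
  fix v
  show "v \<in> ?A \<longleftrightarrow> v \<in> ?B"
  proof (cases v rule: rev_cases)
    case Nil
    then show ?thesis by (auto simp: alive_def)
  next
    case (snoc w i)
    then show ?thesis
      by (auto simp: alive_def realised_snoc birth_time_snoc child_def algebra_simps)
  qed
qed

text \<open>
  Finiteness is essential here: \<^const>\<open>card\<close> of an infinite set is 0, so otherwise the
  populations of the children need not add up.
\<close>

lemma population_decomposition:
  assumes "\<And>i. i < snd (G []) \<Longrightarrow> finite (alive (child G i) (t - fst (G [])))"
  shows "population G t = (if 0 \<le> t \<and> t < fst (G []) then 1 else 0) +
     (\<Sum>i<snd (G []). population (child G i) (t - fst (G [])))"
proof -
  let ?C = "\<lambda>i. (\<lambda>v. v @ [i]) ` alive (child G i) (t - fst (G []))"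
  let ?R = "if 0 \<le> t \<and> t < fst (G []) then {[]} else {} :: nat list set"
  have "card (\<Union>i<snd (G []). ?C i) = (\<Sum>i<snd (G []). card (?C i))"
    using assms by (intro card_UN_disjoint) auto
  also have "\<dots> = (\<Sum>i<snd (G []). population (child G i) (t - fst (G [])))"
    by (intro sum.cong refl) (auto simp: population_eq_card_alive card_image inj_on_def)
  finally have 1: "card (\<Union>i<snd (G []). ?C i) = \<dots>" .
  have "card (?R \<union> (\<Union>i<snd (G []). ?C i)) = card ?R + card (\<Union>i<snd (G []). ?C i)"
    using assms by (intro card_Un_disjoint) auto
  then show ?thesis
    unfolding population_eq_card_alive[of G] alive_decomposition[of G] 1 by auto
qed

text \<open>
  The number of particles of the \<open>n\<close>-th generation born up to time \<open>t\<close>, unfolded along the first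
  generation, so that its expectation can be computed by conditioning on the root.
\<close>

primrec born_count :: "nat \<Rightarrow> genealogy \<Rightarrow> real \<Rightarrow> ennreal" where
  "born_count 0 G t = (if 0 \<le> t then 1 else 0)"
| "born_count (Suc n) G t = (\<Sum>i<snd (G []). born_count n (child G i) (t - fst (G [])))"

lemma born_count_ge_1:
  "realised G v \<Longrightarrow> birth_time G v \<le> t \<Longrightarrow> 1 \<le> born_count (length v) G t"
proof (induction v arbitrary: G t rule: rev_induct)
  case Nil
  then show ?case by simp
next
  case (snoc i v)
  have i: "i < snd (G [])" using snoc.prems by (simp add: realised_snoc)
  have "1 \<le> born_count (length v) (child G i) (t - fst (G []))"
    using snoc.prems by (intro snoc.IH) (auto simp: realised_snoc birth_time_snoc)
  also have "\<dots> \<le> (\<Sum>i<snd (G []). born_count (length v) (child G i) (t - fst (G [])))"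
    using i by (intro member_le_sum) auto
  finally show ?case by simp
qed

lemma finite_generation: "finite {v. length v = n \<and> realised G v}"
proof (induction n arbitrary: G)
  case 0
  then show ?case by (rule finite_subset[of _ "{[]}"]) auto
next
  case (Suc n)
  have "{v. length v = Suc n \<and> realised G v} \<subseteq>
     (\<Union>i<snd (G []). (\<lambda>v. v @ [i]) ` {v. length v = n \<and> realised (child G i) v})"
  proof
    fix v assume v: "v \<in> {v. length v = Suc n \<and> realised G v}"
    then show "v \<in> (\<Union>i<snd (G []). (\<lambda>v. v @ [i]) ` {v. length v = n \<and> realised (child G i) v})"
      by (cases v rule: rev_cases) (auto simp: realised_snoc)
  qed
  then show ?case
    by (rule finite_subset) (use Suc in auto)
qed

text \<open>
  A convergent series of extended naturals has only finitely many nonzero terms, so no particle alive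
  at time \<open>t\<close> belongs to a late generation; and each single generation is finite.
\<close>

lemma finite_alive:
  assumes "(\<Sum>n. born_count n G t) < \<infinity>"
  shows "finite (alive G t)"
proof -
  define c where "c n = enn2real (born_count n G t)" for n
  have bc: "born_count n G t = ennreal (c n)" for n
    using ennreal_suminf_lessD[OF assms, of n] by (simp add: c_def)
  have "summable c"
    using assms by (intro summable_suminf_not_top) (auto simp: bc[symmetric], simp add: c_def)
  then have "eventually (\<lambda>n. c n < 1) sequentially"
    by (intro order_tendstoD(2)[OF summable_LIMSEQ_zero]) auto
  then have "eventually (\<lambda>n. born_count n G t < 1) sequentially"
    by eventually_elim (auto simp: bc simp flip: ennreal_1 intro!: ennreal_lessI)
  then obtain m where m: "\<And>n. n \<ge> m \<Longrightarrow> born_count n G t < 1"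
    unfolding eventually_sequentially by auto
  have "alive G t \<subseteq> (\<Union>n<m. {v. length v = n \<and> realised G v})"
  proof
    fix v assume "v \<in> alive G t"
    then have "1 \<le> born_count (length v) G t" and r: "realised G v"
      using born_count_ge_1[of G v t] by (auto simp: alive_def)
    then have "length v < m" using m[of "length v"] by (meson leD leI)
    then show "v \<in> (\<Union>n<m. {v. length v = n \<and> realised G v})" using r by auto
  qed
  then show ?thesis
    by (rule finite_subset) (use finite_generation in auto)
qed

lemma sets_particle_law: "sets (particle_law \<mu> p) = sets (borel \<Otimes>\<^sub>M count_space UNIV)"
  unfolding particle_law_def by (intro sets_pair_measure_cong) auto

lemma space_particle_law: "space (particle_law \<mu> p) = UNIV"
  by (simp add: particle_law_def space_pair_measure)

lemma genealogy_law_eq: "genealogy_law \<mu> p = PiM UNIV (\<lambda>_. particle_law \<mu> p)"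
  by (simp add: genealogy_law_def particle_law_def)

lemma space_genealogy_law[simp]: "space (genealogy_law \<mu> p) = UNIV"
  by (simp add: genealogy_law_eq space_PiM space_particle_law)

lemma prob_space_particle_law: "\<mu> > 0 \<Longrightarrow> prob_space (particle_law \<mu> p)"
  unfolding particle_law_def
  by (intro prob_space_pair prob_space_exponential_density) (auto intro: prob_space_measure_pmf)

lemma prob_space_genealogy_law: "\<mu> > 0 \<Longrightarrow> prob_space (genealogy_law \<mu> p)"
  unfolding genealogy_law_eq by (intro prob_space_PiM prob_space_particle_law)

lemma measurable_particle[measurable]:
  "(\<lambda>G. G v) \<in> genealogy_law \<mu> p \<rightarrow>\<^sub>M borel \<Otimes>\<^sub>M count_space UNIV"
  using measurable_component_singleton[of v UNIV "\<lambda>_. particle_law \<mu> p"]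
  unfolding genealogy_law_eq by (simp cong: measurable_cong_sets add: sets_particle_law)

lemma measurable_child[measurable]: "(\<lambda>G. child G i) \<in> genealogy_law \<mu> p \<rightarrow>\<^sub>M genealogy_law \<mu> p"
  unfolding genealogy_law_eq child_def
  by (intro measurable_PiM_single') (auto simp: space_PiM space_particle_law)

lemma measurable_realised[measurable]: "Measurable.pred (genealogy_law \<mu> p) (\<lambda>G. realised G v)"
  by (induction v) auto

lemma measurable_birth_time[measurable]: "(\<lambda>G. birth_time G v) \<in> borel_measurable (genealogy_law \<mu> p)"
  by (induction v) auto

lemma measurable_population[measurable]:
  "(\<lambda>(G, t). population G t) \<in> genealogy_law \<mu> p \<Otimes>\<^sub>M borel \<rightarrow>\<^sub>M count_space UNIV"
proof -
  have eq: "(\<lambda>(G, t). population G t) = (\<lambda>x. card {n. n \<in> range (to_nat :: nat list \<Rightarrow> nat) \<and> from_nat n \<in> alive (fst x) (snd x)})"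
  proof (intro ext, clarify)
    fix G :: genealogy and t :: real
    have "{n. n \<in> range (to_nat :: nat list \<Rightarrow> nat) \<and> from_nat n \<in> alive G t} = to_nat ` alive G t"
      by auto
    then show "population G t = card {n. n \<in> range (to_nat :: nat list \<Rightarrow> nat) \<and> from_nat n \<in> alive (fst (G, t)) (snd (G, t))}"
      by (simp add: population_eq_card_alive card_image inj_on_subset[OF inj_to_nat])
  qed
  show ?thesis
    unfolding eq
    by (rule measurable_card) (simp add: alive_def)
qed

lemma measurable_born_count[measurable]:
  "(\<lambda>(G, t). born_count n G t) \<in> borel_measurable (genealogy_law \<mu> p \<Otimes>\<^sub>M borel)"
proof (induction n)
  case 0
  then show ?case by simp
next
  case (Suc n)
  note Suc[measurable]
  have "(\<lambda>x. (\<lambda>k x. \<Sum>i<k. born_count n (child (fst x) i) (snd x - fst (fst x []))) (snd (fst x [])) x)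
      \<in> borel_measurable (genealogy_law \<mu> p \<Otimes>\<^sub>M borel)"
    by (rule measurable_compose_countable) measurable
  then show ?case by (simp add: split_beta')
qed

lemma measurable_set_root[measurable]:
  "(\<lambda>(a, G). G([] := a)) \<in> particle_law \<mu> p \<Otimes>\<^sub>M genealogy_law \<mu> p \<rightarrow>\<^sub>M genealogy_law \<mu> p"
proof -
  have "(\<lambda>x. (snd x)([] := fst x)) \<in> particle_law \<mu> p \<Otimes>\<^sub>M genealogy_law \<mu> p \<rightarrow>\<^sub>M genealogy_law \<mu> p"
    unfolding genealogy_law_eq
    by (rule measurable_fun_upd[where J=UNIV]) auto
  then show ?thesis by (simp add: split_beta')
qed

text \<open>
  The branching property: replacing the root by an independent copy does not change the law, and the
  new root is independent of the trees of its children, which ignore the old root. Integrals over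
  genealogies can thus be computed by conditioning on the root.
\<close>

lemma genealogy_law_set_root:
  assumes "\<mu> > 0"
  shows "distr (particle_law \<mu> p \<Otimes>\<^sub>M genealogy_law \<mu> p) (genealogy_law \<mu> p) (\<lambda>(a, G). G([] := a)) =
    genealogy_law \<mu> p"
  using distr_pair_PiM_eq_PiM[of UNIV "\<lambda>_. particle_law \<mu> p" "[]"] prob_space_particle_law[OF assms]
  by (simp add: genealogy_law_eq)

lemma genealogy_law_child:
  assumes "\<mu> > 0"
  shows "distr (genealogy_law \<mu> p) (genealogy_law \<mu> p) (\<lambda>G. child G i) = genealogy_law \<mu> p"
  using distr_PiM_reindex[of UNIV "\<lambda>_. particle_law \<mu> p" "\<lambda>v. v @ [i]" UNIV]
    prob_space_particle_law[OF assms]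
  by (simp add: genealogy_law_eq inj_on_def child_def restrict_UNIV)

lemma child_set_root[simp]: "child (G([] := a)) i = child G i"
  by (simp add: child_def fun_eq_iff)

lemma nn_integral_exponential_discount:
  assumes "\<mu> > 0"
  shows "(\<integral>\<^sup>+T. ennreal (exp (- \<mu> * T)) \<partial>density lborel (exponential_density \<mu>)) = ennreal (1 / 2)"
proof -
  have "(\<integral>\<^sup>+T. ennreal (exp (- \<mu> * T)) \<partial>density lborel (exponential_density \<mu>)) =
     (\<integral>\<^sup>+T. ennreal (exponential_density \<mu> T) * ennreal (exp (- \<mu> * T)) \<partial>lborel)"
    by (subst nn_integral_density) auto
  also have "\<dots> = (\<integral>\<^sup>+T. ennreal (1/2) * ennreal (exponential_density (2 * \<mu>) T) \<partial>lborel)"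
    using assms
    by (intro nn_integral_cong)
       (auto simp: exponential_density_def field_simps simp flip: exp_add ennreal_mult' simp del: ennreal_half)
  also have "\<dots> = ennreal (1/2) * (\<integral>\<^sup>+T. ennreal (exponential_density (2 * \<mu>) T) \<partial>lborel)"
    by (intro nn_integral_cmult) auto
  also have "(\<integral>\<^sup>+T. ennreal (exponential_density (2 * \<mu>) T) \<partial>lborel) = 1"
    using prob_space.emeasure_space_1[OF prob_space_exponential_density[of "2*\<mu>"]] assms
    by (simp add: emeasure_density)
  finally show ?thesis by simp
qed

lemma nn_integral_genealogy_set_root:
  assumes "\<mu> > 0" and [measurable]: "f \<in> borel_measurable (genealogy_law \<mu> p)"
  shows "(\<integral>\<^sup>+G. f G \<partial>genealogy_law \<mu> p) =
    (\<integral>\<^sup>+a. \<integral>\<^sup>+G. f (G([] := a)) \<partial>genealogy_law \<mu> p \<partial>particle_law \<mu> p)"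
proof -
  interpret G: prob_space "genealogy_law \<mu> p" using assms by (intro prob_space_genealogy_law)
  have "(\<integral>\<^sup>+G. f G \<partial>genealogy_law \<mu> p) =
    (\<integral>\<^sup>+x. f ((\<lambda>(a, G). G([] := a)) x) \<partial>(particle_law \<mu> p \<Otimes>\<^sub>M genealogy_law \<mu> p))"
    by (subst genealogy_law_set_root[OF assms(1), symmetric]) (rule nn_integral_distr; measurable)
  also have "\<dots> = (\<integral>\<^sup>+a. \<integral>\<^sup>+G. f (G([] := a)) \<partial>genealogy_law \<mu> p \<partial>particle_law \<mu> p)"
    by (subst G.nn_integral_fst[symmetric]) auto
  finally show ?thesis .
qed

lemma nn_integral_child:
  assumes "\<mu> > 0" and [measurable]: "f \<in> borel_measurable (genealogy_law \<mu> p)"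
  shows "(\<integral>\<^sup>+G. f (child G i) \<partial>genealogy_law \<mu> p) = (\<integral>\<^sup>+G. f G \<partial>genealogy_law \<mu> p)"
  by (subst (2) genealogy_law_child[OF assms(1), of p i, symmetric]) (subst nn_integral_distr; simp)

lemma measurable_born_count_fixed[measurable]:
  "(\<lambda>G. born_count n G t) \<in> borel_measurable (genealogy_law \<mu> p)"
proof -
  have "(\<lambda>G. (\<lambda>(G, t). born_count n G t) (G, t)) \<in> borel_measurable (genealogy_law \<mu> p)"
    by measurable
  then show ?thesis by simp
qed

text \<open>
  With \<open>T\<close> the lifetime of the root, conditioning on the root multiplies the bound
  by \<open>E (exp (- \<mu> T)) = 1 / 2\<close> and by the mean number of children. The exponential bound holds for
  negative \<open>t\<close> as well, which makes it stable under the shift \<open>t - T\<close>.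
\<close>

lemma nn_integral_born_count_le:
  assumes \<mu>: "\<mu> > 0" and mean: "(\<integral>\<^sup>+k. of_nat k \<partial>measure_pmf p) \<le> 1"
  shows "(\<integral>\<^sup>+G. born_count n G t \<partial>genealogy_law \<mu> p) \<le> ennreal (exp (\<mu> * t) / 2 ^ n)"
proof (induction n arbitrary: t)
  case 0
  interpret G: prob_space "genealogy_law \<mu> p" using \<mu> by (intro prob_space_genealogy_law)
  have "ennreal 1 \<le> ennreal (exp (\<mu> * t))" if "0 \<le> t"
    using \<mu> that by (intro ennreal_leI) simp
  then show ?case
    using G.emeasure_space_1 by auto
next
  case (Suc n)
  have "(\<integral>\<^sup>+G. born_count (Suc n) G t \<partial>genealogy_law \<mu> p) =
    (\<integral>\<^sup>+a. \<integral>\<^sup>+G. (\<Sum>i<snd a. born_count n (child G i) (t - fst a)) \<partial>genealogy_law \<mu> p \<partial>particle_law \<mu> p)"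
    by (subst nn_integral_genealogy_set_root[OF \<mu> measurable_born_count_fixed])
       (simp only: born_count.simps fun_upd_same child_set_root)
  also have "\<dots> = (\<integral>\<^sup>+a. of_nat (snd a) * (\<integral>\<^sup>+G. born_count n G (t - fst a) \<partial>genealogy_law \<mu> p) \<partial>particle_law \<mu> p)"
  proof (intro nn_integral_cong)
    fix a :: "real \<times> nat"
    have "(\<integral>\<^sup>+G. (\<Sum>i<snd a. born_count n (child G i) (t - fst a)) \<partial>genealogy_law \<mu> p) =
        (\<Sum>i<snd a. \<integral>\<^sup>+G. born_count n (child G i) (t - fst a) \<partial>genealogy_law \<mu> p)"
      by (intro nn_integral_sum) measurable
    also have "\<dots> = (\<Sum>i<snd a. \<integral>\<^sup>+G. born_count n G (t - fst a) \<partial>genealogy_law \<mu> p)"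
      by (intro sum.cong refl nn_integral_child[OF \<mu>, of "\<lambda>G. born_count n G (t - fst a)"]) measurable
    finally show "(\<integral>\<^sup>+G. (\<Sum>i<snd a. born_count n (child G i) (t - fst a)) \<partial>genealogy_law \<mu> p) =
        of_nat (snd a) * (\<integral>\<^sup>+G. born_count n G (t - fst a) \<partial>genealogy_law \<mu> p)"
      by simp
  qed
  also have "\<dots> \<le> (\<integral>\<^sup>+a. of_nat (snd a) * ennreal (exp (\<mu> * (t - fst a)) / 2 ^ n) \<partial>particle_law \<mu> p)"
    by (intro nn_integral_mono mult_left_mono Suc) auto
  also have "\<dots> = (\<integral>\<^sup>+a. ennreal (exp (\<mu> * t) / 2 ^ n) * ennreal (exp (- \<mu> * fst a)) * of_nat (snd a) \<partial>particle_law \<mu> p)"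
  proof (intro nn_integral_cong)
    fix a :: "real \<times> nat"
    have "exp (\<mu> * (t - fst a)) = exp (\<mu> * t) * exp (- \<mu> * fst a)"
      by (simp add: right_diff_distrib exp_diff exp_minus field_simps)
    then show "of_nat (snd a) * ennreal (exp (\<mu> * (t - fst a)) / 2 ^ n) =
        ennreal (exp (\<mu> * t) / 2 ^ n) * ennreal (exp (- \<mu> * fst a)) * of_nat (snd a)"
      by (simp add: mult.commute flip: ennreal_mult')
  qed
  also have "\<dots> = (\<integral>\<^sup>+T. \<integral>\<^sup>+k. ennreal (exp (\<mu> * t) / 2 ^ n) * ennreal (exp (- \<mu> * T)) * of_nat k \<partial>measure_pmf p
      \<partial>density lborel (exponential_density \<mu>))"
  proof -
    have [measurable]: "(\<lambda>a. of_nat (snd a) :: ennreal) \<in>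
        borel_measurable (density lborel (exponential_density \<mu>) \<Otimes>\<^sub>M measure_pmf p)"
      by (rule measurable_compose[OF measurable_snd]) simp
    have [measurable]: "(\<lambda>a. ennreal (exp (- \<mu> * fst a))) \<in>
        borel_measurable (density lborel (exponential_density \<mu>) \<Otimes>\<^sub>M measure_pmf p)"
      by (rule measurable_compose[OF measurable_fst]) simp
    show ?thesis
      unfolding particle_law_def
    proof (subst measure_pmf.nn_integral_fst[symmetric])
      show "(\<lambda>a. ennreal (exp (\<mu> * t) / 2 ^ n) * ennreal (exp (- \<mu> * fst a)) * of_nat (snd a))
        \<in> borel_measurable (density lborel (\<lambda>x. ennreal (exponential_density \<mu> x)) \<Otimes>\<^sub>M measure_pmf p)"
        by (intro borel_measurable_times_ennreal measurable_const) (simp, fact+)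
    qed simp
  qed
  also have "\<dots> \<le> (\<integral>\<^sup>+T. ennreal (exp (\<mu> * t) / 2 ^ n) * ennreal (exp (- \<mu> * T)) * 1
      \<partial>density lborel (exponential_density \<mu>))"
  proof (intro nn_integral_mono)
    fix T :: real
    have "(\<integral>\<^sup>+k. ennreal (exp (\<mu> * t) / 2 ^ n) * ennreal (exp (- \<mu> * T)) * of_nat k \<partial>measure_pmf p) =
      ennreal (exp (\<mu> * t) / 2 ^ n) * ennreal (exp (- \<mu> * T)) * (\<integral>\<^sup>+k. of_nat k \<partial>measure_pmf p)"
      by (rule nn_integral_cmult) simp
    then show "(\<integral>\<^sup>+k. ennreal (exp (\<mu> * t) / 2 ^ n) * ennreal (exp (- \<mu> * T)) * of_nat k \<partial>measure_pmf p)
      \<le> ennreal (exp (\<mu> * t) / 2 ^ n) * ennreal (exp (- \<mu> * T)) * 1"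
      using mult_left_mono[OF mean] by (simp only:) simp
  qed
  also have "\<dots> = ennreal (exp (\<mu> * t) / 2 ^ n) * ennreal (1 / 2)"
    unfolding mult_1_right
    by (subst nn_integral_cmult) (simp, simp only: nn_integral_exponential_discount[OF \<mu>])
  also have "\<dots> = ennreal (exp (\<mu> * t) / 2 ^ Suc n)"
    by (subst ennreal_mult'[symmetric]) (simp_all add: mult.commute)
  finally show ?case .
qed

text \<open>
  The expected sizes of the generations born by time \<open>t\<close> decay geometrically, so their sum is almost
  surely finite.
\<close>

lemma AE_finite_alive:
  assumes \<mu>: "\<mu> > 0" and mean: "(\<integral>\<^sup>+k. of_nat k \<partial>measure_pmf p) \<le> 1"
  shows "AE G in genealogy_law \<mu> p. finite (alive G t)"
proof -
  have "(\<integral>\<^sup>+G. (\<Sum>n. born_count n G t) \<partial>genealogy_law \<mu> p) =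
      (\<Sum>n. \<integral>\<^sup>+G. born_count n G t \<partial>genealogy_law \<mu> p)"
    by (intro nn_integral_suminf) measurable
  also have "\<dots> \<le> (\<Sum>n. ennreal (exp (\<mu> * t) / 2 ^ n))"
    by (intro suminf_le nn_integral_born_count_le assms) auto
  also have "\<dots> < \<infinity>"
  proof -
    have "summable (\<lambda>n. exp (\<mu> * t) * (1 / 2) ^ n)"
      by (intro summable_mult summable_geometric) simp
    then have "(\<Sum>n. ennreal (exp (\<mu> * t) / 2 ^ n)) \<noteq> top"
      by (intro ennreal_suminf_neq_top) (simp_all add: power_one_over)
    then show ?thesis by (simp only: infinity_ennreal_def top.not_eq_extremum)
  qed
  finally have fin: "(\<integral>\<^sup>+G. (\<Sum>n. born_count n G t) \<partial>genealogy_law \<mu> p) \<noteq> \<infinity>"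
    by (rule less_imp_neq)
  have "AE G in genealogy_law \<mu> p. (\<Sum>n. born_count n G t) \<noteq> \<infinity>"
    by (rule nn_integral_PInf_AE[OF _ fin]) measurable
  then show ?thesis
  proof eventually_elim
    case (elim G)
    then show ?case
      using top.not_eq_extremum[of "\<Sum>n. born_count n G t"] by (intro finite_alive) simp
  qed
qed

lemma AE_lifetime_nonneg:
  assumes \<mu>: "\<mu> > 0"
  shows "AE G in genealogy_law \<mu> p. \<forall>v. 0 \<le> fst (G v)"
proof -
  have 1: "AE T in density lborel (exponential_density \<mu>). 0 \<le> T"
    by (subst AE_density) (auto simp: exponential_density_def)
  have "AE a in particle_law \<mu> p. 0 \<le> fst a"
  proof -
    interpret E: prob_space "density lborel (exponential_density \<mu>)"
      using \<mu> by (rule prob_space_exponential_density)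
    interpret E: pair_sigma_finite "density lborel (exponential_density \<mu>)" "measure_pmf p" ..
    show ?thesis
      unfolding particle_law_def
      by (rule E.AE_pair_measure) (use 1 in auto)
  qed
  then show ?thesis
    unfolding genealogy_law_eq AE_all_countable
    by (intro allI AE_PiM_component prob_space_particle_law \<mu>) simp_all
qed

text \<open>
  The trees of different children are read off from disjoint sets of addresses.
\<close>

lemma indep_vars_child:
  assumes \<mu>: "\<mu> > 0"
  shows "prob_space.indep_vars (genealogy_law \<mu> p) (\<lambda>_. genealogy_law \<mu> p) (\<lambda>i G. child G i) UNIV"
proof -
  let ?S = "particle_law \<mu> p" and ?H = "genealogy_law \<mu> p"
  interpret G: prob_space ?H using assms by (intro prob_space_genealogy_law)
  have comp: "distr ?H ?S (\<lambda>G. G v) = ?S" for v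
    unfolding genealogy_law_eq
    using prob_space_particle_law[OF \<mu>] by (intro distr_PiM_component) auto
  have [measurable]: "(\<lambda>G. G v) \<in> ?H \<rightarrow>\<^sub>M ?S" for v
    unfolding genealogy_law_eq by auto
  have "G.indep_vars (\<lambda>_. ?S) (\<lambda>v G. G v) UNIV"
    by (subst G.indep_vars_iff_distr_eq_PiM)
       (auto simp: comp[unfolded genealogy_law_eq] genealogy_law_eq restrict_UNIV)
  then have "G.indep_vars (\<lambda>i. PiM (range (\<lambda>v. v @ [i])) (\<lambda>_. ?S))
      (\<lambda>i G. restrict (\<lambda>v. G v) (range (\<lambda>v. v @ [i]))) UNIV"
    by (rule G.indep_vars_restrict) (auto simp: disjoint_family_on_def)
  then have "G.indep_vars (\<lambda>_. ?H)
      (\<lambda>i G. child (restrict (\<lambda>v. G v) (range (\<lambda>v. v @ [i]))) i) UNIV"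
    by (rule G.indep_vars_compose2)
       (auto simp: genealogy_law_eq child_def intro!: measurable_PiM_single' measurable_component_singleton simp: space_PiM space_particle_law)
  then show ?thesis
    by (simp add: child_def)
qed


section \<open>The generating function of the branching process\<close>

lemma measurable_population_fixed[measurable]:
  "(\<lambda>G. population G t) \<in> genealogy_law \<mu> p \<rightarrow>\<^sub>M count_space UNIV"
proof -
  have "(\<lambda>G. (\<lambda>(G, t). population G t) (G, t)) \<in> genealogy_law \<mu> p \<rightarrow>\<^sub>M count_space UNIV"
    by measurable
  then show ?thesis by simp
qed

lemma birth_time_nonneg: "(\<And>v. 0 \<le> fst (G v)) \<Longrightarrow> 0 \<le> birth_time G v"
  by (induction v) auto

text \<open>
  This is the right convention for the renewal equation, where a child that is not yet born
  contributes the factor 1. Lifetimes are nonnegative only almost surely, so even this needs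
  a null set.
\<close>

lemma mbp_F_negative_time:
  assumes \<mu>: "\<mu> > 0" and t: "t < 0"
  shows "mbp_F \<mu> p t s = 1"
proof -
  interpret G: prob_space "genealogy_law \<mu> p" using \<mu> by (rule prob_space_genealogy_law)
  have "AE G in genealogy_law \<mu> p. s ^ population G t = 1"
    using AE_lifetime_nonneg[OF \<mu>]
  proof eventually_elim
    case (elim G)
    then have "\<not> birth_time G v \<le> t" for v
      using birth_time_nonneg[of G v] t by auto
    then have "alive G t = {}" by (auto simp: alive_def)
    then show ?case by (simp add: population_eq_card_alive)
  qed
  then have "mbp_F \<mu> p t s = (LINT G|genealogy_law \<mu> p. 1)"
    unfolding mbp_F_def by (intro integral_cong_AE) auto
  then show ?thesis using G.prob_space by simp
qed

lemma integral_child_population: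
  assumes \<mu>: "\<mu> > 0"
  shows "(LINT G|genealogy_law \<mu> p. s ^ population (child G i) t) = mbp_F \<mu> p t s"
proof -
  have "mbp_F \<mu> p t s = (LINT G|distr (genealogy_law \<mu> p) (genealogy_law \<mu> p) (\<lambda>G. child G i). s ^ population G t)"
    unfolding mbp_F_def genealogy_law_child[OF \<mu>] ..
  also have "\<dots> = (LINT G|genealogy_law \<mu> p. s ^ population (child G i) t)"
    by (rule integral_distr) measurable
  finally show ?thesis ..
qed

text \<open>
  The conditional generating function given that the root is \<open>a\<close>. If the root is still alive at time
  \<open>t\<close>, its children have empty populations; otherwise the population is the sum over the
  independent trees of the children.
\<close>

lemma mbp_F_root_decomposition:
  assumes \<mu>: "\<mu> > 0" and mean: "(\<integral>\<^sup>+k. of_nat k \<partial>measure_pmf p) \<le> 1"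
    and s: "0 \<le> s" "s \<le> 1" and t: "0 \<le> t"
  shows "(LINT G|genealogy_law \<mu> p. s ^ population (G([] := a)) t) =
    (if t < fst a then s else mbp_F \<mu> p (t - fst a) s ^ snd a)"
proof -
  let ?H = "genealogy_law \<mu> p"
  interpret G: prob_space ?H using \<mu> by (rule prob_space_genealogy_law)
  have "AE G in distr ?H ?H (\<lambda>G. child G i). finite (alive G (t - fst a))" for i
    unfolding genealogy_law_child[OF \<mu>] by (rule AE_finite_alive[OF \<mu> mean])
  then have "AE G in ?H. finite (alive (child G i) (t - fst a))" for i
    by (rule AE_distrD[OF measurable_child])
  then have "AE G in ?H. \<forall>i. finite (alive (child G i) (t - fst a))"
    by (simp add: AE_all_countable)
  then have "AE G in ?H. s ^ population (G([] := a)) t =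
     (if t < fst a then s else 1) * (\<Prod>i<snd a. s ^ population (child G i) (t - fst a))"
  proof eventually_elim
    case (elim G)
    then show ?case
      using population_decomposition[of "G([] := a)" t] t by (simp add: power_add power_sum)
  qed
  moreover have "(\<lambda>G. G([] := a)) \<in> ?H \<rightarrow>\<^sub>M ?H"
  proof -
    have "(\<lambda>G. (\<lambda>(a, G). G([] := a)) (a, G)) \<in> ?H \<rightarrow>\<^sub>M ?H"
      using measurable_Pair1'[of a "particle_law \<mu> p" ?H] space_particle_law
      by (intro measurable_compose[OF _ measurable_set_root]) auto
    then show ?thesis by simp
  qed
  note [measurable] = this
  ultimately have "(LINT G|?H. s ^ population (G([] := a)) t) =
     (LINT G|?H. (if t < fst a then s else 1) * (\<Prod>i<snd a. s ^ population (child G i) (t - fst a)))"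
    by (intro integral_cong_AE) measurable
  also have "\<dots> = (if t < fst a then s else 1) * (LINT G|?H. (\<Prod>i<snd a. s ^ population (child G i) (t - fst a)))"
    by simp
  also have "(LINT G|?H. (\<Prod>i<snd a. s ^ population (child G i) (t - fst a))) =
     (\<Prod>i<snd a. LINT G|?H. s ^ population (child G i) (t - fst a))"
  proof (rule G.indep_vars_lebesgue_integral)
    show "G.indep_vars (\<lambda>_. borel) (\<lambda>i G. s ^ population (child G i) (t - fst a)) {..<snd a}"
      by (rule G.indep_vars_compose2[OF G.indep_vars_subset[OF indep_vars_child[OF \<mu>]]]) auto
    fix i
    show "integrable ?H (\<lambda>G. s ^ population (child G i) (t - fst a))"
      using s by (intro G.integrable_const_bound[where B=1]) (auto simp: power_le_one)
  qed auto
  also have "\<dots> = mbp_F \<mu> p (t - fst a) s ^ snd a"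
    by (simp add: integral_child_population[OF \<mu>])
  finally show ?thesis
    using mbp_F_negative_time[OF \<mu>, of "t - fst a" p s] by (auto simp del: fun_upd_apply)
qed

lemma mbp_F_bounds:
  assumes \<mu>: "\<mu> > 0" and s: "0 \<le> s" "s \<le> 1"
  shows "0 \<le> mbp_F \<mu> p t s" "mbp_F \<mu> p t s \<le> 1"
proof -
  interpret G: prob_space "genealogy_law \<mu> p" using \<mu> by (rule prob_space_genealogy_law)
  show "0 \<le> mbp_F \<mu> p t s" unfolding mbp_F_def using s by simp
  show "mbp_F \<mu> p t s \<le> 1" unfolding mbp_F_def using s
    by (intro G.integral_le_const G.integrable_const_bound[where B=1]) (auto simp: power_le_one)
qed

lemma measurable_mbp_F[measurable]:
  assumes \<mu>: "\<mu> > 0"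
  shows "(\<lambda>t. mbp_F \<mu> p t s) \<in> borel_measurable borel"
proof -
  interpret G: prob_space "genealogy_law \<mu> p" using \<mu> by (rule prob_space_genealogy_law)
  have [measurable]: "(\<lambda>(t, G). population G t) \<in> borel \<Otimes>\<^sub>M genealogy_law \<mu> p \<rightarrow>\<^sub>M count_space UNIV"
    using measurable_compose[OF measurable_pair_swap' measurable_population]
    by (simp add: split_beta')
  show ?thesis
    unfolding mbp_F_def by measurable
qed

lemma measurable_pgf[measurable]: "pgf p \<in> borel_measurable borel"
proof -
  have "(\<lambda>z :: real \<times> nat. (\<lambda>k z. fst z ^ k) (snd z) z) \<in> borel_measurable (borel \<Otimes>\<^sub>M count_space UNIV)"
    by (rule measurable_compose_countable) auto
  then have [measurable]: "(\<lambda>(x :: real, k). x ^ k) \<in> borel_measurable (borel \<Otimes>\<^sub>M measure_pmf p)"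
    by (subst measurable_cong_sets[OF sets_pair_measure_cong[OF refl sets_measure_pmf_count_space] refl])
       (simp add: split_beta')
  have "(\<lambda>s::real. LINT k|measure_pmf p. s ^ k) \<in> borel_measurable borel"
    by (rule measure_pmf.borel_measurable_lebesgue_integral) measurable
  then show ?thesis by (simp add: pgf_def[abs_def])
qed

lemma pgf_integrable: "0 \<le> x \<Longrightarrow> x \<le> 1 \<Longrightarrow> integrable (measure_pmf p) (\<lambda>k. (x::real) ^ k)"
  by (intro measure_pmf.integrable_const_bound[where B=1]) (auto simp: power_le_one)

lemma pgf_bounds: assumes "0 \<le> x" "x \<le> 1" shows "0 \<le> pgf p x" "pgf p x \<le> 1"
  unfolding pgf_def using assms
  by (auto intro!: measure_pmf.integral_le_const integral_nonneg_AE pgf_integrable simp: power_le_one)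

lemma pgf_1[simp]: "pgf p 1 = 1"
  by (simp add: pgf_def)

lemma continuous_on_pgf: "continuous_on {0..1} (pgf p)"
proof (rule continuous_on_sequentiallyI)
  fix u and a :: real assume u: "\<forall>n. u n \<in> {0..1}" "u \<longlonglongrightarrow> a"
  show "(\<lambda>n. pgf p (u n)) \<longlonglongrightarrow> pgf p a"
    unfolding pgf_def
    by (rule integral_dominated_convergence[where w="\<lambda>_. 1"])
       (use u in \<open>auto intro!: tendsto_intros simp: power_le_one\<close>)
qed

text \<open>
  The renewal equation: the root either survives time \<open>t\<close>, with probability \<open>exp (- \<mu> t)\<close>, or dies
  at time \<open>t - v\<close> and leaves independent copies of the process with time \<open>v\<close> to go.
\<close>

lemma mbp_F_integral_equation:
  assumes \<mu>: "\<mu> > 0" and mean: "(\<integral>\<^sup>+k. of_nat k \<partial>measure_pmf p) \<le> 1"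
    and s: "0 \<le> s" "s \<le> 1" and t: "0 \<le> t"
  shows "mbp_F \<mu> p t s = exp (- \<mu> * t) *
     (s + integral {0..t} (\<lambda>v. \<mu> * exp (\<mu> * v) * pgf p (mbp_F \<mu> p v s)))"
proof -
  let ?H = "genealogy_law \<mu> p" and ?S = "particle_law \<mu> p"
  let ?E = "density lborel (exponential_density \<mu>)"
  define h where "h v = pgf p (mbp_F \<mu> p v s)" for v
  interpret G: prob_space ?H using \<mu> by (rule prob_space_genealogy_law)
  interpret S: prob_space ?S using \<mu> by (rule prob_space_particle_law)
  interpret E: prob_space ?E using \<mu> by (rule prob_space_exponential_density)
  interpret SH: pair_prob_space ?S ?H ..
  interpret Ep: pair_prob_space ?E "measure_pmf p" ..
  note [measurable] = measurable_mbp_F[OF \<mu>]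
  have [measurable]: "h \<in> borel_measurable borel" unfolding h_def by measurable
  have F01: "0 \<le> mbp_F \<mu> p v s" "mbp_F \<mu> p v s \<le> 1" for v
    using mbp_F_bounds[OF \<mu> s] by auto
  have h01: "0 \<le> h v" "h v \<le> 1" for v
    using pgf_bounds[OF F01] by (auto simp: h_def)
  have "mbp_F \<mu> p t s = (LINT x|(?S \<Otimes>\<^sub>M ?H). s ^ population ((\<lambda>(a, G). G([] := a)) x) t)"
    unfolding mbp_F_def by (subst genealogy_law_set_root[OF \<mu>, symmetric]) (rule integral_distr; measurable)
  also have "\<dots> = (LINT x|(?S \<Otimes>\<^sub>M ?H). (case x of (a, G) \<Rightarrow> s ^ population (G([] := a)) t))"
    by (intro Bochner_Integration.integral_cong) auto
  also have "\<dots> = (LINT a|?S. LINT G|?H. s ^ population (G([] := a)) t)"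
  proof (rule SH.integral_fst[symmetric])
    have "(\<lambda>x. s ^ population ((\<lambda>(a, G). G([] := a)) x) t) \<in> borel_measurable (?S \<Otimes>\<^sub>M ?H)"
      by measurable
    then show "integrable (?S \<Otimes>\<^sub>M ?H) (\<lambda>(a, G). s ^ population (G([] := a)) t)"
      using s by (intro SH.integrable_const_bound[where B=1]) (auto simp: power_le_one split_beta')
  qed
  also have "\<dots> = (LINT a|?S. (if t < fst a then s else mbp_F \<mu> p (t - fst a) s ^ snd a))"
    using mbp_F_root_decomposition[OF \<mu> mean s t] by simp
  also have "\<dots> = (LINT x|(?E \<Otimes>\<^sub>M measure_pmf p). (case x of (T, k) \<Rightarrow> (if t < T then s else mbp_F \<mu> p (t - T) s ^ k)))"
    unfolding particle_law_def by (intro Bochner_Integration.integral_cong) auto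
  also have "\<dots> = (LINT T|?E. LINT k|measure_pmf p. (if t < T then s else mbp_F \<mu> p (t - T) s ^ k))"
  proof (rule Ep.integral_fst[symmetric])
    have "(\<lambda>z. (\<lambda>k z. if t < fst z then s else mbp_F \<mu> p (t - fst z) s ^ k) (snd z) z) \<in>
        borel_measurable (borel \<Otimes>\<^sub>M count_space UNIV)"
      by (rule measurable_compose_countable) auto
    then have "(\<lambda>(T, k). if t < T then s else mbp_F \<mu> p (t - T) s ^ k) \<in> borel_measurable (?E \<Otimes>\<^sub>M measure_pmf p)"
      by (subst measurable_cong_sets[OF sets_pair_measure_cong[of ?E borel, OF _ sets_measure_pmf_count_space] refl])
         (simp_all add: split_beta')
    then show "integrable (?E \<Otimes>\<^sub>M measure_pmf p) (\<lambda>(T, k). if t < T then s else mbp_F \<mu> p (t - T) s ^ k)"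
      using s F01 by (intro Ep.integrable_const_bound[where B=1]) (auto simp: power_le_one)
  qed
  also have "\<dots> = (LINT T|?E. (if t < T then s else h (t - T)))"
    by (intro Bochner_Integration.integral_cong) (auto simp: h_def pgf_def)
  also have "\<dots> = (LINT T|lborel. exponential_density \<mu> T * (if t < T then s else h (t - T)))"
    using \<mu> by (subst integral_density) (auto simp: exponential_density_nonneg)
  also have "\<dots> = (LINT T|lborel. s * (indicator {t<..} T * exponential_density \<mu> T) +
      indicator {0..t} T * (\<mu> * exp (- \<mu> * T) * h (t - T)))"
    by (intro Bochner_Integration.integral_cong)
       (use t in \<open>auto simp: exponential_density_def indicator_def ac_simps\<close>)
  also have "\<dots> = s * (LINT T|lborel. indicator {t<..} T * exponential_density \<mu> T) +
      (LINT T|lborel. indicator {0..t} T * (\<mu> * exp (- \<mu> * T) * h (t - T)))"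
  proof (subst Bochner_Integration.integral_add)
    have ied: "integrable lborel (exponential_density \<mu>)"
    proof -
      have "integrable ?E (\<lambda>_. 1::real)" by simp
      then show ?thesis
        using \<mu> by (subst (asm) integrable_density) (auto simp: exponential_density_nonneg)
    qed
    show "integrable lborel (\<lambda>T. s * (indicator {t<..} T * exponential_density \<mu> T))"
      using integrable_mult_indicator[OF _ ied, of "{t<..}"] by (intro integrable_mult_right) simp
    show "integrable lborel (\<lambda>T. indicator {0..t} T * (\<mu> * exp (- \<mu> * T) * h (t - T)))"
    proof (rule Bochner_Integration.integrable_bound[OF ied])
      show "AE x in lborel. norm (indicator {0..t} x * (\<mu> * exp (- \<mu> * x) * h (t - x))) \<le> norm (exponential_density \<mu> x)"
        using \<mu> h01 by (intro AE_I2) (auto simp: exponential_density_def indicator_def abs_mult mult_left_le ac_simps mult_left_mono)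
    qed measurable
  qed simp
  also have "(LINT T|lborel. indicator {t<..} T * exponential_density \<mu> T) = exp (- \<mu> * t)"
  proof -
    have "(LINT T|lborel. indicator {t<..} T * exponential_density \<mu> T) = (LINT T|?E. indicator {t<..} T)"
      using \<mu> by (subst integral_density) (auto simp: exponential_density_nonneg mult.commute)
    also have "\<dots> = measure ?E {t<..}" by simp
    also have "\<dots> = exp (- \<mu> * t)"
    proof -
      have "distributed ?E lborel (\<lambda>x. x) (exponential_density \<mu>)"
        by (auto simp: distributed_def intro: distr_id2)
      from E.exponential_distributedD_gt[OF this t \<mu>] show ?thesis
        by (simp add: greaterThan_def[symmetric] mult.commute)
    qed
    finally show ?thesis .
  qed
  also have "(LINT T|lborel. indicator {0..t} T * (\<mu> * exp (- \<mu> * T) * h (t - T))) =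
     (LINT v|lborel. indicator {0..t} (t - v) * (\<mu> * exp (- \<mu> * (t - v)) * h v))"
    by (subst lborel_integral_real_affine[where c="-1" and t=t]) auto
  also have "\<dots> = (LINT v|lborel. exp (- \<mu> * t) * (indicator {0..t} v * (\<mu> * exp (\<mu> * v) * h v)))"
    by (intro Bochner_Integration.integral_cong)
       (auto simp: indicator_def right_diff_distrib exp_diff exp_minus field_simps)
  also have "\<dots> = exp (- \<mu> * t) * (LINT v:{0..t}|lborel. \<mu> * exp (\<mu> * v) * h v)"
    by (simp add: set_lebesgue_integral_def)
  also have "(LINT v:{0..t}|lborel. \<mu> * exp (\<mu> * v) * h v) = integral {0..t} (\<lambda>v. \<mu> * exp (\<mu> * v) * h v)"
  proof (rule set_borel_integral_eq_integral(2))
    show "set_integrable lborel {0..t} (\<lambda>v. \<mu> * exp (\<mu> * v) * h v)"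
      unfolding set_integrable_def
    proof (rule Bochner_Integration.integrable_bound)
      show "integrable lborel (\<lambda>v. indicator {0..t} v * (\<mu> * exp (\<mu> * t)))"
        by (simp add: integrable_indicator_iff emeasure_lborel_Icc_eq)
      show "AE v in lborel. norm (indicator {0..t} v *\<^sub>R (\<mu> * exp (\<mu> * v) * h v)) \<le> norm (indicator {0..t} v * (\<mu> * exp (\<mu> * t)))"
      proof (intro AE_I2)
        fix v
        have "exp (\<mu> * v) * h v \<le> exp (\<mu> * t) * 1" if "v \<le> t"
          using \<mu> h01[of v] that by (intro mult_mono) auto
        then show "norm (indicator {0..t} v *\<^sub>R (\<mu> * exp (\<mu> * v) * h v)) \<le> norm (indicator {0..t} v * (\<mu> * exp (\<mu> * t)))"
          using \<mu> h01[of v] by (auto simp: indicator_def abs_mult)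
      qed
    qed measurable
  qed
  finally show ?thesis
    by (simp add: h_def algebra_simps)
qed

lemma critical_mean:
  assumes "measure_pmf.expectation p real = 1"
  shows "integrable (measure_pmf p) real" "(\<integral>\<^sup>+k. of_nat k \<partial>measure_pmf p) \<le> 1"
proof -
  show i: "integrable (measure_pmf p) real"
    using assms not_integrable_integral_eq by fastforce
  have "(\<integral>\<^sup>+k. ennreal (real k) \<partial>measure_pmf p) = ennreal (measure_pmf.expectation p real)"
    by (rule nn_integral_eq_integral[OF i]) auto
  then show "(\<integral>\<^sup>+k. of_nat k \<partial>measure_pmf p) \<le> 1"
    using assms by (simp add: ennreal_of_nat_eq_real_of_nat)
qed

lemma pgf_mono: "0 \<le> x \<Longrightarrow> x \<le> y \<Longrightarrow> y \<le> 1 \<Longrightarrow> pgf p x \<le> pgf p y"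
  unfolding pgf_def by (intro integral_mono pgf_integrable power_mono) auto

lemma power_diff_le:
  fixes x y :: real
  assumes "0 \<le> x" "x \<le> y" "y \<le> 1"
  shows "y ^ k - x ^ k \<le> real k * (y - x)"
proof (induction k)
  case (Suc k)
  have "y ^ Suc k - x ^ Suc k = y * (y ^ k - x ^ k) + (y - x) * x ^ k"
    by (simp add: algebra_simps)
  also have "\<dots> \<le> 1 * (y ^ k - x ^ k) + (y - x) * 1"
    using assms by (intro add_mono mult_mono mult_left_mono power_le_one) (auto intro: power_mono)
  also have "\<dots> \<le> real (Suc k) * (y - x)"
    using Suc by (simp add: algebra_simps)
  finally show ?case .
qed simp

lemma pgf_diff_le:
  assumes crit: "measure_pmf.expectation p real = 1" and "0 \<le> x" "x \<le> y" "y \<le> 1"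
  shows "pgf p y - pgf p x \<le> y - x"
proof -
  have "pgf p y - pgf p x = measure_pmf.expectation p (\<lambda>k. y ^ k - x ^ k)"
    unfolding pgf_def using assms by (subst Bochner_Integration.integral_diff) (auto intro: pgf_integrable)
  also have "\<dots> \<le> measure_pmf.expectation p (\<lambda>k. real k * (y - x))"
    using assms power_diff_le[of x y] critical_mean(1)[OF crit]
    by (intro integral_mono Bochner_Integration.integrable_diff pgf_integrable integrable_mult_left) auto
  also have "\<dots> = y - x" using crit critical_mean(1)[OF crit] by simp
  finally show ?thesis .
qed

lemma critical_pgf_ge:
  assumes crit: "measure_pmf.expectation p real = 1" and "0 \<le> x" "x \<le> 1"
  shows "x \<le> pgf p x"
  using pgf_diff_le[OF crit, of x 1] assms by simp

lemma pgf_convex: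
  assumes "0 \<le> x" "x \<le> 1" "0 \<le> c" "c \<le> 1"
  shows "pgf p ((1 - c) * x + c) \<le> (1 - c) * pgf p x + c"
proof -
  have e: "0 \<le> (1 - c) * x + c" "(1 - c) * x + c \<le> 1"
  proof -
    have "(1 - c) * x \<le> (1 - c) * 1" using assms by (intro mult_left_mono) auto
    then show "(1 - c) * x + c \<le> 1" by simp
  qed (use assms in auto)
  have "pgf p ((1 - c) * x + c) \<le> measure_pmf.expectation p (\<lambda>k. (1 - c) * x ^ k + c)"
    unfolding pgf_def
  proof (intro integral_mono pgf_integrable e Bochner_Integration.integrable_add integrable_mult_right)
    fix k
    show "((1 - c) * x + c) ^ k \<le> (1 - c) * x ^ k + c"
    proof (induction k)
      case (Suc k)
      have "((1 - c) * x + c) ^ Suc k \<le> ((1 - c) * x + c) * ((1 - c) * x ^ k + c)"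
        using Suc e by (simp add: mult_left_mono)
      also have "\<dots> = (1 - c) * x ^ Suc k + c - c * (1 - c) * ((1 - x) * (1 - x ^ k))"
        by (simp add: algebra_simps)
      also have "\<dots> \<le> (1 - c) * x ^ Suc k + c"
        using assms by (simp add: power_le_one)
      finally show ?case .
    qed simp
  qed (use assms in auto)
  also have "\<dots> = (1 - c) * pgf p x + c"
    unfolding pgf_def using pgf_integrable[of x p] assms by simp
  finally show ?thesis .
qed

text \<open>
  A fixed point \<open>x < 1\<close> would, by convexity and \<open>f(1) = 1\<close>, force \<open>f(y) \<le> y\<close> on all of \<open>[x, 1]\<close>.
  The witness \<open>y\<close> is later taken where the slowly varying factor is positive, which is only known
  near 1.
\<close>

lemma critical_pgf_gt:
  assumes crit: "measure_pmf.expectation p real = 1" and x: "0 \<le> x" "x < 1"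
    and y: "x \<le> y" "y < 1" "y < pgf p y"
  shows "x < pgf p x"
proof (rule ccontr)
  assume "\<not> x < pgf p x"
  then have eq: "pgf p x = x" using critical_pgf_ge[OF crit, of x] x by simp
  define c where "c = (y - x) / (1 - x)"
  have "c * (1 - x) = y - x" using x by (simp add: c_def)
  then have c: "(1 - c) * x + c = y" "0 \<le> c" "c \<le> 1"
    using x y by (simp add: algebra_simps, simp_all add: c_def)
  show False
    using pgf_convex[of x c p] x c y eq by simp
qed

text \<open>
  The integral equation bootstraps regularity: its integrand is bounded and measurable, so \<open>F\<close> is
  continuous; then the integrand is continuous, so \<open>F\<close> is differentiable.
\<close>

lemma mbp_F_continuous_derivative:
  assumes \<mu>: "\<mu> > 0" and mean: "(\<integral>\<^sup>+k. of_nat k \<partial>measure_pmf p) \<le> 1"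
    and s: "0 \<le> s" "s \<le> 1" and t: "t \<in> {0..b}"
  shows "((\<lambda>t. mbp_F \<mu> p t s) has_real_derivative \<mu> * (pgf p (mbp_F \<mu> p t s) - mbp_F \<mu> p t s))
      (at t within {0..b})"
    and "continuous_on {0..b} (\<lambda>t. mbp_F \<mu> p t s)"
proof -
  let ?F = "\<lambda>t. mbp_F \<mu> p t s"
  let ?g = "\<lambda>v. \<mu> * exp (\<mu> * v) * pgf p (?F v)"
  have eq: "?F t = exp (- \<mu> * t) * (s + integral {0..t} ?g)" if "t \<in> {0..b}" for t
    using that by (intro mbp_F_integral_equation[OF \<mu> mean s]) auto
  note [measurable] = measurable_mbp_F[OF \<mu>]
  have F01: "?F t \<in> {0..1}" for t using mbp_F_bounds[OF \<mu> s] by auto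
  have "set_integrable lborel {0..b} ?g"
    unfolding set_integrable_def
  proof (rule Bochner_Integration.integrable_bound)
    show "integrable lborel (\<lambda>v. indicator {0..b} v * (\<mu> * exp (\<mu> * b)))"
      by (simp add: integrable_indicator_iff emeasure_lborel_Icc_eq)
    show "AE v in lborel. norm (indicator {0..b} v *\<^sub>R ?g v) \<le> norm (indicator {0..b} v * (\<mu> * exp (\<mu> * b)))"
    proof (intro AE_I2)
      fix v
      have h: "0 \<le> pgf p (?F v)" "pgf p (?F v) \<le> 1" using pgf_bounds[of "?F v" p] F01[of v] by auto
      then have "exp (\<mu> * v) * pgf p (?F v) \<le> exp (\<mu> * b) * 1" if "v \<le> b"
        using \<mu> that by (intro mult_mono) auto
      then show "norm (indicator {0..b} v *\<^sub>R ?g v) \<le> norm (indicator {0..b} v * (\<mu> * exp (\<mu> * b)))"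
        using \<mu> h by (auto simp: indicator_def abs_mult)
    qed
  qed measurable
  then have int: "?g integrable_on {0..b}"
    by (rule set_borel_integral_eq_integral(1))
  have "continuous_on {0..b} (\<lambda>t. exp (- \<mu> * t) * (s + integral {0..t} ?g))"
    by (intro continuous_intros indefinite_integral_continuous_1 int)
  then show cont: "continuous_on {0..b} ?F"
    using eq by (subst continuous_on_cong[OF refl]) auto
  have contg: "continuous_on {0..b} ?g"
    by (intro continuous_intros continuous_on_compose2[OF continuous_on_pgf] cont) (use F01 in auto)
  have "((\<lambda>t. exp (- \<mu> * t) * (s + integral {0..t} ?g)) has_real_derivative
      exp (- \<mu> * t) * ?g t + (exp (- \<mu> * t) * (- \<mu>)) * (s + integral {0..t} ?g)) (at t within {0..b})"
    by (rule derivative_eq_intros integral_has_real_derivative contg t refl)+ (simp add: algebra_simps)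
  also have "exp (- \<mu> * t) * ?g t + (exp (- \<mu> * t) * (- \<mu>)) * (s + integral {0..t} ?g) =
      \<mu> * (pgf p (?F t) - (exp (- \<mu> * t) * (s + integral {0..t} ?g)))"
    by (simp add: algebra_simps flip: exp_add)
  also have "\<dots> = \<mu> * (pgf p (?F t) - ?F t)" using eq[OF t] by simp
  finally show "(?F has_real_derivative \<mu> * (pgf p (?F t) - ?F t)) (at t within {0..b})"
    by (rule has_field_derivative_transform_within[OF _ zero_less_one t]) (simp add: eq)
qed

lemma mbp_F_0:
  assumes \<mu>: "\<mu> > 0" and mean: "(\<integral>\<^sup>+k. of_nat k \<partial>measure_pmf p) \<le> 1"
    and s: "0 \<le> s" "s \<le> 1"
  shows "mbp_F \<mu> p 0 s = s"
  using mbp_F_integral_equation[OF assms, of 0] by simp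

text \<open>
  With probability \<open>exp (- \<mu> t)\<close> the root is still alive at time \<open>t\<close>. This keeps \<open>F\<close> away
  from 1, where \<open>1 / (f(u) - u)\<close> is not integrable.
\<close>

lemma mbp_F_less_1:
  assumes \<mu>: "\<mu> > 0" and mean: "(\<integral>\<^sup>+k. of_nat k \<partial>measure_pmf p) \<le> 1"
    and s: "0 \<le> s" "s < 1" and t: "0 \<le> t"
  shows "mbp_F \<mu> p t s \<le> 1 - (1 - s) * exp (- \<mu> * t)"
proof -
  let ?F = "\<lambda>t. mbp_F \<mu> p t s"
  have s1: "s \<le> 1" using s by simp
  have F01: "?F t \<in> {0..1}" for t using mbp_F_bounds[OF \<mu> s(1) s1] by auto
  have contg: "continuous_on {0..t} (\<lambda>v. \<mu> * exp (\<mu> * v) * pgf p (?F v))"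
    by (intro continuous_intros continuous_on_compose2[OF continuous_on_pgf]
        mbp_F_continuous_derivative(2)[OF \<mu> mean s(1) s1, of 0]) (use F01 t in auto)
  have contp: "continuous_on {0..t} (\<lambda>v. pgf p (?F v))"
    by (intro continuous_on_compose2[OF continuous_on_pgf]
        mbp_F_continuous_derivative(2)[OF \<mu> mean s(1) s1, of 0]) (use F01 t in auto)
  have ex: "((\<lambda>v. \<mu> * exp (\<mu> * v)) has_integral (exp (\<mu> * t) - exp (\<mu> * 0))) {0..t}"
    by (rule fundamental_theorem_of_calculus)
       (auto intro!: derivative_eq_intros simp flip: has_real_derivative_iff_has_vector_derivative, use t in simp)
  have "integral {0..t} (\<lambda>v. \<mu> * exp (\<mu> * v) * pgf p (?F v)) \<le> integral {0..t} (\<lambda>v. \<mu> * exp (\<mu> * v))"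
    using \<mu> F01 pgf_bounds[of _ p] contg contp
    by (intro integral_le integrable_continuous_interval continuous_intros) (auto simp: mult_left_le)
  also have "\<dots> = exp (\<mu> * t) - 1" unfolding integral_unique[OF ex] by simp
  finally have "?F t \<le> exp (- \<mu> * t) * (s + (exp (\<mu> * t) - 1))"
    unfolding mbp_F_integral_equation[OF \<mu> mean s(1) s1 t] by (intro mult_left_mono add_left_mono) auto
  also have "\<dots> = 1 - (1 - s) * exp (- \<mu> * t)"
    by (simp add: algebra_simps flip: exp_add)
  finally show ?thesis .
qed

lemma offspring_primitive_derivative:
  assumes gt: "\<And>x. 0 \<le> x \<Longrightarrow> x < 1 \<Longrightarrow> x < pgf p x" and b: "b < 1" "y \<in> {0..b}"
  shows "((\<lambda>y. integral {0..y} (\<lambda>u. 1 / (pgf p u - u))) has_real_derivative 1 / (pgf p y - y)) (at y within {0..b})"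
proof (rule integral_has_real_derivative[OF _ b(2)])
  have "pgf p u - u \<noteq> 0" if "u \<in> {0..b}" for u using gt[of u] that b by auto
  then show "continuous_on {0..b} (\<lambda>u. 1 / (pgf p u - u))"
    using b by (intro continuous_intros continuous_on_subset[OF continuous_on_pgf]) auto
qed

text \<open>
  Separation of variables: the primitive of \<open>1 / (f(u) - u)\<close> grows along \<open>F\<close> at the constant
  rate \<open>\<mu>\<close>. The primitive is evaluated at \<open>F = 1 - 1 / x\<close>, which is how \<^const>\<open>mbp_V\<close> is scaled.
\<close>

theorem mbp_V_mbp_F:
  assumes \<mu>: "\<mu> > 0" and mean: "(\<integral>\<^sup>+k. of_nat k \<partial>measure_pmf p) \<le> 1"
    and gt: "\<And>x. 0 \<le> x \<Longrightarrow> x < 1 \<Longrightarrow> x < pgf p x"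
    and s: "0 \<le> s" "s < 1" and t: "0 \<le> t"
  shows "mbp_V p (1 / (1 - mbp_F \<mu> p t s)) = \<mu> * t + mbp_V p (1 / (1 - s))"
proof -
  let ?F = "\<lambda>t. mbp_F \<mu> p t s"
  let ?P = "\<lambda>y. integral {0..y} (\<lambda>u. 1 / (pgf p u - u))"
  define b where "b = 1 - (1 - s) * exp (- \<mu> * t)"
  have s1: "s \<le> 1" using s by simp
  have b1: "b < 1" using s by (simp add: b_def)
  have Fb: "?F v \<in> {0..b}" if "v \<in> {0..t}" for v
  proof -
    have "(1 - s) * exp (- \<mu> * t) \<le> (1 - s) * exp (- \<mu> * v)"
      using that \<mu> s by (intro mult_left_mono) auto
    then show ?thesis
      using mbp_F_less_1[OF \<mu> mean s, of v] mbp_F_bounds(1)[OF \<mu> s(1) s1, of p v] that by (auto simp: b_def)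
  qed
  have "((\<lambda>v. ?P (?F v) - \<mu> * v) has_real_derivative 0) (at v within {0..t})" if v: "v \<in> {0..t}" for v
  proof -
    have ne: "pgf p (?F v) - ?F v \<noteq> 0" using gt[of "?F v"] Fb[OF v] b1 by auto
    have "(?P has_real_derivative 1 / (pgf p (?F v) - ?F v)) (at (?F v) within ?F ` {0..t})"
      using Fb by (intro DERIV_subset[OF offspring_primitive_derivative[OF gt b1 Fb[OF v]]]) auto
    from DERIV_image_chain[OF this mbp_F_continuous_derivative(1)[OF \<mu> mean s(1) s1 v]]
    have "((\<lambda>v. ?P (?F v)) has_real_derivative \<mu>) (at v within {0..t})"
      using ne by (simp add: o_def)
    from DERIV_diff[OF this DERIV_cmult_Id[of \<mu>]] show ?thesis by simp
  qed
  from has_field_derivative_zero_constant[OF convex_real_interval(5) this]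
  obtain c where c: "\<And>v. v \<in> {0..t} \<Longrightarrow> ?P (?F v) - \<mu> * v = c" by metis
  have "?P (?F t) = \<mu> * t + ?P s"
    using c[of 0] c[of t] t mbp_F_0[OF \<mu> mean s(1) s1] by simp
  then show ?thesis by (simp add: mbp_V_def)
qed

text \<open>
  Surjectivity is a consequence of the previous theorem: with \<open>\<mu> = 1\<close> and \<open>s = 0\<close> the value \<open>y\<close> is
  attained at \<open>1 / (1 - F(y;0))\<close>.
\<close>

theorem mbp_V_properties:
  assumes mean: "(\<integral>\<^sup>+k. of_nat k \<partial>measure_pmf p) \<le> 1"
    and gt: "\<And>x. 0 \<le> x \<Longrightarrow> x < 1 \<Longrightarrow> x < pgf p x"
  shows "mbp_V p 1 = 0"
    and "\<And>x y. 1 \<le> x \<Longrightarrow> x < y \<Longrightarrow> mbp_V p x < mbp_V p y"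
    and "\<And>x. 1 < x \<Longrightarrow>
      (mbp_V p has_real_derivative 1 / (x\<^sup>2 * (pgf p (1 - 1 / x) - (1 - 1 / x)))) (at x)"
    and "\<And>y. 0 \<le> y \<Longrightarrow> \<exists>x\<ge>1. mbp_V p x = y"
proof -
  let ?P = "\<lambda>y. integral {0..y} (\<lambda>u. 1 / (pgf p u - u))"
  show V1: "mbp_V p 1 = 0" by (simp add: mbp_V_def)
  show "mbp_V p x < mbp_V p y" if xy: "1 \<le> x" "x < y" for x y
  proof -
    define a b where "a = 1 - 1 / x" and "b = 1 - 1 / y"
    have ab: "0 \<le> a" "a < b" "b < 1" using xy by (auto simp: a_def b_def field_simps)
    have "?P a < ?P b"
    proof (rule DERIV_pos_imp_increasing_open[OF ab(2)])
      show "\<exists>d. (?P has_real_derivative d) (at x) \<and> 0 < d" if "a < x" "x < b" for x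
        using offspring_primitive_derivative[OF gt ab(3), of x] gt[of x] that ab
        by (intro exI[of _ "1 / (pgf p x - x)"]) (simp add: at_within_Icc_at)
      have "continuous_on {0..b} ?P"
        using offspring_primitive_derivative[OF gt ab(3)]
        by (intro DERIV_continuous_on)
      then show "continuous_on {a..b} ?P"
        by (rule continuous_on_subset) (use ab in auto)
    qed
    then show ?thesis by (simp add: mbp_V_def a_def b_def)
  qed
  show "(mbp_V p has_real_derivative 1 / (x\<^sup>2 * (pgf p (1 - 1 / x) - (1 - 1 / x)))) (at x)" if x: "1 < x" for x
  proof -
    define y b where "y = 1 - 1 / x" and "b = (1 + y) / 2"
    have yb: "0 < y" "y < b" "b < 1" using x by (auto simp: y_def b_def field_simps)
    have "(?P has_real_derivative 1 / (pgf p y - y)) (at y within {0..b})"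
      using yb by (intro offspring_primitive_derivative gt) auto
    then have P: "(?P has_real_derivative 1 / (pgf p y - y)) (at y)"
      using yb by (simp add: at_within_Icc_at)
    have "((\<lambda>x. 1 - 1 / x) has_real_derivative 1 / x\<^sup>2) (at x)"
      using x by (auto intro!: derivative_eq_intros simp: power2_eq_square)
    from DERIV_chain2[OF P[unfolded y_def] this] show ?thesis
      by (simp add: mbp_V_def[abs_def] y_def mult.commute)
  qed
  show "\<exists>x\<ge>1. mbp_V p x = y" if y: "0 \<le> y" for y
  proof (intro exI conjI)
    show "mbp_V p (1 / (1 - mbp_F 1 p (y) 0)) = y"
      using mbp_V_mbp_F[of 1 p 0 y] mean gt y V1 by simp
    have "mbp_F 1 p (y) 0 < 1"
      using mbp_F_less_1[of 1 p 0 y] mean y exp_gt_zero[of "- y"] by (simp del: exp_gt_zero)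
    then show "1 / (1 - mbp_F 1 p (y) 0) \<ge> 1"
      using mbp_F_bounds(1)[of 1 0 p y] by simp
  qed
qed


section \<open>Slow and regular variation\<close>

lemma measure_incseq_exceeds:
  fixes A :: "nat \<Rightarrow> real set"
  assumes "\<And>n. A n \<in> sets lebesgue" "incseq A" "(\<Union>n. A n) = {a..b}" "c < b - a" "a \<le> b"
  shows "eventually (\<lambda>n. c < measure lebesgue (A n)) sequentially"
proof (rule order_tendstoD(1))
  show "(\<lambda>n. measure lebesgue (A n)) \<longlonglongrightarrow> measure lebesgue {a..b}"
    using Lim_measure_incseq[of A lebesgue] assms by auto
  show "c < measure lebesgue {a..b}" using assms by simp
qed

text \<open>
  The uniform convergence theorem for measurable slowly varying functions. If it failed along points
  \<open>x\<^sub>n\<close> and \<open>y\<^sub>n = u\<^sub>n x\<^sub>n\<close> with \<open>u\<^sub>n \<in> [1, K]\<close>, one could compare both \<open>L(x\<^sub>n)\<close> and \<open>L(y\<^sub>n)\<close> with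
  the value of \<open>L\<close> at a common point. Pointwise convergence makes the set \<open>A\<^sub>n\<close> of good multipliers of
  \<open>x\<^sub>n\<close> in \<open>[1, 2K]\<close> and the set \<open>B\<^sub>n\<close> of good multipliers of \<open>y\<^sub>n\<close> in \<open>[1, 2]\<close> nearly full in
  measure, so \<open>A\<^sub>n\<close> and \<open>u\<^sub>n B\<^sub>n\<close>, both inside \<open>[1, 2K]\<close>, must meet.
\<close>

theorem slowly_varying_uniform:
  assumes L: "slowly_varying L" and \<eta>: "\<eta> > 1" and K: "K \<ge> 1"
  shows "\<exists>T>0. \<forall>x\<ge>T. \<forall>y. x \<le> y \<and> y \<le> K * x \<longrightarrow> 0 < L x \<and> 0 < L y \<and> L y \<le> \<eta> * L x \<and> L x \<le> \<eta> * L y"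
proof (rule ccontr)
  assume contra: "\<not> ?thesis"
  obtain a where meas: "L \<in> borel_measurable (lebesgue_on {a..})" and pos: "\<And>x. x \<ge> a \<Longrightarrow> L x > 0"
    and lim: "\<And>c. c > 0 \<Longrightarrow> ((\<lambda>x. L (c * x) / L x) \<longlongrightarrow> 1) at_top"
    using L unfolding slowly_varying_def by blast
  \<comment> \<open>on the logarithmic scale deviations satisfy the triangle inequality\<close>
  define d where "d x y = \<bar>ln (L x) - ln (L y)\<bar>" for x y
  have "\<exists>x y. x \<ge> max (real n + 1) a \<and> x \<le> y \<and> y \<le> K * x \<and> ln \<eta> < d x y" for n :: nat
  proof -
    have "max (real n + 1) a > 0" by (simp add: max_def)
    then have "\<not> (\<forall>x\<ge>max (real n + 1) a. \<forall>y. x \<le> y \<and> y \<le> K * x \<longrightarrow> 0 < L x \<and> 0 < L y \<and> L y \<le> \<eta> * L x \<and> L x \<le> \<eta> * L y)"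
      using contra by blast
    then obtain x y where xy: "x \<ge> max (real n + 1) a" "x \<le> y" "y \<le> K * x"
      "\<not> (0 < L x \<and> 0 < L y \<and> L y \<le> \<eta> * L x \<and> L x \<le> \<eta> * L y)"
      by meson
    have "0 < L x" "0 < L y" using xy pos by auto
    then have "ln (L y) > ln (\<eta> * L x) \<or> ln (L x) > ln (\<eta> * L y)"
      using xy \<eta> by (auto simp: not_le)
    then have "ln \<eta> < d x y"
      using \<open>0 < L x\<close> \<open>0 < L y\<close> \<eta> by (auto simp: d_def ln_mult)
    then show ?thesis using xy by blast
  qed
  then obtain x y where x: "\<And>n. x n \<ge> max (real n + 1) a" and xy: "\<And>n. x n \<le> y n" "\<And>n. y n \<le> K * x n"
    and far: "\<And>n. ln \<eta> < d (x n) (y n)"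
    by metis
  define \<epsilon> where "\<epsilon> = ln \<eta> / 2"
  have \<epsilon>: "\<epsilon> > 0" using \<eta> by (simp add: \<epsilon>_def)
  have x1: "x n \<ge> 1" "x n \<ge> a" "y n \<ge> 1" "y n \<ge> a" for n using x[of n] xy(1)[of n] by auto
  have xn: "real n \<le> x n" for n using x[of n] by simp
  have xtop: "filterlim x at_top sequentially"
    by (rule filterlim_at_top_mono[OF filterlim_real_sequentially]) (use xn in auto)
  have ytop: "filterlim y at_top sequentially"
    by (rule filterlim_at_top_mono[OF xtop]) (use xy in auto)
  have small: "eventually (\<lambda>n. d (v * z n) (z n) < \<epsilon>) sequentially"
    if v: "v \<ge> 1" and z: "filterlim z at_top sequentially" for v z
  proof -
    have "((\<lambda>x. ln (L (v * x) / L x)) \<longlongrightarrow> ln 1) at_top"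
      using v by (intro tendsto_ln lim) auto
    then have "eventually (\<lambda>x. \<bar>ln (L (v * x) / L x)\<bar> < \<epsilon>) at_top"
      using \<epsilon> by (auto simp: tendsto_iff dist_real_def)
    moreover have "eventually (\<lambda>x. x \<ge> a \<and> x \<ge> 0) at_top"
      by (intro eventually_conj eventually_ge_at_top)
    ultimately have "eventually (\<lambda>x. d (v * x) x < \<epsilon>) at_top"
    proof eventually_elim
      case (elim x)
      have "v * x \<ge> 1 * x" using v elim by (intro mult_right_mono) auto
      then have "L (v * x) > 0" "L x > 0" using elim pos by auto
      then show ?case using elim by (simp add: d_def ln_div)
    qed
    then show ?thesis using z by (rule eventually_compose_filterlim)
  qed
  have meas_near: "{v \<in> {1..B}. \<forall>m\<ge>n. d (v * z m) (z m) < \<epsilon>} \<in> sets lebesgue"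
    if z: "\<And>m. z m \<ge> 1" "\<And>m. z m \<ge> a" for z :: "nat \<Rightarrow> real" and B n
  proof -
    define L' where "L' x = (if x \<in> {a..} then L x else 0)" for x
    have L': "L' \<in> borel_measurable lebesgue"
      unfolding L'_def by (rule borel_measurable_if_I[OF meas]) auto
    define k where "k m v = \<bar>ln (L' (v * z m)) - ln (L (z m))\<bar>" for m v
    have "(\<lambda>v. L' (v * z m)) \<in> borel_measurable lebesgue" for m
      using measurable_compose[OF lebesgue_measurable_scaling[of "z m"] L'] by (simp add: mult.commute)
    then have [measurable]: "k m \<in> borel_measurable lebesgue" for m
      unfolding k_def by measurable
    have [measurable]: "(\<lambda>v::real. v) \<in> borel_measurable lebesgue"
      by (simp add: measurable_completion)
    have "{v \<in> space lebesgue. 1 \<le> v \<and> v \<le> B \<and> (\<forall>m\<ge>n. k m v < \<epsilon>)} \<in> sets lebesgue"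
      by measurable
    also have "{v \<in> space lebesgue. 1 \<le> v \<and> v \<le> B \<and> (\<forall>m\<ge>n. k m v < \<epsilon>)} =
       {v \<in> {1..B}. \<forall>m\<ge>n. d (v * z m) (z m) < \<epsilon>}"
    proof -
      have "L' (v * z m) = L (v * z m)" if "v \<ge> 1" for v m
      proof -
        have "a \<le> v * z m" using mult_right_mono[OF that, of "z m"] z[of m] by linarith
        then show ?thesis by (simp add: L'_def)
      qed
      then show ?thesis by (auto simp: d_def k_def)
    qed
    finally show ?thesis .
  qed
  define A where "A n = {v \<in> {1..2*K}. \<forall>m\<ge>n. d (v * x m) (x m) < \<epsilon>}" for n
  define B where "B n = {v \<in> {1..2}. \<forall>m\<ge>n. d (v * y m) (y m) < \<epsilon>}" for n
  have A_sets: "A n \<in> sets lebesgue" for n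
    unfolding A_def by (rule meas_near[OF x1(1,2)])
  have B_sets: "B n \<in> sets lebesgue" for n
    unfolding B_def by (rule meas_near[OF x1(3,4)])
  have "eventually (\<lambda>n. 2 * K - 1 - 1/2 < measure lebesgue (A n)) sequentially"
  proof (rule measure_incseq_exceeds[OF A_sets])
    show "incseq A" by (auto simp: incseq_def A_def)
    have "\<exists>n. v \<in> A n" if "v \<in> {1..2*K}" for v
      using small[OF _ xtop, of v] that unfolding A_def eventually_sequentially by simp
    then show "(\<Union>n. A n) = {1..2*K}" by (auto simp: A_def)
  qed (use K in auto)
  moreover have "eventually (\<lambda>n. 1/2 < measure lebesgue (B n)) sequentially"
  proof (rule measure_incseq_exceeds[OF B_sets])
    show "incseq B" by (auto simp: incseq_def B_def)
    have "\<exists>n. v \<in> B n" if "v \<in> {1..2}" for v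
      using small[OF _ ytop, of v] that unfolding B_def eventually_sequentially by simp
    then show "(\<Union>n. B n) = {1..2}" by (auto simp: B_def)
  qed auto
  ultimately have "eventually (\<lambda>n. 2 * K - 1 - 1/2 < measure lebesgue (A n) \<and> 1/2 < measure lebesgue (B n)) sequentially"
    by (rule eventually_conj)
  then obtain n where n: "2 * K - 1 - 1/2 < measure lebesgue (A n)" "1/2 < measure lebesgue (B n)"
    by (auto simp: eventually_sequentially)
  define u where "u = y n / x n"
  have u: "1 \<le> u" "u \<le> K" "u * x n = y n" using xy[of n] x1[of n] by (auto simp: u_def field_simps)
  define uB where "uB = (\<lambda>w. u * w) ` B n"
  have muB: "measure lebesgue uB > 1/2"
  proof -
    have "measure lebesgue uB = u * measure lebesgue (B n)"
      using measure_lebesgue_affine[of u 0 "B n"] u by (simp add: uB_def)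
    also have "\<dots> \<ge> 1 * measure lebesgue (B n)" using u by (intro mult_right_mono) auto
    finally show ?thesis using n by simp
  qed
  then have uB_sets: "uB \<in> sets lebesgue" using measure_notin_sets[of uB lebesgue] by fastforce
  have uB_sub: "uB \<subseteq> {1..2*K}"
  proof
    fix v assume "v \<in> uB"
    then obtain w where w: "v = u * w" "1 \<le> w" "w \<le> 2" by (auto simp: uB_def B_def)
    then show "v \<in> {1..2*K}" using u mult_mono[of 1 u 1 w] mult_mono[of u K w 2] by auto
  qed
  have "A n \<inter> uB \<noteq> {}"
  proof
    assume disj: "A n \<inter> uB = {}"
    have fin: "A n \<in> lmeasurable" "uB \<in> lmeasurable"
    proof -
      have "bounded (A n)" by (rule bounded_subset[OF bounded_closed_interval[of 1 "2*K"]]) (auto simp: A_def)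
      then show "A n \<in> lmeasurable" using A_sets by (rule bounded_set_imp_lmeasurable)
      have "bounded uB" by (rule bounded_subset[OF bounded_closed_interval uB_sub])
      then show "uB \<in> lmeasurable" using uB_sets by (rule bounded_set_imp_lmeasurable)
    qed
    have "measure lebesgue (A n) + measure lebesgue uB = measure lebesgue (A n \<union> uB)"
      using fin disj by (subst measure_Un3) auto
    also have "\<dots> \<le> measure lebesgue {1..2*K}"
    proof (rule measure_mono_fmeasurable)
      show "A n \<union> uB \<subseteq> {1..2*K}" using uB_sub by (auto simp: A_def)
      show "A n \<union> uB \<in> sets lebesgue" using A_sets uB_sets by (intro sets.Un)
      show "{1..2*K} \<in> lmeasurable" by (rule lmeasurable_interval)
    qed
    also have "\<dots> = 2 * K - 1" using K by simp
    finally show False using n muB by simp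
  qed
  then obtain w where w: "u * w \<in> A n" "w \<in> B n" by (auto simp: uB_def)
  have "d (u * w * x n) (x n) < \<epsilon>" using w by (auto simp: A_def)
  moreover have "d (w * y n) (y n) < \<epsilon>" using w by (auto simp: B_def)
  moreover have "u * w * x n = w * y n" unfolding u(3)[symmetric] by (simp only: ac_simps)
  ultimately have "d (x n) (y n) < 2 * \<epsilon>" by (simp add: d_def)
  then show False using far[of n] by (simp add: \<epsilon>_def)
qed

definition regularly_varying :: "real \<Rightarrow> (real \<Rightarrow> real) \<Rightarrow> bool" where
  "regularly_varying \<rho> h \<longleftrightarrow> (\<forall>c>0. ((\<lambda>x. h (c * x) / h x) \<longlongrightarrow> c powr \<rho>) at_top)"

lemma regularly_varyingD:
  "regularly_varying \<rho> h \<Longrightarrow> c > 0 \<Longrightarrow> ((\<lambda>x. h (c * x) / h x) \<longlongrightarrow> c powr \<rho>) at_top"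
  by (simp add: regularly_varying_def)

lemma regularly_varying_inverse:
  assumes "regularly_varying \<rho> h"
  shows "regularly_varying (- \<rho>) (\<lambda>x. inverse (h x))"
  unfolding regularly_varying_def
proof safe
  fix c :: real assume c: "c > 0"
  have "((\<lambda>x. inverse (h (c * x) / h x)) \<longlongrightarrow> inverse (c powr \<rho>)) at_top"
    using c by (intro tendsto_inverse regularly_varyingD[OF assms]) auto
  then show "((\<lambda>x. inverse (h (c * x)) / inverse (h x)) \<longlongrightarrow> c powr - \<rho>) at_top"
    by (simp add: field_simps powr_minus)
qed

text \<open>
  Monotonicity allows a moving multiplier: \<open>a t\<close> is squeezed between constant multiples of \<open>b t\<close>.
\<close>

lemma regularly_varying_mono_tendsto:
  fixes h :: "real \<Rightarrow> real"
  assumes rv: "regularly_varying \<rho> h" and mono: "\<And>x y. m \<le> x \<Longrightarrow> x \<le> y \<Longrightarrow> h x \<le> h y"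
    and pos: "\<And>x. m \<le> x \<Longrightarrow> 0 < h x"
    and b: "filterlim b at_top F" and ab: "((\<lambda>t. a t / b t) \<longlongrightarrow> c) F" and c: "c > 0"
  shows "((\<lambda>t. h (a t) / h (b t)) \<longlongrightarrow> c powr \<rho>) F"
proof -
  have cont: "((\<lambda>x. x powr \<rho>) \<longlongrightarrow> c powr \<rho>) (at c)" using c by (intro tendsto_intros) auto
  have b_ge: "eventually (\<lambda>t. b t \<ge> B) F" for B using b by (simp add: filterlim_at_top)
  have lim: "((\<lambda>t. h (x * b t) / h (b t)) \<longlongrightarrow> x powr \<rho>) F" if "x > 0" for x
    using filterlim_compose[OF regularly_varyingD[OF rv that] b] .
  show ?thesis
  proof (rule order_tendstoI)
    fix y assume "y < c powr \<rho>"
    then have "eventually (\<lambda>x. y < x powr \<rho>) (at_left c)"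
      using order_tendstoD(1)[OF tendsto_mono[OF at_le cont]] by auto
    moreover have "eventually (\<lambda>x. x \<in> {0<..<c}) (at_left c)" using c by (rule eventually_at_left_real)
    ultimately have "eventually (\<lambda>x. y < x powr \<rho> \<and> x \<in> {0<..<c}) (at_left c)" by (rule eventually_conj)
    then obtain x where x: "y < x powr \<rho>" "0 < x" "x < c"
      using eventually_happens'[OF trivial_limit_at_left_real] by auto
    have "eventually (\<lambda>t. y < h (x * b t) / h (b t)) F"
      using order_tendstoD(1)[OF lim] x by blast
    moreover have "eventually (\<lambda>t. x < a t / b t) F" using order_tendstoD(1)[OF ab] x by blast
    moreover note b_ge[of "max 1 (max m (m / x))"]
    ultimately show "eventually (\<lambda>t. y < h (a t) / h (b t)) F"
    proof eventually_elim
      case (elim t)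
      then have "x * b t \<le> a t" "m \<le> x * b t" "0 < h (b t)" using x pos by (auto simp: field_simps)
      then have "h (x * b t) / h (b t) \<le> h (a t) / h (b t)" using mono by (intro divide_right_mono) auto
      then show ?case using elim by simp
    qed
  next
    fix y assume "c powr \<rho> < y"
    then have "eventually (\<lambda>x. x powr \<rho> < y) (at_right c)"
      using order_tendstoD(2)[OF tendsto_mono[OF at_le cont]] by auto
    moreover have "eventually (\<lambda>x. x \<in> {c<..<c+1}) (at_right c)" by (rule eventually_at_right_real) simp
    ultimately have "eventually (\<lambda>x. x powr \<rho> < y \<and> x \<in> {c<..<c+1}) (at_right c)" by (rule eventually_conj)
    then obtain x where x: "x powr \<rho> < y" "c < x" 
      using eventually_happens'[OF trivial_limit_at_right_real] by auto
    have "eventually (\<lambda>t. h (x * b t) / h (b t) < y) F"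
      using order_tendstoD(2)[OF lim] x c by auto
    moreover have "eventually (\<lambda>t. a t / b t < x) F" using order_tendstoD(2)[OF ab] x by blast
    moreover have "eventually (\<lambda>t. c / 2 < a t / b t) F" using order_tendstoD(1)[OF ab, of "c / 2"] c by simp
    moreover note b_ge[of "max 1 (max m (m / (c/2)))"]
    ultimately show "eventually (\<lambda>t. h (a t) / h (b t) < y) F"
    proof eventually_elim
      case (elim t)
      then have "c / 2 * b t \<le> a t" "a t \<le> x * b t" "m \<le> c / 2 * b t" "0 < h (b t)"
        using x pos c by (auto simp: field_simps)
      then have "h (a t) / h (b t) \<le> h (x * b t) / h (b t)" using mono by (intro divide_right_mono) auto
      then show ?case using elim by simp
    qed
  qed
qed

lemma regularly_varying_antimono_tendsto:
  fixes h :: "real \<Rightarrow> real"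
  assumes rv: "regularly_varying \<rho> h" and mono: "\<And>x y. m \<le> x \<Longrightarrow> x \<le> y \<Longrightarrow> h y \<le> h x"
    and pos: "\<And>x. m \<le> x \<Longrightarrow> 0 < h x"
    and b: "filterlim b at_top F" and ab: "((\<lambda>t. a t / b t) \<longlongrightarrow> c) F" and c: "c > 0"
  shows "((\<lambda>t. h (a t) / h (b t)) \<longlongrightarrow> c powr \<rho>) F"
proof -
  have "((\<lambda>t. inverse (h (a t)) / inverse (h (b t))) \<longlongrightarrow> c powr (- \<rho>)) F"
    using regularly_varying_inverse[OF rv]
  proof (rule regularly_varying_mono_tendsto[OF _ _ _ b ab c])
    show "inverse (h x) \<le> inverse (h y)" if "m \<le> x" "x \<le> y" for x y
      using that mono[of x y] pos[of y] by (intro le_imp_inverse_le) auto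
  qed (use pos in auto)
  then have "((\<lambda>t. inverse (inverse (h (a t)) / inverse (h (b t)))) \<longlongrightarrow> inverse (c powr (- \<rho>))) F"
    using c by (intro tendsto_inverse) auto
  then show ?thesis by (simp add: field_simps powr_minus)
qed

text \<open>
  For \<open>x\<close> above \<open>c powr (1 / \<rho>)\<close> one has eventually \<open>V (x W(y)) > c y = V (W (c y))\<close>, hence
  \<open>W (c y) < x W(y)\<close>; similarly below.
\<close>

lemma regularly_varying_inverse_function:
  fixes V W :: "real \<Rightarrow> real"
  assumes rv: "regularly_varying \<rho> V" and \<rho>: "\<rho> > 0"
    and mono: "\<And>x y. 1 \<le> x \<Longrightarrow> x < y \<Longrightarrow> V x < V y" and V1: "V 1 = 0"
    and W: "\<And>y. 0 \<le> y \<Longrightarrow> W y \<ge> 1" "\<And>y. 0 \<le> y \<Longrightarrow> V (W y) = y"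
  shows "filterlim W at_top at_top" and "regularly_varying (1 / \<rho>) W"
proof -
  have V_less: "x < y" if "V x < V y" "1 \<le> y" for x y
    using that mono[of y x] by (cases x y rule: linorder_cases) auto
  show top: "filterlim W at_top at_top"
    unfolding filterlim_at_top
  proof
    fix B :: real
    have "eventually (\<lambda>y. y > V (max 1 B) \<and> y \<ge> 0) at_top"
      by (intro eventually_conj eventually_gt_at_top eventually_ge_at_top)
    then show "eventually (\<lambda>y. B \<le> W y) at_top"
    proof eventually_elim
      case (elim y)
      then have "V (max 1 B) < V (W y)" using W(2)[of y] by simp
      then have "max 1 B < W y" by (rule V_less) (use W(1)[of y] elim in auto)
      then show ?case by simp
    qed
  qed
  show "regularly_varying (1 / \<rho>) W"
    unfolding regularly_varying_def
  proof safe
    fix c :: real assume c: "c > 0"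
    have lim: "((\<lambda>y. V (x * W y) / y) \<longlongrightarrow> x powr \<rho>) at_top" if x: "x > 0" for x
    proof (rule Lim_transform_eventually)
      show "((\<lambda>y. V (x * W y) / V (W y)) \<longlongrightarrow> x powr \<rho>) at_top"
        by (rule filterlim_compose[OF regularly_varyingD[OF rv x] top])
      show "eventually (\<lambda>y. V (x * W y) / V (W y) = V (x * W y) / y) at_top"
        using eventually_ge_at_top[of "0::real"] by eventually_elim (simp only: W(2))
    qed
    have cpos: "c powr (1 / \<rho>) > 0" using c by simp
    have cp: "(c powr (1 / \<rho>)) powr \<rho> = c" using c \<rho> by (simp add: powr_powr)
    show "((\<lambda>y. W (c * y) / W y) \<longlongrightarrow> c powr (1 / \<rho>)) at_top"
    proof (rule order_tendstoI)
      fix a assume a: "a < c powr (1 / \<rho>)"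
      define x where "x = max a (c powr (1 / \<rho>) / 2)"
      have x: "0 < x" "x < c powr (1 / \<rho>)" "a \<le> x" using a cpos by (auto simp: x_def max_def)
      have "x powr \<rho> < c" using powr_less_mono2[OF \<rho> _ x(2)] x(1) cp by simp
      then have "eventually (\<lambda>y. V (x * W y) / y < c) at_top" by (rule order_tendstoD(2)[OF lim[OF x(1)]])
      then show "eventually (\<lambda>y. a < W (c * y) / W y) at_top"
        using eventually_gt_at_top[of "0::real"]
      proof eventually_elim
        case (elim y)
        have cy: "0 \<le> c * y" using c elim by simp
        have "V (x * W y) < V (W (c * y))" unfolding W(2)[OF cy] using elim by (simp only: pos_divide_less_eq)
        then have "x * W y < W (c * y)" by (rule V_less[OF _ W(1)[OF cy]])
        then have "x < W (c * y) / W y" using W(1)[of y] elim by (simp add: pos_divide_less_eq pos_less_divide_eq)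
        then show ?case using x by simp
      qed
    next
      fix x assume x: "c powr (1 / \<rho>) < x"
      have x0: "0 < x" using x cpos by linarith
      have "c < x powr \<rho>" using powr_less_mono2[OF \<rho> _ x] c cp by simp
      then have "eventually (\<lambda>y. c < V (x * W y) / y) at_top" by (rule order_tendstoD(1)[OF lim[OF x0]])
      moreover have "eventually (\<lambda>y. W y \<ge> 1 / x) at_top" using top by (simp add: filterlim_at_top)
      ultimately show "eventually (\<lambda>y. W (c * y) / W y < x) at_top"
        using eventually_gt_at_top[of "0::real"]
      proof eventually_elim
        case (elim y)
        have cy: "0 \<le> c * y" using c elim by simp
        have "V (W (c * y)) < V (x * W y)" unfolding W(2)[OF cy] using elim by (simp only: pos_less_divide_eq)
        moreover have "1 \<le> x * W y" using elim x0 by (simp add: divide_le_eq mult.commute)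
        ultimately have "W (c * y) < x * W y" by (rule V_less)
        then show ?case using W(1)[of y] elim by (simp add: pos_divide_less_eq pos_less_divide_eq)
      qed
    qed
  qed
qed

lemma doubling_induct:
  fixes P :: "real \<Rightarrow> bool"
  assumes T: "T > 0" and base: "\<And>t. T \<le> t \<Longrightarrow> t \<le> 2 * T \<Longrightarrow> P t"
    and step: "\<And>t. T \<le> t \<Longrightarrow> P t \<Longrightarrow> P (2 * t)" and t: "T \<le> t"
  shows "P t"
proof -
  have "\<forall>t. T \<le> t \<longrightarrow> t \<le> 2 ^ n * T \<longrightarrow> P t" for n
  proof (induction n)
    case 0
    then show ?case using base T by auto
  next
    case (Suc n)
    show ?case
    proof safe
      fix t assume t: "T \<le> t" "t \<le> 2 ^ Suc n * T"
      show "P t"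
      proof (cases "t \<le> 2 * T")
        case True
        then show ?thesis using base t by simp
      next
        case False
        then have "P (t / 2)" using t by (intro Suc[rule_format]) auto
        then show ?thesis using step[of "t / 2"] False by simp
      qed
    qed
  qed
  moreover obtain n :: nat where "t / T < 2 ^ n" using real_arch_pow[of 2 "t / T"] by auto
  then have "t \<le> 2 ^ n * T" using T by (simp add: field_simps)
  ultimately show ?thesis using t by blast
qed

text \<open>
  A geometric rate along doubling amounts to a power bound: the exponent \<open>\<kappa>\<close> is chosen such that
  \<open>2 powr (- \<kappa>) = \<eta>\<close>, and the bound reproduces itself under \<open>t \<mapsto> 2 t\<close>.
\<close>

lemma doubling_decay:
  fixes B :: "real \<Rightarrow> real"
  assumes T: "T > 0" and \<eta>: "0 < \<eta>" "\<eta> < 1" and step: "\<And>t. T \<le> t \<Longrightarrow> B (2 * t) \<le> \<eta> * B t"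
    and base: "\<And>t. T \<le> t \<Longrightarrow> t \<le> 2 * T \<Longrightarrow> B t \<le> C" and nonneg: "\<And>t. T \<le> t \<Longrightarrow> 0 \<le> B t"
  shows "(B \<longlongrightarrow> 0) at_top"
proof -
  define \<kappa> where "\<kappa> = - log 2 \<eta>"
  have \<kappa>: "\<kappa> > 0" "2 powr (- \<kappa>) = \<eta>" using \<eta> by (auto simp: \<kappa>_def)
  have C: "C \<ge> 0" using base[of T] nonneg[of T] T by simp
  define K where "K = C * (2 * T) powr \<kappa>"
  have bound: "B t \<le> K * t powr (- \<kappa>)" if "T \<le> t" for t
    using T _ _ that
  proof (rule doubling_induct)
    fix t assume t: "T \<le> t" "t \<le> 2 * T"
    have "t powr \<kappa> \<le> (2 * T) powr \<kappa>" using t T \<kappa> by (intro powr_mono2) auto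
    then have "1 \<le> (2 * T) powr \<kappa> * t powr (- \<kappa>)"
      using t T by (simp add: powr_minus field_simps)
    then have "C * 1 \<le> C * ((2 * T) powr \<kappa> * t powr (- \<kappa>))" using C by (intro mult_left_mono)
    then show "B t \<le> K * t powr (- \<kappa>)" using base[OF t] by (simp add: K_def mult.assoc)
  next
    fix t assume t: "T \<le> t" "B t \<le> K * t powr (- \<kappa>)"
    have "B (2 * t) \<le> \<eta> * (K * t powr (- \<kappa>))" using step[OF t(1)] mult_left_mono[OF t(2), of \<eta>] \<eta> by linarith
    also have "\<dots> = K * (2 * t) powr (- \<kappa>)" using t T \<kappa> by (simp add: powr_mult)
    finally show "B (2 * t) \<le> K * (2 * t) powr (- \<kappa>)" .
  qed
  have "((\<lambda>t. K * t powr (- \<kappa>)) \<longlongrightarrow> K * 0) at_top"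
    using \<kappa> by (intro tendsto_mult tendsto_const tendsto_neg_powr filterlim_ident) auto
  then have lim: "((\<lambda>t. K * t powr (- \<kappa>)) \<longlongrightarrow> 0) at_top" by simp
  show ?thesis
    by (rule real_tendsto_sandwich[OF _ _ tendsto_const lim])
       (use eventually_ge_at_top[of T] in \<open>eventually_elim; use nonneg bound in auto\<close>)+
qed

text \<open>
  The Karamata estimate in dyadic form, used with \<open>A\<close> the integral of a function \<open>h\<close> over
  \<open>[0, t]\<close> and \<open>B t = t * h t\<close>. If \<open>h\<close> has an index above -1 then \<open>B\<close> grows geometrically along
  doubling, and the last dyadic block dominates.
\<close>

lemma doubling_dominated:
  fixes A B :: "real \<Rightarrow> real"
  assumes T: "T > 0" and \<eta>: "\<eta> < 1" and C1: "C1 \<ge> 0"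
    and stepA: "\<And>t. T \<le> t \<Longrightarrow> A (2 * t) \<le> A t + C1 * B (2 * t)"
    and stepB: "\<And>t. T \<le> t \<Longrightarrow> B t \<le> \<eta> * B (2 * t)"
    and nonneg: "\<And>t. T \<le> t \<Longrightarrow> 0 \<le> B t"
    and base: "\<And>t. T \<le> t \<Longrightarrow> t \<le> 2 * T \<Longrightarrow> A t \<le> C0 * B t"
  shows "\<exists>C>0. \<forall>t\<ge>T. A t \<le> C * B t"
proof -
  define C where "C = max 1 (max C0 (C1 / (1 - \<eta>)))"
  have C: "C \<ge> 1" "C \<ge> C0" "C * \<eta> + C1 \<le> C"
  proof -
    have "C1 / (1 - \<eta>) \<le> C" by (simp add: C_def)
    then show "C * \<eta> + C1 \<le> C" using \<eta> by (simp add: field_simps)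
  qed (auto simp: C_def)
  have "A t \<le> C * B t" if "T \<le> t" for t
    using T _ _ that
  proof (rule doubling_induct)
    fix t assume t: "T \<le> t" "t \<le> 2 * T"
    show "A t \<le> C * B t" using base[OF t] mult_right_mono[OF C(2) nonneg[OF t(1)]] by simp
  next
    fix t assume t: "T \<le> t" "A t \<le> C * B t"
    have "A (2 * t) \<le> C * (\<eta> * B (2 * t)) + C1 * B (2 * t)"
      using stepA[OF t(1)] t(2) mult_left_mono[OF stepB[OF t(1)], of C] C by linarith
    also have "\<dots> = (C * \<eta> + C1) * B (2 * t)" by (simp add: algebra_simps)
    also have "\<dots> \<le> C * B (2 * t)" using C nonneg[of "2 * t"] t T by (intro mult_right_mono) auto
    finally show "A (2 * t) \<le> C * B (2 * t)" .
  qed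
  then show ?thesis using C by (intro exI[of _ C]) auto
qed


section \<open>Intensities that vary regularly\<close>

lemma integral_convolution_reflect:
  fixes f :: "real \<Rightarrow> real"
  shows "integral {a..b} (\<lambda>u. f (t - u)) = integral {t - b..t - a} f"
proof -
  have "integral {a..b} (\<lambda>u. (f \<circ> (+) t) (- u)) = integral {- b..- a} (f \<circ> (+) t)"
    using Henstock_Kurzweil_Integration.integral_reflect_real[of "- a" "- b" "f \<circ> (+) t"] by simp
  also have "\<dots> = integral {- b + t..- a + t} f" by (rule integral_shift_Icc_real)
  finally show ?thesis by (simp add: o_def algebra_simps)
qed

locale intensity =
  fixes r :: "real \<Rightarrow> real"
  assumes r_nonneg: "\<And>t. 0 \<le> r t"
    and r_integrable: "\<And>t. t \<ge> 0 \<Longrightarrow> r integrable_on {0..t}"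
begin

definition R :: "real \<Rightarrow> real" where "R t = integral {0..t} r"

lemma r_integrable_sub: "0 \<le> a \<Longrightarrow> r integrable_on {a..b}"
  by (cases "a \<le> b") (auto intro!: integrable_subinterval_real[OF r_integrable[of b]])

lemma R_diff: "0 \<le> a \<Longrightarrow> a \<le> b \<Longrightarrow> R b - R a = integral {a..b} r"
  unfolding R_def using Henstock_Kurzweil_Integration.integral_combine[of 0 a b r] r_integrable by simp

lemma R_mono: "0 \<le> a \<Longrightarrow> a \<le> b \<Longrightarrow> R a \<le> R b"
  using R_diff[of a b] Henstock_Kurzweil_Integration.integral_nonneg[OF r_integrable_sub[of a b]] r_nonneg by simp

lemma R_nonneg: "0 \<le> R t"
  unfolding R_def using r_nonneg
  by (cases "t \<ge> 0") (auto intro!: Henstock_Kurzweil_Integration.integral_nonneg r_integrable)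

lemma integral_r_le:
  assumes "0 \<le> a" "a \<le> b" "\<And>u. a \<le> u \<Longrightarrow> u \<le> b \<Longrightarrow> r u \<le> c"
  shows "integral {a..b} r \<le> (b - a) * c"
proof -
  have "integral {a..b} r \<le> integral {a..b} (\<lambda>_. c)"
    using assms by (intro integral_le r_integrable_sub) auto
  then show ?thesis using assms by simp
qed

lemma integral_r_ge:
  assumes "0 \<le> a" "a \<le> b" "\<And>u. a \<le> u \<Longrightarrow> u \<le> b \<Longrightarrow> c \<le> r u"
  shows "(b - a) * c \<le> integral {a..b} r"
proof -
  have "integral {a..b} (\<lambda>_. c) \<le> integral {a..b} r"
    using assms by (intro integral_le r_integrable_sub) auto
  then show ?thesis using assms by simp
qed

lemma product_integrable:
  assumes "0 \<le> a" and g: "continuous_on {a..b} g"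
  shows "(\<lambda>u. r u * g u) integrable_on {a..b}"
proof -
  have ri: "r absolutely_integrable_on {a..b}"
    using assms r_nonneg by (intro nonnegative_absolutely_integrable_1 r_integrable_sub) auto
  have "(\<lambda>u. g u * r u) absolutely_integrable_on {a..b}"
  proof (rule absolutely_integrable_bounded_measurable_product_real[OF _ _ _ ri])
    show "g \<in> borel_measurable (lebesgue_on {a..b})"
      using g by (intro continuous_imp_measurable_on_sets_lebesgue) auto
    show "bounded (g ` {a..b})"
      using g by (intro compact_imp_bounded compact_continuous_image) auto
  qed auto
  then show ?thesis
    by (simp add: mult.commute set_lebesgue_integral_eq_integral(1))
qed

lemma integral_product_le:
  assumes "0 \<le> a" "a \<le> b" and g: "continuous_on {a..b} g" and le: "\<And>u. a \<le> u \<Longrightarrow> u \<le> b \<Longrightarrow> g u \<le> c"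
  shows "integral {a..b} (\<lambda>u. r u * g u) \<le> c * (R b - R a)"
proof -
  have "integral {a..b} (\<lambda>u. r u * g u) \<le> integral {a..b} (\<lambda>u. r u * c)"
    using assms r_nonneg
    by (intro integral_le product_integrable g continuous_intros) (auto intro!: mult_left_mono)
  then show ?thesis using R_diff[of a b] assms by (simp add: mult.commute)
qed

lemma integral_product_ge:
  assumes "0 \<le> a" "a \<le> b" and g: "continuous_on {a..b} g" and le: "\<And>u. a \<le> u \<Longrightarrow> u \<le> b \<Longrightarrow> c \<le> g u"
  shows "c * (R b - R a) \<le> integral {a..b} (\<lambda>u. r u * g u)"
proof -
  have "integral {a..b} (\<lambda>u. r u * c) \<le> integral {a..b} (\<lambda>u. r u * g u)"
    using assms r_nonneg
    by (intro integral_le product_integrable g continuous_intros) (auto intro!: mult_left_mono)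
  then show ?thesis using R_diff[of a b] assms by (simp add: mult.commute)
qed

lemma integral_product_le':
  assumes "0 \<le> a" "a \<le> b" and g: "continuous_on {a..b} g" "\<And>u. a \<le> u \<Longrightarrow> u \<le> b \<Longrightarrow> 0 \<le> g u"
    and le: "\<And>u. a \<le> u \<Longrightarrow> u \<le> b \<Longrightarrow> r u \<le> c"
  shows "integral {a..b} (\<lambda>u. r u * g u) \<le> c * integral {a..b} g"
proof -
  have "integral {a..b} (\<lambda>u. r u * g u) \<le> integral {a..b} (\<lambda>u. c * g u)"
    using assms
    by (intro integral_le product_integrable g integrable_continuous_interval continuous_intros)
      (auto intro!: mult_right_mono)
  then show ?thesis by simp
qed

lemma integral_product_ge':
  assumes "0 \<le> a" "a \<le> b" and g: "continuous_on {a..b} g" "\<And>u. a \<le> u \<Longrightarrow> u \<le> b \<Longrightarrow> 0 \<le> g u"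
    and le: "\<And>u. a \<le> u \<Longrightarrow> u \<le> b \<Longrightarrow> c \<le> r u"
  shows "c * integral {a..b} g \<le> integral {a..b} (\<lambda>u. r u * g u)"
proof -
  have "integral {a..b} (\<lambda>u. c * g u) \<le> integral {a..b} (\<lambda>u. r u * g u)"
    using assms
    by (intro integral_le product_integrable g integrable_continuous_interval continuous_intros)
      (auto intro!: mult_right_mono)
  then show ?thesis by simp
qed

lemma integral_product_nonneg:
  assumes "0 \<le> a" and g: "continuous_on {a..b} g" "\<And>u. a \<le> u \<Longrightarrow> u \<le> b \<Longrightarrow> 0 \<le> g u"
  shows "0 \<le> integral {a..b} (\<lambda>u. r u * g u)"
  using assms r_nonneg by (intro Henstock_Kurzweil_Integration.integral_nonneg product_integrable) auto

lemma integral_product_split: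
  assumes "0 \<le> a" "a \<le> b" "b \<le> c" and g: "continuous_on {a..c} g"
  shows "integral {a..c} (\<lambda>u. r u * g u) = integral {a..b} (\<lambda>u. r u * g u) + integral {b..c} (\<lambda>u. r u * g u)"
  using Henstock_Kurzweil_Integration.integral_combine[of a b c "\<lambda>u. r u * g u"] assms product_integrable[of a c g] by simp

end

locale power_intensity = intensity +
  fixes L :: "real \<Rightarrow> real" and \<theta> :: real
  assumes L: "slowly_varying L" and \<theta>: "\<theta> > 0"
    and r_eq: "\<And>t. t > 0 \<Longrightarrow> r t = t powr (- \<theta>) * L t"
begin

text \<open>
  The uniform convergence theorem, with the power factor made explicit.
\<close>

lemma r_compare:
  assumes "\<eta> > 1" "K \<ge> 1"
  shows "\<exists>T>0. \<forall>x\<ge>T. \<forall>y. x \<le> y \<and> y \<le> K * x \<longrightarrow>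
    0 < r x \<and> 0 < r y \<and> (y / x) powr \<theta> * r y \<le> \<eta> * r x \<and> r x \<le> \<eta> * (y / x) powr \<theta> * r y"
proof -
  obtain T where T: "T > 0" and *: "\<And>x y. x \<ge> T \<Longrightarrow> x \<le> y \<Longrightarrow> y \<le> K * x \<Longrightarrow>
      0 < L x \<and> 0 < L y \<and> L y \<le> \<eta> * L x \<and> L x \<le> \<eta> * L y"
    using slowly_varying_uniform[OF L assms] by blast
  have "0 < r x \<and> 0 < r y \<and> (y / x) powr \<theta> * r y \<le> \<eta> * r x \<and> r x \<le> \<eta> * (y / x) powr \<theta> * r y"
    if "x \<ge> T" "x \<le> y" "y \<le> K * x" for x y
  proof -
    have xy: "0 < x" "0 < y" using that T by auto
    have e: "(y / x) powr \<theta> * r y = x powr (- \<theta>) * L y"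
      using xy by (simp add: r_eq powr_divide powr_minus field_simps)
    have "x powr (- \<theta>) * L y \<le> x powr (- \<theta>) * (\<eta> * L x)" "x powr (- \<theta>) * L x \<le> x powr (- \<theta>) * (\<eta> * L y)"
      using *[OF that] by (auto intro!: mult_left_mono)
    then show ?thesis
      using *[OF that] xy e by (simp add: r_eq[of x] r_eq[of y] ac_simps)
  qed
  then show ?thesis using T by blast
qed

lemma r_bounded_ratio:
  assumes "K \<ge> 1"
  shows "\<exists>T>0. \<exists>C\<ge>1. \<forall>x\<ge>T. \<forall>y. x \<le> y \<and> y \<le> K * x \<longrightarrow> 0 < r x \<and> 0 < r y \<and> r y \<le> 2 * r x \<and> r x \<le> C * r y"
proof -
  obtain T where T: "T > 0" and *: "\<And>x y. x \<ge> T \<Longrightarrow> x \<le> y \<Longrightarrow> y \<le> K * x \<Longrightarrow>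
      0 < r x \<and> 0 < r y \<and> (y / x) powr \<theta> * r y \<le> 2 * r x \<and> r x \<le> 2 * (y / x) powr \<theta> * r y"
    using r_compare[of 2 K] assms by auto
  have "0 < r x \<and> 0 < r y \<and> r y \<le> 2 * r x \<and> r x \<le> (2 * K powr \<theta>) * r y" if "x \<ge> T" "x \<le> y" "y \<le> K * x" for x y
  proof -
    have b: "1 \<le> y / x" "y / x \<le> K" using that T by (auto simp: field_simps)
    have "1 powr \<theta> \<le> (y / x) powr \<theta>" "(y / x) powr \<theta> \<le> K powr \<theta>"
      using b \<theta> by (intro powr_mono2; simp)+
    then have "1 * r y \<le> (y / x) powr \<theta> * r y" "2 * (y / x) powr \<theta> * r y \<le> 2 * K powr \<theta> * r y"
      using r_nonneg[of y] by (intro mult_right_mono; simp)+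
    then show ?thesis using *[OF that] by linarith
  qed
  moreover have "2 * K powr \<theta> \<ge> 1" using powr_mono2[of \<theta> 1 K] assms \<theta> by simp
  ultimately show ?thesis using T by blast
qed

lemma r_eventually_pos: "eventually (\<lambda>t. 0 < r t) at_top"
proof -
  obtain T where "\<And>x y. x \<ge> T \<Longrightarrow> x \<le> y \<Longrightarrow> y \<le> 1 * x \<Longrightarrow> 0 < r x"
    using r_bounded_ratio[of 1] by auto
  then show ?thesis unfolding eventually_at_top_linorder by auto
qed

lemma R_eventually_pos: "eventually (\<lambda>t. 0 < R t) at_top"
proof -
  obtain T C where T: "T > 0" "C \<ge> 1" and *: "\<And>x y. x \<ge> T \<Longrightarrow> x \<le> y \<Longrightarrow> y \<le> 2 * x \<Longrightarrow> 0 < r x \<and> r x \<le> C * r y"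
    using r_bounded_ratio[of 2] by auto
  have "(2 * T - T) * (r T / C) \<le> integral {T..2 * T} r"
    using T * by (intro integral_r_ge) (auto simp: field_simps)
  moreover have "(2 * T - T) * (r T / C) > 0" using T *[of T T] by simp
  ultimately have "0 < integral {T..2 * T} r" by linarith
  then have pos: "0 < R (2 * T)" using R_diff[of T "2 * T"] T R_nonneg[of T] by simp
  then have "0 < R t" if "t \<ge> 2 * T" for t
    using R_mono[of "2 * T" t] that T by simp
  then show ?thesis unfolding eventually_at_top_linorder by blast
qed

lemma r_doubling:
  assumes "2 powr (- \<theta>) < b"
  shows "\<exists>T>0. \<forall>t\<ge>T. r (2 * t) \<le> b * r t"
proof -
  define \<eta> where "\<eta> = b * 2 powr \<theta>"
  have "\<eta> > 1" using assms by (simp add: \<eta>_def powr_minus field_simps)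
  from r_compare[OF this, of 2] obtain T where T: "T > 0" and *: "\<And>x y. x \<ge> T \<Longrightarrow> x \<le> y \<Longrightarrow> y \<le> 2 * x \<Longrightarrow>
      (y / x) powr \<theta> * r y \<le> \<eta> * r x" by auto
  have "r (2 * t) \<le> b * r t" if "t \<ge> T" for t
    using *[OF that, of "2 * t"] that T by (simp add: \<eta>_def field_simps)
  then show ?thesis using T by blast
qed

lemma r_tendsto_0: "(r \<longlongrightarrow> 0) at_top"
proof -
  have "2 powr (- \<theta>) < 1" using powr_less_mono[of "- \<theta>" 0 2] \<theta> by simp
  then obtain b where b: "2 powr (- \<theta>) < b" "b < 1" using dense by blast
  have b0: "0 < b" using b(1) powr_gt_zero[of 2 "- \<theta>"] by linarith
  obtain T1 where T1: "T1 > 0" "\<And>t. t \<ge> T1 \<Longrightarrow> r (2 * t) \<le> b * r t" using r_doubling[OF b(1)] by blast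
  obtain T2 where T2: "T2 > 0" "\<And>x y. x \<ge> T2 \<Longrightarrow> x \<le> y \<Longrightarrow> y \<le> 2 * x \<Longrightarrow> r y \<le> 2 * r x"
    using r_bounded_ratio[of 2] by auto
  show ?thesis
    by (rule doubling_decay[of "max T1 T2" b _ "2 * r (max T1 T2)"]) (use T1 T2 b b0 r_nonneg in auto)
qed

text \<open>
  For \<open>\<theta> < 1\<close> the mass of \<open>r\<close> on \<open>[0, t]\<close> sits at times comparable to \<open>t\<close>.
\<close>

lemma R_le_tr:
  assumes "\<theta> < 1"
  shows "\<exists>T>0. \<exists>C>0. \<forall>t\<ge>T. R t \<le> C * (t * r t)"
proof -
  \<comment> \<open>\<open>\<eta>\<close> lies strictly between 1 and \<open>2 powr (1 - \<theta>)\<close>, so that \<open>t * r t\<close> grows along doubling\<close>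
  define \<eta> where "\<eta> = (1 + 2 / 2 powr \<theta>) / 2"
  have p: "1 < 2 powr \<theta>" "2 powr \<theta> < 2" using powr_less_mono[of 0 \<theta> 2] powr_less_mono[of \<theta> 1 2] assms \<theta> by auto
  have \<eta>: "\<eta> > 1" "\<eta> * 2 powr \<theta> < 2" using p by (auto simp: \<eta>_def field_simps)
  obtain T1 where T1: "T1 > 0" and *: "\<And>x y. x \<ge> T1 \<Longrightarrow> x \<le> y \<Longrightarrow> y \<le> 2 * x \<Longrightarrow>
      r x \<le> \<eta> * (y / x) powr \<theta> * r y"
    using r_compare[OF \<eta>(1), of 2] by auto
  obtain T2 C where T2: "T2 > 0" "C \<ge> 1" and **: "\<And>x y. x \<ge> T2 \<Longrightarrow> x \<le> y \<Longrightarrow> y \<le> 2 * x \<Longrightarrow>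
      0 < r x \<and> 0 < r y \<and> r y \<le> 2 * r x \<and> r x \<le> C * r y"
    using r_bounded_ratio[of 2] by auto
  define T where "T = max T1 T2"
  have T: "T > 0" "T \<ge> T1" "T \<ge> T2" using T1 T2 by (auto simp: T_def)
  have "\<exists>C'>0. \<forall>t\<ge>T. R t \<le> C' * (t * r t)"
  proof (rule doubling_dominated[of T "\<eta> * 2 powr \<theta> / 2" C])
    show "R (2 * t) \<le> R t + C * (2 * t * r (2 * t))" if t: "T \<le> t" for t
    proof -
      have "integral {t..2 * t} r \<le> (2 * t - t) * (2 * C * r (2 * t))"
      proof (rule integral_r_le)
        fix u assume u: "t \<le> u" "u \<le> 2 * t"
        have "r u \<le> C * r (2 * t)" using **[of u "2 * t"] u t T by auto
        also have "\<dots> \<le> 2 * C * r (2 * t)" using r_nonneg T2 by (simp add: mult_right_mono)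
        finally show "r u \<le> 2 * C * r (2 * t)" .
      qed (use t T in auto)
      then show ?thesis using R_diff[of t "2 * t"] t T by (simp add: algebra_simps)
    qed
    show "t * r t \<le> \<eta> * 2 powr \<theta> / 2 * (2 * t * r (2 * t))" if t: "T \<le> t" for t
      using mult_left_mono[OF *[of t "2 * t"], of t] t T by (simp add: algebra_simps)
    show "R t \<le> (R (2 * T) * C / (T * r T)) * (t * r t)" if t: "T \<le> t" "t \<le> 2 * T" for t
    proof -
      have rT: "r T > 0" "r T \<le> C * r t" using **[of T t] t T by auto
      have "R t \<le> R (2 * T)" using R_mono[of t "2 * T"] t T by simp
      moreover have "1 \<le> C / (T * r T) * (t * r t)"
      proof -
        have "T * r T \<le> t * (C * r t)" using rT t T by (intro mult_mono) auto
        then show ?thesis using rT T by (simp add: field_simps)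
      qed
      then have "R (2 * T) * 1 \<le> R (2 * T) * (C / (T * r T) * (t * r t))"
        using R_nonneg by (intro mult_left_mono)
      ultimately show ?thesis by (simp add: ac_simps)
    qed
    show "0 \<le> t * r t" if "T \<le> t" for t using that T r_nonneg by auto
  qed (use T \<eta> T2 in auto)
  then show ?thesis using T by blast
qed

text \<open>
  For \<open>\<theta> \<ge> 1\<close> each dyadic block \<open>[t / 2\<^sup>j\<^sup>+\<^sup>1, t / 2\<^sup>j]\<close> contributes at least \<open>t * r t / 4\<close> to \<open>R t\<close>,
  and arbitrarily many blocks are available as \<open>t\<close> grows. This covers \<open>\<theta> = 1\<close> and \<open>\<theta> > 1\<close> alike.
\<close>

lemma tr_over_R_tendsto_0:
  assumes "\<theta> \<ge> 1"
  shows "((\<lambda>t. t * r t / R t) \<longlongrightarrow> 0) at_top"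
proof (rule order_tendstoI)
  fix a :: real assume "a < 0"
  show "eventually (\<lambda>t. a < t * r t / R t) at_top"
    using eventually_ge_at_top[of "0::real"]
  proof eventually_elim
    case (elim t)
    then have "0 \<le> t * r t / R t" using r_nonneg R_nonneg by auto
    then show ?case using \<open>a < 0\<close> by linarith
  qed
next
  fix a :: real assume a: "a > 0"
  \<comment> \<open>\<open>n\<close> blocks of mass \<open>t * r t / 4\<close> exceed \<open>t * r t / a\<close>\<close>
  obtain n :: nat where "4 / a < real n" using reals_Archimedean2 by blast
  then have n: "n > 0" "4 < a * real n" using a by (auto simp: field_simps intro: gr0I)
  obtain T where T: "T > 0" and *: "\<And>x y. x \<ge> T \<Longrightarrow> x \<le> y \<Longrightarrow> y \<le> 2 ^ n * x \<Longrightarrow>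
      0 < r y \<and> (y / x) powr \<theta> * r y \<le> 2 * r x"
    using r_compare[of 2 "2 ^ n"] by auto
  have "t * r t / R t < a" if t: "t \<ge> 2 ^ n * T" for t
  proof -
    have tT: "t \<ge> T" "t > 0"
    proof -
      have "1 * T \<le> 2 ^ n * T" using T by (intro mult_right_mono) auto
      then show "t \<ge> T" "t > 0" using t T by linarith+
    qed
    have step: "t * r t / 4 \<le> R (t / 2 ^ j) - R (t / 2 ^ Suc j)" if j: "j < n" for j
    proof -
      have nj: "(2::real) ^ Suc j \<le> 2 ^ n" using j by (intro power_increasing) auto
      have "(t / 2 ^ j - t / 2 ^ Suc j) * (2 ^ j * r t / 2) \<le> integral {t / 2 ^ Suc j..t / 2 ^ j} r"
      proof (rule integral_r_ge)
        fix u assume u: "t / 2 ^ Suc j \<le> u" "u \<le> t / 2 ^ j"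
        have u0: "u > 0" using u(1) tT by (smt (verit) divide_pos_pos zero_less_power)
        have "t \<le> 2 ^ Suc j * u" using u(1) by (simp add: field_simps)
        also have "\<dots> \<le> 2 ^ n * u" using nj u0 by (intro mult_right_mono) auto
        finally have tu: "t \<le> 2 ^ n * u" .
        have uT: "u \<ge> T" using t tu by (smt (verit) mult_le_cancel_left_pos zero_less_power)
        have "2 ^ j * u \<le> t" using u(2) by (simp add: field_simps)
        then have tu': "2 ^ j \<le> t / u" using u0 by (simp add: field_simps)
        have ut: "u \<le> t"
        proof -
          have "1 * u \<le> 2 ^ j * u" using u0 by (intro mult_right_mono) auto
          then show ?thesis using \<open>2 ^ j * u \<le> t\<close> by simp
        qed
        have "2 ^ j * r t \<le> (t / u) powr \<theta> * r t"
        proof (intro mult_right_mono r_nonneg)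
          have "1 \<le> t / u" using ut u0 by simp
          then have "(t / u) powr 1 \<le> (t / u) powr \<theta>" using assms by (intro powr_mono) auto
          then show "2 ^ j \<le> (t / u) powr \<theta>" using tu' ut u0 tT by simp
        qed
        also have "\<dots> \<le> 2 * r u" using *[OF uT ut tu] by simp
        finally show "2 ^ j * r t / 2 \<le> r u" by simp
      qed (use tT in \<open>auto simp: field_simps\<close>)
      also have "\<dots> = R (t / 2 ^ j) - R (t / 2 ^ Suc j)"
        using tT by (intro R_diff[symmetric]) (auto simp: field_simps)
      finally show ?thesis by (simp add: field_simps)
    qed
    have "real n * (t * r t / 4) = (\<Sum>j<n. t * r t / 4)" by simp
    also have "\<dots> \<le> (\<Sum>j<n. R (t / 2 ^ j) - R (t / 2 ^ Suc j))" by (intro sum_mono step) auto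
    also have "\<dots> = R (t / 2 ^ 0) - R (t / 2 ^ n)" by (rule sum_lessThan_telescope')
    also have "\<dots> \<le> R t" using R_nonneg by simp
    finally have le: "real n * (t * r t / 4) \<le> R t" .
    have pos: "0 < t * r t" using *[OF tT(1), of t] tT mult_right_mono[of 1 "2 ^ n" t] by simp
    then have "0 < R t" using le n by (smt (verit) divide_pos_pos mult_pos_pos of_nat_0_less_iff)
    have "4 * (t * r t) < a * real n * (t * r t)" using n pos by (intro mult_strict_right_mono) auto
    then have "t * r t < a * (real n * (t * r t / 4))" by simp
    also have "\<dots> \<le> a * R t" using le a by (intro mult_left_mono) auto
    finally have "t * r t < a * R t" .
    with \<open>0 < R t\<close> show ?thesis by (simp add: pos_divide_less_eq)
  qed
  then show "eventually (\<lambda>t. t * r t / R t < a) at_top"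
    unfolding eventually_at_top_linorder by blast
qed

end

context power_intensity
begin

lemma R_doubling:
  assumes \<theta>1: "\<theta> \<ge> 1" and "\<epsilon> > 0"
  shows "eventually (\<lambda>t. R (2 * t) \<le> (1 + \<epsilon>) * R t) at_top"
proof -
  obtain T where T: "T > 0" and *: "\<And>x y. x \<ge> T \<Longrightarrow> x \<le> y \<Longrightarrow> y \<le> 2 * x \<Longrightarrow> r y \<le> 2 * r x"
    using r_bounded_ratio[of 2] by auto
  have "eventually (\<lambda>t. t * r t / R t < \<epsilon> / 2) at_top"
    using order_tendstoD(2)[OF tr_over_R_tendsto_0[OF \<theta>1], of "\<epsilon> / 2"] assms by simp
  then show ?thesis using R_eventually_pos eventually_ge_at_top[of T]
  proof eventually_elim
    case (elim t)
    have "integral {t..2 * t} r \<le> (2 * t - t) * (2 * r t)"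
      using elim T * by (intro integral_r_le) auto
    also have "\<dots> = 2 * (t * r t)" by simp
    also have "\<dots> \<le> \<epsilon> * R t" using elim by (simp add: field_simps)
    finally show ?case using R_diff[of t "2 * t"] elim T by (simp add: algebra_simps)
  qed
qed

end

text \<open>
  Here \<open>p\<close> stands for the probability that an immigration wave of age \<open>t\<close> has living descendants.
\<close>

locale power_intensity_kernel = power_intensity +
  fixes p :: "real \<Rightarrow> real" and \<beta> :: real
  assumes \<theta>1: "\<theta> \<ge> 1" and \<beta>: "0 < \<beta>" "\<beta> < 1"
    and p_rv: "regularly_varying (- \<beta>) p"
    and p_antimono: "\<And>x y. 0 \<le> x \<Longrightarrow> x \<le> y \<Longrightarrow> p y \<le> p x"
    and p_pos: "\<And>x. 0 \<le> x \<Longrightarrow> 0 < p x"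
    and p_cont: "continuous_on {0..} p"
begin

lemma p_integrable: "0 \<le> a \<Longrightarrow> p integrable_on {a..b}"
  by (intro integrable_continuous_interval continuous_on_subset[OF p_cont]) auto

lemma integral_p_le: "\<exists>T>0. \<exists>C>0. \<forall>t\<ge>T. integral {0..t} p \<le> C * (t * p t)"
proof -
  have b: "1/2 < 2 powr (- \<beta>)" using powr_less_mono[of "-1" "- \<beta>" 2] \<beta> by (simp add: powr_minus)
  then obtain \<eta> where \<eta>: "1/2 < \<eta>" "\<eta> < 2 powr (- \<beta>)" using dense by blast
  have "eventually (\<lambda>t. \<eta> < p (2 * t) / p t) at_top"
    using order_tendstoD(1)[OF regularly_varyingD[OF p_rv, of 2]] \<eta> by simp
  then obtain T0 where T0: "\<And>t. t \<ge> T0 \<Longrightarrow> \<eta> < p (2 * t) / p t" unfolding eventually_at_top_linorder by blast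
  define T where "T = max 1 T0"
  have T: "T \<ge> 1" "T \<ge> T0" by (auto simp: T_def)
  have pt: "\<eta> * p t \<le> p (2 * t)" if "t \<ge> T" for t
    using T0[of t] p_pos[of t] that T by (simp add: field_simps)
  have "\<exists>C>0. \<forall>t\<ge>T. integral {0..t} p \<le> C * (t * p t)"
  proof (rule doubling_dominated[of T "1 / (2 * \<eta>)" "1 / (2 * \<eta>)" _ _ "integral {0..2 * T} p / (T * p (2 * T))"])
    show "integral {0..2 * t} p \<le> integral {0..t} p + 1 / (2 * \<eta>) * (2 * t * p (2 * t))" if t: "T \<le> t" for t
    proof -
      have "integral {t..2 * t} p \<le> integral {t..2 * t} (\<lambda>_. p t)"
        using t T p_antimono by (intro integral_le p_integrable) auto
      also have "\<dots> = t * p t" using t T by simp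
      also have "\<dots> \<le> 1 / (2 * \<eta>) * (2 * t * p (2 * t))"
        using mult_left_mono[OF pt[OF t], of t] t T \<eta> by (simp add: field_simps)
      finally show ?thesis
        using Henstock_Kurzweil_Integration.integral_combine[of 0 t "2 * t" p] t T p_integrable[of 0 "2 * t"] by simp
    qed
    show "t * p t \<le> 1 / (2 * \<eta>) * (2 * t * p (2 * t))" if t: "T \<le> t" for t
      using mult_left_mono[OF pt[OF t], of t] t T \<eta> by (simp add: field_simps)
    show "0 \<le> t * p t" if "T \<le> t" for t using that T p_pos[of t] by simp
    show "integral {0..t} p \<le> integral {0..2 * T} p / (T * p (2 * T)) * (t * p t)" if t: "T \<le> t" "t \<le> 2 * T" for t
    proof -
      have "integral {0..t} p \<le> integral {0..2 * T} p"
        using t T p_pos by (intro integral_subset_le p_integrable) (auto intro: less_imp_le)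
      moreover have "1 \<le> (t * p t) / (T * p (2 * T))"
      proof -
        have "T * p (2 * T) \<le> t * p t"
          using t T p_pos[of "2 * T"] p_antimono[of t "2 * T"] by (intro mult_mono) auto
        then show ?thesis using T p_pos[of "2 * T"] by simp
      qed
      moreover have "0 \<le> integral {0..2 * T} p"
        using p_pos T by (intro Henstock_Kurzweil_Integration.integral_nonneg p_integrable) (auto intro: less_imp_le)
      ultimately show ?thesis
        using mult_mono[of "integral {0..t} p" "integral {0..2 * T} p" 1 "(t * p t) / (T * p (2 * T))"]
        by simp
    qed
  qed (use T \<eta> in \<open>auto simp: field_simps\<close>)
  then show ?thesis using T by (intro exI[of _ T]) auto
qed

text \<open>
  \<open>R\<close> is slowly varying, so the negative index of \<open>p\<close> wins.
\<close>

lemma Rp_tendsto_0: "((\<lambda>t. R t * p t) \<longlongrightarrow> 0) at_top"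
proof -
  have b: "2 powr (- \<beta>) < 1" using powr_less_mono[of "- \<beta>" 0 2] \<beta> by simp
  then obtain \<eta> where \<eta>: "2 powr (- \<beta>) < \<eta>" "\<eta> < 1" using dense by blast
  have \<eta>0: "0 < \<eta>" using \<eta>(1) powr_gt_zero[of 2 "- \<beta>"] by linarith
  obtain \<eta>' where \<eta>': "\<eta> < \<eta>'" "\<eta>' < 1" using \<eta>(2) dense by blast
  define \<epsilon> where "\<epsilon> = \<eta>' / \<eta> - 1"
  have \<epsilon>: "\<epsilon> > 0" "(1 + \<epsilon>) * \<eta> = \<eta>'" using \<eta>' \<eta>0 by (auto simp: \<epsilon>_def)
  have "eventually (\<lambda>t. p (2 * t) / p t < \<eta>) at_top"
    using order_tendstoD(2)[OF regularly_varyingD[OF p_rv, of 2]] \<eta> by simp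
  then have "eventually (\<lambda>t. R (2 * t) * p (2 * t) \<le> \<eta>' * (R t * p t)) at_top"
    using R_doubling[OF \<theta>1 \<epsilon>(1)] eventually_ge_at_top[of "0::real"]
  proof eventually_elim
    case (elim t)
    have "p (2 * t) \<le> \<eta> * p t" using elim p_pos[of t] by (simp add: field_simps)
    then have "R (2 * t) * p (2 * t) \<le> ((1 + \<epsilon>) * R t) * (\<eta> * p t)"
      using elim R_nonneg \<epsilon> p_pos[of "2 * t"] by (intro mult_mono) auto
    also have "\<dots> = ((1 + \<epsilon>) * \<eta>) * (R t * p t)" by (simp only: ac_simps)
    finally show ?case unfolding \<epsilon>(2) .
  qed
  then obtain T0 where T0: "\<And>t. t \<ge> T0 \<Longrightarrow> R (2 * t) * p (2 * t) \<le> \<eta>' * (R t * p t)"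
    unfolding eventually_at_top_linorder by blast
  define T where "T = max 1 T0"
  have T: "T \<ge> 1" "T \<ge> T0" by (auto simp: T_def)
  show ?thesis
  proof (rule doubling_decay[of T \<eta>' _ "R (2 * T) * p T"])
    show "R t * p t \<le> R (2 * T) * p T" if "T \<le> t" "t \<le> 2 * T" for t
      using that T R_mono[of t "2 * T"] p_antimono[of T t] R_nonneg p_pos[of t] by (intro mult_mono) auto
    show "0 \<le> R t * p t" if "T \<le> t" for t using that T R_nonneg p_pos[of t] by simp
  qed (use T T0 \<eta>' \<eta>0 in auto)
qed

lemma p_tendsto:
  assumes "((\<lambda>t. a t / t) \<longlongrightarrow> c) at_top" "c > 0"
  shows "((\<lambda>t. p (a t) / p t) \<longlongrightarrow> c powr (- \<beta>)) at_top"
  using regularly_varying_antimono_tendsto[OF p_rv p_antimono p_pos filterlim_ident assms] by blast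

text \<open>
  Since \<open>t * r t = o(R t)\<close>, almost all of the mass of \<open>r\<close> on \<open>[0, t]\<close> lies in \<open>[0, \<delta> t]\<close> for every
  \<open>\<delta> > 0\<close>, where the kernel is close to \<open>p (t + w t)\<close>. On \<open>[\<delta> t, t]\<close> the kernel may be large, but its
  integral is at most of order \<open>t * p t\<close> because the index of \<open>p\<close> is above -1, so this part is of order
  \<open>t * r t * p t\<close> and negligible.
\<close>

theorem convolution_asymptotics:
  assumes w: "\<And>t. 0 \<le> w t" "((\<lambda>t. w t / t) \<longlongrightarrow> \<kappa>) at_top" and \<kappa>: "\<kappa> \<ge> 0"
  shows "((\<lambda>t. integral {0..t} (\<lambda>u. r u * p (t - u + w t)) / (R t * p t)) \<longlongrightarrow> (1 + \<kappa>) powr (- \<beta>)) at_top"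
proof -
  let ?I = "\<lambda>t. integral {0..t} (\<lambda>u. r u * p (t - u + w t))"
  have cont: "continuous_on {a..b} (\<lambda>u. p (t - u + w t))" if "b \<le> t" for a b t
    using w that by (intro continuous_on_compose2[OF p_cont] continuous_intros) auto
  have one: "((\<lambda>t::real. t / t) \<longlongrightarrow> 1) at_top"
    using eventually_gt_at_top[of "0::real"] by (intro tendsto_eventually) (auto elim: eventually_mono)
  have shift: "((\<lambda>t. (c * t + w t) / t) \<longlongrightarrow> c + \<kappa>) at_top" for c
  proof -
    have "(c * t + w t) / t = c * (t / t) + w t / t" for t by (simp add: add_divide_distrib)
    then show ?thesis using tendsto_add[OF tendsto_mult[OF tendsto_const[of c] one] w(2)] by (simp only: mult_1_right)
  qed
  show ?thesis
  proof (rule order_tendstoI)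
    fix y assume "y < (1 + \<kappa>) powr (- \<beta>)"
    then have "eventually (\<lambda>t. y < p (1 * t + w t) / p t) at_top"
      using order_tendstoD(1)[OF p_tendsto[OF shift[of 1]]] \<kappa> by simp
    then show "eventually (\<lambda>t. y < ?I t / (R t * p t)) at_top"
      using R_eventually_pos eventually_ge_at_top[of "0::real"]
    proof eventually_elim
      case (elim t)
      have "p (t + w t) * (R t - R 0) \<le> ?I t"
        using elim w(1)[of t] by (intro integral_product_ge cont p_antimono) auto
      then have "p (t + w t) * R t \<le> ?I t" by (simp add: R_def)
      then have "p (t + w t) * R t / (R t * p t) \<le> ?I t / (R t * p t)"
        using elim p_pos[of t] by (intro divide_right_mono) auto
      then show ?case using elim by simp
    qed
  next
    fix y assume y: "(1 + \<kappa>) powr (- \<beta>) < y"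
    have "((\<lambda>x. (1 - x + \<kappa>) powr (- \<beta>)) \<longlongrightarrow> (1 - 0 + \<kappa>) powr (- \<beta>)) (at_right 0)"
      using \<kappa> by (intro tendsto_intros) auto
    then have "eventually (\<lambda>x. (1 - x + \<kappa>) powr (- \<beta>) < y) (at_right 0)"
      using y by (intro order_tendstoD(2)) auto
    moreover have "eventually (\<lambda>x. x \<in> {0<..<1}) (at_right (0::real))" by (rule eventually_at_right_real) simp
    ultimately have "eventually (\<lambda>x. (1 - x + \<kappa>) powr (- \<beta>) < y \<and> x \<in> {0<..<1}) (at_right 0)"
      by (rule eventually_conj)
    then obtain \<delta> where \<delta>: "(1 - \<delta> + \<kappa>) powr (- \<beta>) < y" "0 < \<delta>" "\<delta> < 1"
      using eventually_happens'[OF trivial_limit_at_right_real] by auto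
    obtain T1 C1 where T1: "T1 > 0" "C1 \<ge> 1" "\<And>x z. x \<ge> T1 \<Longrightarrow> x \<le> z \<Longrightarrow> z \<le> (1 / \<delta>) * x \<Longrightarrow> r x \<le> C1 * r z"
      using r_bounded_ratio[of "1 / \<delta>"] \<delta> by auto
    obtain T2 C2 where T2: "T2 > 0" "C2 > 0" "\<And>t. t \<ge> T2 \<Longrightarrow> integral {0..t} p \<le> C2 * (t * p t)"
      using integral_p_le by blast
    have "((\<lambda>t. p ((1 - \<delta>) * t + w t) / p t + C1 * C2 * (t * r t / R t)) \<longlongrightarrow>
        (1 - \<delta> + \<kappa>) powr (- \<beta>) + C1 * C2 * 0) at_top"
      using \<delta> \<kappa> by (intro tendsto_add tendsto_mult tendsto_const tr_over_R_tendsto_0[OF \<theta>1] p_tendsto shift) auto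
    then have "eventually (\<lambda>t. p ((1 - \<delta>) * t + w t) / p t + C1 * C2 * (t * r t / R t) < y) at_top"
      using \<delta> by (intro order_tendstoD(2)) auto
    then show "eventually (\<lambda>t. ?I t / (R t * p t) < y) at_top"
      using R_eventually_pos eventually_ge_at_top[of T2] eventually_ge_at_top[of "T1 / \<delta>"]
    proof eventually_elim
      case (elim t)
      have t0: "t > 0" using elim T2 by simp
      have dt: "0 \<le> \<delta> * t" "\<delta> * t \<le> t" "T1 \<le> \<delta> * t"
        using t0 \<delta> elim by (auto simp: field_simps)
      have "?I t = integral {0..\<delta> * t} (\<lambda>u. r u * p (t - u + w t)) + integral {\<delta> * t..t} (\<lambda>u. r u * p (t - u + w t))"
        using dt by (intro integral_product_split cont) auto
      moreover have "integral {0..\<delta> * t} (\<lambda>u. r u * p (t - u + w t)) \<le> p ((1 - \<delta>) * t + w t) * (R (\<delta> * t) - R 0)"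
      proof (rule integral_product_le[OF _ _ cont])
        have "(1 - \<delta>) * t + w t = t - \<delta> * t + w t" by (simp add: algebra_simps)
        then show "p (t - u + w t) \<le> p ((1 - \<delta>) * t + w t)" if "0 \<le> u" "u \<le> \<delta> * t" for u
          using that dt w(1)[of t] by (intro p_antimono) linarith+
      qed (use dt in auto)
      moreover have "p ((1 - \<delta>) * t + w t) * (R (\<delta> * t) - R 0) \<le> p ((1 - \<delta>) * t + w t) * R t"
        using dt R_mono[of "\<delta> * t" t] p_pos[of "(1 - \<delta>) * t + w t"] w(1)[of t] \<delta> t0
        by (intro mult_left_mono) (auto simp: R_def)
      moreover have "integral {\<delta> * t..t} (\<lambda>u. r u * p (t - u + w t)) \<le> (C1 * r t) * (C2 * (t * p t))"
      proof -
        have "integral {\<delta> * t..t} (\<lambda>u. r u * p (t - u + w t)) \<le> (C1 * r t) * integral {\<delta> * t..t} (\<lambda>u. p (t - u + w t))"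
        proof (rule integral_product_le'[OF _ _ cont])
          show "0 \<le> p (t - u + w t)" if "u \<le> t" for u using p_pos[of "t - u + w t"] w(1)[of t] that by simp
          show "r u \<le> C1 * r t" if "\<delta> * t \<le> u" "u \<le> t" for u
            using T1(3)[of u t] that dt \<delta> by (simp add: field_simps)
        qed (use dt in auto)
        also have "integral {\<delta> * t..t} (\<lambda>u. p (t - u + w t)) \<le> integral {\<delta> * t..t} (\<lambda>u. p (t - u))"
        proof (intro integral_le integrable_continuous_interval)
          show "continuous_on {\<delta> * t..t} (\<lambda>u. p (t - u))"
            by (intro continuous_on_compose2[OF p_cont] continuous_intros) auto
        qed (use w(1)[of t] in \<open>auto intro!: cont p_antimono\<close>)
        also have "\<dots> = integral {0..t - \<delta> * t} p"
          using integral_convolution_reflect[of "\<delta> * t" t p t] by simp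
        also have "\<dots> \<le> integral {0..t} p"
          using dt p_pos by (intro integral_subset_le p_integrable) (auto intro: less_imp_le)
        also have "\<dots> \<le> C2 * (t * p t)" using T2(3) elim by simp
        finally show ?thesis using T1 r_nonneg[of t] by (simp add: mult_left_mono)
      qed
      ultimately have "?I t \<le> p ((1 - \<delta>) * t + w t) * R t + (C1 * r t) * (C2 * (t * p t))" by linarith
      then have "?I t / (R t * p t) \<le> (p ((1 - \<delta>) * t + w t) * R t + (C1 * r t) * (C2 * (t * p t))) / (R t * p t)"
        using elim p_pos[of t] t0 by (intro divide_right_mono) auto
      also have "\<dots> = p ((1 - \<delta>) * t + w t) / p t + C1 * C2 * (t * r t / R t)"
        using elim p_pos[of t] t0 by (simp add: field_simps)
      finally show ?case using elim by simp
    qed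
  qed
qed

end

lemma integral_tendsto_half_line:
  fixes f :: "real \<Rightarrow> real"
  assumes "f integrable_on {0..}" "\<And>x. 0 \<le> x \<Longrightarrow> 0 \<le> f x"
  shows "((\<lambda>B. integral {0..B} f) \<longlongrightarrow> integral {0..} f) at_top"
proof -
  have ai: "f absolutely_integrable_on {0..}"
    using assms by (intro nonnegative_absolutely_integrable_1) auto
  have "((\<lambda>B. set_lebesgue_integral lebesgue {0..B} f) \<longlongrightarrow> set_lebesgue_integral lebesgue {0..} f) at_top"
    by (rule tendsto_set_lebesgue_integral_at_top[OF _ ai]) auto
  moreover have "set_lebesgue_integral lebesgue {0..B} f = integral {0..B} f" for B
    by (rule set_lebesgue_integral_eq_integral(2)) (rule absolutely_integrable_on_subinterval[OF ai], auto)
  moreover have "set_lebesgue_integral lebesgue {0..} f = integral {0..} f"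
    by (rule set_lebesgue_integral_eq_integral(2)[OF ai])
  ultimately show ?thesis by simp
qed

context power_intensity
begin

text \<open>
  Now the recent times dominate. On \<open>[t - B, t]\<close> the intensity is nearly constant and the integral is
  close to \<open>r t\<close> times that of \<open>k\<close> over \<open>[0, B]\<close>. On \<open>[t / 2, t - B]\<close> the intensity is still of order
  \<open>r t\<close>, and only a tail of the integral of \<open>k\<close> is left. On \<open>[0, t / 2]\<close> the kernel is at most \<open>q (t / 2) = o(1 / t)\<close>,
  whereas the mass of \<open>r\<close> is of order \<open>t * r t\<close>.
\<close>

theorem convolution_integrable_asymptotics:
  fixes q k :: "real \<Rightarrow> real"
  assumes \<theta>1: "\<theta> < 1"
    and q: "\<And>x y. 0 \<le> x \<Longrightarrow> x \<le> y \<Longrightarrow> q y \<le> q x" "continuous_on {0..} q" "q integrable_on {0..}"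
    and k: "\<And>x. 0 \<le> x \<Longrightarrow> 0 \<le> k x" "\<And>x. 0 \<le> x \<Longrightarrow> k x \<le> q x" "continuous_on {0..} k"
  shows "((\<lambda>t. integral {0..t} (\<lambda>u. r u * k (t - u)) / r t) \<longlongrightarrow> integral {0..} k) at_top"
proof -
  let ?I = "\<lambda>t. integral {0..t} (\<lambda>u. r u * k (t - u))"
  have q0: "0 \<le> q x" if "0 \<le> x" for x using k(1,2)[OF that] by simp
  have q_int: "q integrable_on {a..b}" if "0 \<le> a" for a b
    using that by (intro integrable_continuous_interval continuous_on_subset[OF q(2)]) auto
  have k_int': "k integrable_on {a..b}" if "0 \<le> a" for a b
    using that by (intro integrable_continuous_interval continuous_on_subset[OF k(3)]) auto
  have k_int: "k integrable_on {0..}"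
  proof (rule measurable_bounded_by_integrable_imp_integrable[OF _ q(3)])
    show "k \<in> borel_measurable (lebesgue_on {0..})"
      by (rule continuous_imp_measurable_on_sets_lebesgue[OF k(3)]) auto
  qed (use k in auto)
  have k_lim: "((\<lambda>B. integral {0..B} k) \<longlongrightarrow> integral {0..} k) at_top"
    by (rule integral_tendsto_half_line[OF k_int k(1)])
  have q_lim: "((\<lambda>B. integral {0..B} q) \<longlongrightarrow> integral {0..} q) at_top"
    by (rule integral_tendsto_half_line[OF q(3) q0])
  have q_le: "integral {0..b} q \<le> integral {0..} q" for b
    using q0 by (intro integral_subset_le q_int q(3)) auto
  have k_le: "integral {0..b} k \<le> integral {0..} k" for b
    using k(1) by (intro integral_subset_le k_int k_int') auto
  have contk: "continuous_on {a..b} (\<lambda>u. k (t - u))" if "b \<le> t" for a b t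
    using that by (intro continuous_on_compose2[OF k(3)] continuous_intros) auto
  have refl: "integral {t - b..t - a} (\<lambda>u. k (t - u)) = integral {a..b} k" for a b t
    using integral_convolution_reflect[of "t - b" "t - a" k t] by simp
  \<comment> \<open>\<open>u / t\<close> tends to 1 uniformly on \<open>[t - B, t]\<close>; one factor \<open>sqrt \<eta>\<close> is spent on the slowly
    varying part and the other on the power\<close>
  have r_near: "eventually (\<lambda>t. \<forall>u. t - B \<le> u \<and> u \<le> t \<longrightarrow> r t / \<eta> \<le> r u \<and> r u \<le> \<eta> * r t) at_top"
    if \<eta>: "\<eta> > 1" for B \<eta>
  proof -
    define \<eta>' where "\<eta>' = sqrt \<eta>"
    have \<eta>': "\<eta>' > 1" "\<eta>' * \<eta>' = \<eta>" using \<eta> by (auto simp: \<eta>'_def)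
    obtain T where T: "T > 0" and *: "\<And>x y. x \<ge> T \<Longrightarrow> x \<le> y \<Longrightarrow> y \<le> 2 * x \<Longrightarrow>
        0 < r x \<and> 0 < r y \<and> (y / x) powr \<theta> * r y \<le> \<eta>' * r x \<and> r x \<le> \<eta>' * (y / x) powr \<theta> * r y"
      using r_compare[of \<eta>' 2] \<eta>' by auto
    have "((\<lambda>t::real. (t / (t - B)) powr \<theta>) \<longlongrightarrow> 1 powr \<theta>) at_top"
    proof (intro tendsto_intros)
      show "((\<lambda>t::real. t / (t - B)) \<longlongrightarrow> 1) at_top" by real_asymp
    qed auto
    then have "eventually (\<lambda>t. (t / (t - B)) powr \<theta> < \<eta>') at_top"
      using \<eta>' by (intro order_tendstoD(2)) auto
    then show ?thesis
      using eventually_ge_at_top[of "T + \<bar>B\<bar>"] eventually_ge_at_top[of "2 * \<bar>B\<bar>"]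
    proof eventually_elim
      case (elim t)
      show ?case
      proof safe
        fix u assume u: "t - B \<le> u" "u \<le> t"
        have uT: "u \<ge> T" "t \<le> 2 * u" "t - B > 0" "u > 0" using u elim T by auto
        note b = *[OF uT(1) u(2) uT(2)]
        have "1 \<le> t / u" using u uT by simp
        then have "1 powr \<theta> \<le> (t / u) powr \<theta>" using \<theta> by (intro powr_mono2) auto
        then have "1 * r t \<le> (t / u) powr \<theta> * r t" using r_nonneg by (intro mult_right_mono) auto
        then have "r t \<le> \<eta>' * r u" using b by linarith
        also have "\<dots> \<le> \<eta> * r u"
          using r_nonneg[of u] \<eta>' mult_right_mono[of 1 \<eta>' \<eta>'] by (intro mult_right_mono) auto
        finally show "r t / \<eta> \<le> r u" using \<eta> by (simp add: field_simps)
        have "t / u \<le> t / (t - B)" using u uT elim T by (intro divide_left_mono) auto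
        then have "(t / u) powr \<theta> \<le> (t / (t - B)) powr \<theta>" using \<theta> uT u by (intro powr_mono2) auto
        then have le: "(t / u) powr \<theta> \<le> \<eta>'" using elim by simp
        have "r u \<le> \<eta>' * (t / u) powr \<theta> * r t" using b by simp
        also have "\<dots> \<le> \<eta>' * \<eta>' * r t"
          using le \<eta>' r_nonneg[of t] by (intro mult_right_mono mult_left_mono) auto
        finally show "r u \<le> \<eta> * r t" using \<eta>' by simp
      qed
    qed
  qed
  show ?thesis
  proof (rule order_tendstoI)
    fix y assume y: "y < integral {0..} k"
    have "eventually (\<lambda>B. y < integral {0..B} k) at_top" by (rule order_tendstoD(1)[OF k_lim y])
    then have "eventually (\<lambda>B. 0 \<le> B \<and> y < integral {0..B} k) at_top"
      by (intro eventually_conj eventually_ge_at_top)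
    then obtain B where B: "B \<ge> 0" "y < integral {0..B} k"
      using eventually_happens'[OF trivial_limit_at_top_linorder] by blast
    define J where "J = integral {0..B} k"
    have J0: "0 \<le> J" unfolding J_def using k(1) by (intro Henstock_Kurzweil_Integration.integral_nonneg k_int') auto
    have "((\<lambda>\<eta>. J / \<eta>) \<longlongrightarrow> J / 1) (at_right 1)" by (intro tendsto_intros) auto
    then have "eventually (\<lambda>\<eta>. y < J / \<eta>) (at_right 1)" using B by (intro order_tendstoD(1)) (auto simp: J_def)
    moreover have "eventually (\<lambda>\<eta>. \<eta> \<in> {1<..<2}) (at_right (1::real))" by (rule eventually_at_right_real) simp
    ultimately have "eventually (\<lambda>\<eta>. y < J / \<eta> \<and> \<eta> \<in> {1<..<2}) (at_right 1)" by (rule eventually_conj)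
    then obtain \<eta> where \<eta>: "y < J / \<eta>" "1 < \<eta>"
      using eventually_happens'[OF trivial_limit_at_right_real] by auto
    show "eventually (\<lambda>t. y < ?I t / r t) at_top"
      using r_near[OF \<eta>(2), of B] r_eventually_pos eventually_ge_at_top[of "B"]
    proof eventually_elim
      case (elim t)
      have "?I t = integral {0..t - B} (\<lambda>u. r u * k (t - u)) + integral {t - B..t} (\<lambda>u. r u * k (t - u))"
        using B elim by (intro integral_product_split contk) auto
      moreover have "0 \<le> integral {0..t - B} (\<lambda>u. r u * k (t - u))"
        using B elim k(1) by (intro integral_product_nonneg contk) auto
      moreover have "r t / \<eta> * integral {t - B..t} (\<lambda>u. k (t - u)) \<le> integral {t - B..t} (\<lambda>u. r u * k (t - u))"
        using B elim k(1) by (intro integral_product_ge' contk) auto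
      moreover have "integral {t - B..t} (\<lambda>u. k (t - u)) = J" using refl[of t B 0] by (simp add: J_def)
      ultimately have "r t / \<eta> * J \<le> ?I t" by simp
      then have "J / \<eta> \<le> ?I t / r t" using elim by (simp add: field_simps)
      then show ?case using \<eta> by simp
    qed
  next
    fix y assume y: "integral {0..} k < y"
    define J where "J = integral {0..} k"
    have J0: "0 \<le> J" unfolding J_def using k(1) by (intro Henstock_Kurzweil_Integration.integral_nonneg k_int) auto
    have "((\<lambda>\<eta>. \<eta> * J) \<longlongrightarrow> 1 * J) (at_right 1)" by (intro tendsto_intros)
    then have "eventually (\<lambda>\<eta>. \<eta> * J < y) (at_right 1)" using y by (intro order_tendstoD(2)) (auto simp: J_def)
    moreover have "eventually (\<lambda>\<eta>. \<eta> \<in> {1<..<2}) (at_right (1::real))" by (rule eventually_at_right_real) simp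
    ultimately have "eventually (\<lambda>\<eta>. \<eta> * J < y \<and> \<eta> \<in> {1<..<2}) (at_right 1)" by (rule eventually_conj)
    then obtain \<eta> where \<eta>: "\<eta> * J < y" "1 < \<eta>"
      using eventually_happens'[OF trivial_limit_at_right_real] by auto
    define \<epsilon> where "\<epsilon> = (y - \<eta> * J) / 2"
    have \<epsilon>: "\<epsilon> > 0" "\<eta> * J + \<epsilon> + \<epsilon> = y" using \<eta> by (auto simp: \<epsilon>_def field_simps)
    obtain T1 C1 where T1: "T1 > 0" "C1 \<ge> 1" "\<And>x z. x \<ge> T1 \<Longrightarrow> x \<le> z \<Longrightarrow> z \<le> 2 * x \<Longrightarrow> r x \<le> C1 * r z"
      using r_bounded_ratio[of 2] by auto
    obtain T2 C2 where T2: "T2 > 0" "C2 > 0" "\<And>t. t \<ge> T2 \<Longrightarrow> R t \<le> C2 * (t * r t)"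
      using R_le_tr[OF \<theta>1] by blast
    have "((\<lambda>B. integral {0..} q - integral {0..B} q) \<longlongrightarrow> 0) at_top"
      using tendsto_diff[OF tendsto_const q_lim, of "integral {0..} q"] by simp
    then have tail: "eventually (\<lambda>B. integral {0..} q - integral {0..B} q < e) at_top" if "e > 0" for e
      using that by (rule order_tendstoD(2))
    have "eventually (\<lambda>B. 0 \<le> B \<and> integral {0..} q - integral {0..B} q < \<epsilon> / C1) at_top"
      using \<epsilon> T1 by (intro eventually_conj eventually_ge_at_top tail) auto
    then obtain B where B: "B \<ge> 0" "integral {0..} q - integral {0..B} q < \<epsilon> / C1"
      using eventually_happens'[OF trivial_limit_at_top_linorder] by blast
    \<comment> \<open>\<open>t / 4 * q (t / 2)\<close> is at most the integral of \<open>q\<close> over \<open>[t / 4, t / 2]\<close>\<close>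
    have tq: "eventually (\<lambda>t. C2 * C1 * (t * q (t / 2)) < \<epsilon>) at_top"
    proof -
      have "\<epsilon> / (4 * C1 * C2) > 0" using \<epsilon> T1 T2 by simp
      from tail[OF this] have "eventually (\<lambda>t. integral {0..} q - integral {0..t / 4} q < \<epsilon> / (4 * C1 * C2)) at_top"
        by (rule eventually_compose_filterlim) real_asymp
      then show ?thesis using eventually_gt_at_top[of "0::real"]
      proof eventually_elim
        case (elim t)
        have "integral {t/4..t/2} (\<lambda>_. q (t / 2)) \<le> integral {t/4..t/2} q"
          using elim by (intro integral_le q_int q(1)) auto
        moreover have "integral {0..t/4} q + integral {t/4..t/2} q = integral {0..t/2} q"
          using elim by (intro Henstock_Kurzweil_Integration.integral_combine q_int) auto
        ultimately have "t / 4 * q (t / 2) < \<epsilon> / (4 * C1 * C2)"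
          using q_le[of "t / 2"] elim by simp
        then show ?case using T1 T2 by (simp add: field_simps)
      qed
    qed
    show "eventually (\<lambda>t. ?I t / r t < y) at_top"
      using tq r_near[OF \<eta>(2), of B] r_eventually_pos eventually_ge_at_top[of "2 * B + 2 * T1"] eventually_ge_at_top[of T2]
    proof eventually_elim
      case (elim t)
      have t: "0 < t" "t / 2 \<le> t - B" "0 \<le> t - B" "T1 \<le> t / 2" using elim T1 B by auto
      have "?I t = integral {0..t / 2} (\<lambda>u. r u * k (t - u)) + integral {t / 2..t} (\<lambda>u. r u * k (t - u))"
        using t by (intro integral_product_split contk) auto
      also have "integral {t / 2..t} (\<lambda>u. r u * k (t - u)) =
          integral {t / 2..t - B} (\<lambda>u. r u * k (t - u)) + integral {t - B..t} (\<lambda>u. r u * k (t - u))"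
        using t B by (intro integral_product_split contk) auto
      finally have split: "?I t = integral {0..t / 2} (\<lambda>u. r u * k (t - u)) +
          (integral {t / 2..t - B} (\<lambda>u. r u * k (t - u)) + integral {t - B..t} (\<lambda>u. r u * k (t - u)))" .
      have 1: "integral {t - B..t} (\<lambda>u. r u * k (t - u)) \<le> (\<eta> * r t) * J"
      proof -
        have "integral {t - B..t} (\<lambda>u. r u * k (t - u)) \<le> (\<eta> * r t) * integral {t - B..t} (\<lambda>u. k (t - u))"
          using t B k(1) elim by (intro integral_product_le' contk) auto
        also have "integral {t - B..t} (\<lambda>u. k (t - u)) \<le> J"
          using refl[of t B 0] k_le[of B] by (simp add: J_def)
        finally show ?thesis using \<eta> r_nonneg[of t] by (simp add: mult_left_mono)
      qed
      have 2: "integral {t / 2..t - B} (\<lambda>u. r u * k (t - u)) \<le> r t * \<epsilon>"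
      proof -
        have "integral {t / 2..t - B} (\<lambda>u. r u * k (t - u)) \<le> (C1 * r t) * integral {t / 2..t - B} (\<lambda>u. k (t - u))"
        proof (rule integral_product_le'[OF _ _ contk])
          show "r u \<le> C1 * r t" if "t / 2 \<le> u" "u \<le> t - B" for u
            using T1(3)[of u t] that t B by auto
        qed (use t B k(1) in auto)
        also have "integral {t / 2..t - B} (\<lambda>u. k (t - u)) = integral {B..t / 2} k"
          using refl[of t "t / 2" B] by simp
        also have "integral {B..t / 2} k \<le> integral {B..t / 2} q"
          using B k(2) by (intro integral_le k_int' q_int) auto
        also have "\<dots> = integral {0..t / 2} q - integral {0..B} q"
          using Henstock_Kurzweil_Integration.integral_combine[of 0 B "t / 2" q] B t q_int[of 0 "t / 2"] by simp
        also have "\<dots> \<le> \<epsilon> / C1" using q_le[of "t / 2"] B by simp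
        finally have "integral {t / 2..t - B} (\<lambda>u. r u * k (t - u)) \<le> (C1 * r t) * (\<epsilon> / C1)"
          using T1 r_nonneg[of t] by (simp add: mult_left_mono)
        then show ?thesis using T1 by simp
      qed
      have 3: "integral {0..t / 2} (\<lambda>u. r u * k (t - u)) < r t * \<epsilon>"
      proof -
        have "integral {0..t / 2} (\<lambda>u. r u * k (t - u)) \<le> q (t / 2) * (R (t / 2) - R 0)"
        proof (rule integral_product_le[OF _ _ contk])
          show "k (t - u) \<le> q (t / 2)" if "0 \<le> u" "u \<le> t / 2" for u
            using k(2)[of "t - u"] q(1)[of "t / 2" "t - u"] that t by auto
        qed (use t in auto)
        also have "\<dots> \<le> q (t / 2) * (C2 * (t * r t))"
          using T2(3)[of t] elim R_mono[of "t / 2" t] t q0[of "t / 2"]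
          by (intro mult_left_mono) (auto simp: R_def)
        also have "\<dots> = (C2 * (t * q (t / 2))) * r t" by simp
        also have "\<dots> \<le> (C2 * C1 * (t * q (t / 2))) * r t"
          using T1 T2 t q0[of "t / 2"] r_nonneg[of t] mult_right_mono[of 1 C1 "C2 * (t * q (t / 2))"]
          by (intro mult_right_mono) (auto simp: ac_simps)
        also have "\<dots> < \<epsilon> * r t" using elim by (intro mult_strict_right_mono) auto
        finally show ?thesis by (simp add: mult.commute)
      qed
      have "?I t < r t * (\<eta> * J + \<epsilon> + \<epsilon>)" using 1 2 3 split by (simp add: algebra_simps)
      then show ?case unfolding \<epsilon>(2) using elim by (simp add: field_simps)
    qed
  qed
qed

end


section \<open>Laplace transforms of distributions on the half-line\<close>

lemma norm_exp_minus_1_le: "norm (exp z - 1) \<le> exp \<bar>Re z\<bar> * norm (z::complex)"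
  using Taylor_exp[of z 0] by simp

locale nonneg_distribution = real_distribution M for M +
  assumes measure_neg: "measure M {..<0} = 0"
begin

lemma AE_nonneg: "AE x in M. 0 \<le> x"
proof -
  have "emeasure M {..<0} = 0" using measure_neg by (simp add: emeasure_eq_measure)
  then have "{..<0::real} \<in> null_sets M" by (intro null_setsI) auto
  then show ?thesis by (rule AE_I') auto
qed

definition laplace :: "complex \<Rightarrow> complex" where
  "laplace z = (CLINT x|M. exp (- z * of_real x))"

lemma exp_integrable: "0 \<le> Re z \<Longrightarrow> integrable M (\<lambda>x. exp (- z * complex_of_real x))"
  using AE_nonneg by (intro integrable_const_bound[where B=1]) (auto elim!: eventually_mono)

lemma laplace_of_real:
  assumes "0 < u"
  shows "laplace (of_real u) = of_real (LINT x|M. exp (- u * x))"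
  unfolding laplace_def of_real_exp[symmetric] of_real_mult[symmetric] of_real_minus[symmetric]
  by (rule integral_complex_of_real)

text \<open>
  Differentiation under the integral sign. With \<open>a = Re z / 2\<close> and increments of norm below \<open>a\<close>, the
  difference quotients are at most \<open>x * exp (- a * x) \<le> 1 / a\<close>.
\<close>

lemma laplace_has_derivative:
  assumes z: "0 < Re z"
  shows "(laplace has_field_derivative (CLINT x|M. - of_real x * exp (- z * of_real x))) (at z)"
proof -
  define a where "a = Re z / 2"
  have a: "a > 0" "Re z = 2 * a" using z by (auto simp: a_def)
  have "((\<lambda>h. (laplace (z + h) - laplace z) / h) \<longlongrightarrow> (CLINT x|M. - of_real x * exp (- z * of_real x)))
      (at 0 within ball 0 a)"
    unfolding tendsto_at_iff_sequentially
  proof safe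
    fix X :: "nat \<Rightarrow> complex" assume X: "\<forall>i. X i \<in> ball 0 a - {0}" "X \<longlonglongrightarrow> 0"
    let ?s = "\<lambda>n x. (exp (- (z + X n) * complex_of_real x) - exp (- z * complex_of_real x)) / X n"
    have Xn: "X n \<noteq> 0" "norm (X n) < a" for n using X(1) by auto
    have Re_pos: "0 \<le> Re (z + X n)" for n
      using abs_Re_le_cmod[of "X n"] Xn(2)[of n] a by auto
    have "(\<lambda>n. CLINT x|M. ?s n x) \<longlonglongrightarrow> (CLINT x|M. - of_real x * exp (- z * of_real x))"
    proof (rule integral_dominated_convergence[where w="\<lambda>_. 1 / a"])
      show "AE x in M. (\<lambda>n. ?s n x) \<longlonglongrightarrow> - of_real x * exp (- z * of_real x)"
      proof (intro AE_I2)
        fix x :: real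
        have "((\<lambda>w. exp (- w * complex_of_real x)) has_field_derivative - of_real x * exp (- z * of_real x)) (at z)"
          by (auto intro!: derivative_eq_intros)
        then have "((\<lambda>h. (exp (- (z + h) * complex_of_real x) - exp (- z * complex_of_real x)) / h) \<longlongrightarrow>
            - of_real x * exp (- z * of_real x)) (at 0)"
          by (simp only: DERIV_def)
        moreover have "filterlim X (at 0) sequentially"
          using X by (auto simp: filterlim_at)
        ultimately show "(\<lambda>n. ?s n x) \<longlonglongrightarrow> - of_real x * exp (- z * of_real x)"
          by (rule filterlim_compose)
      qed
      show "AE x in M. norm (?s n x) \<le> 1 / a" for n
        using AE_nonneg
      proof eventually_elim
        case (elim x)
        have "?s n x = exp (- z * of_real x) * (exp (- X n * of_real x) - 1) / X n"
          by (simp add: algebra_simps flip: exp_add)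
        then have "norm (?s n x) = norm (exp (- z * complex_of_real x)) * norm (exp (- X n * of_real x) - 1) / norm (X n)"
          by (simp only: norm_mult norm_divide)
        also have "norm (exp (- z * complex_of_real x)) = exp (- 2 * a * x)"
          using a by (simp add: norm_exp_eq_Re)
        finally have "norm (?s n x) = exp (- 2 * a * x) * norm (exp (- X n * of_real x) - 1) / norm (X n)" .
        also have "\<dots> \<le> exp (- 2 * a * x) * (exp (a * x) * (norm (X n) * x)) / norm (X n)"
        proof (intro divide_right_mono mult_left_mono)
          have "norm (exp (- X n * of_real x) - 1) \<le> exp \<bar>Re (- X n * of_real x)\<bar> * norm (- X n * complex_of_real x)"
            by (rule norm_exp_minus_1_le)
          also have "\<dots> \<le> exp (a * x) * (norm (X n) * x)"
          proof (intro mult_mono)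
            have "\<bar>Re (X n)\<bar> * x \<le> a * x"
              using abs_Re_le_cmod[of "X n"] Xn(2)[of n] elim by (intro mult_right_mono) auto
            then show "exp \<bar>Re (- X n * of_real x)\<bar> \<le> exp (a * x)" using elim by (simp add: abs_mult)
          qed (use elim in \<open>auto simp: norm_mult\<close>)
          finally show "norm (exp (- X n * of_real x) - 1) \<le> exp (a * x) * (norm (X n) * x)" .
        qed auto
        also have "\<dots> = exp (- a * x) * x" using Xn(1)[of n] by (simp add: field_simps flip: exp_add)
        also have "\<dots> \<le> 1 / a"
        proof -
          have "a * x \<le> exp (a * x)" using exp_ge_add_one_self[of "a * x"] by linarith
          then have "exp (- a * x) * (a * x) \<le> exp (- a * x) * exp (a * x)" by (intro mult_left_mono) auto
          then have "exp (- a * x) * (a * x) \<le> 1" by (simp flip: exp_add)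
          then show ?thesis using a by (simp add: field_simps)
        qed
        finally show ?case .
      qed
    qed auto
    moreover have "(CLINT x|M. ?s n x) = (laplace (z + X n) - laplace z) / X n" for n
    proof -
      have "(CLINT x|M. ?s n x) = (CLINT x|M. exp (- (z + X n) * complex_of_real x) - exp (- z * complex_of_real x)) / X n"
        by (rule integral_divide_zero)
      also have "(CLINT x|M. exp (- (z + X n) * complex_of_real x) - exp (- z * complex_of_real x)) = laplace (z + X n) - laplace z"
        unfolding laplace_def using Re_pos z
        by (intro Bochner_Integration.integral_diff exp_integrable) auto
      finally show ?thesis .
    qed
    ultimately show "((\<lambda>h. (laplace (z + h) - laplace z) / h) \<circ> X) \<longlonglongrightarrow> (CLINT x|M. - of_real x * exp (- z * of_real x))"
      by (simp only: o_def)
  qed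
  then show ?thesis
    using a by (simp add: DERIV_def at_within_open[of 0 "ball 0 a"])
qed

lemma laplace_holomorphic: "laplace holomorphic_on {z. 0 < Re z}"
  unfolding holomorphic_on_def field_differentiable_def
  using laplace_has_derivative has_field_derivative_at_within by blast

lemma char_eq_lim_laplace: "(\<lambda>n. laplace (of_real (1 / Suc n) - \<i> * of_real t)) \<longlonglongrightarrow> char M t"
  unfolding laplace_def char_def
proof (rule integral_dominated_convergence[where w="\<lambda>_. 1"])
  show "AE x in M. (\<lambda>n. exp (- (complex_of_real (1 / Suc n) - \<i> * of_real t) * of_real x)) \<longlonglongrightarrow> iexp (t * x)"
  proof (intro AE_I2)
    fix x
    have "(\<lambda>n. 1 / real (Suc n)) \<longlonglongrightarrow> 0" by real_asymp
    then have "(\<lambda>n. exp (- (complex_of_real (1 / Suc n) - \<i> * of_real t) * of_real x)) \<longlonglongrightarrow>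
        exp (- (of_real 0 - \<i> * of_real t) * of_real x)"
      by (intro tendsto_intros)
    then show "(\<lambda>n. exp (- (complex_of_real (1 / Suc n) - \<i> * of_real t) * of_real x)) \<longlonglongrightarrow> iexp (t * x)"
      by (simp add: mult.assoc)
  qed
  show "AE x in M. norm (exp (- (complex_of_real (1 / Suc n) - \<i> * of_real t) * of_real x)) \<le> 1" for n
    using AE_nonneg by eventually_elim simp
qed auto

end

lemma laplace_eq_on_halfplane:
  fixes f g :: "complex \<Rightarrow> complex"
  assumes f: "f holomorphic_on {z. c < Re z}" and g: "g holomorphic_on {z. c < Re z}"
    and eq: "\<And>u. c < u \<Longrightarrow> f (of_real u) = g (of_real u)" and z: "c < Re z"
  shows "f z = g z"
proof -
  let ?S = "{z. c < Re z}" and ?U = "complex_of_real ` {c<..}"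
  have "f z - g z = 0"
  proof (rule analytic_continuation[where f="\<lambda>z. f z - g z" and w=z and S="?S" and U="?U" and \<xi>="of_real (c + 1)"])
    show "(\<lambda>z. f z - g z) holomorphic_on ?S" using f g by (intro holomorphic_intros)
    show "open ?S" by (rule open_halfspace_Re_gt)
    show "connected ?S" by (intro convex_connected convex_halfspace_Re_gt)
    show "complex_of_real (c + 1) islimpt ?U"
      unfolding islimpt_sequential
    proof (intro exI conjI allI)
      show "complex_of_real (c + 1 + 1 / Suc n) \<in> ?U - {of_real (c + 1)}" for n
      proof -
        have "c + 1 + 1 / Suc n \<noteq> c + 1" "c < c + 1 + 1 / Suc n" by (auto simp: add_pos_pos)
        then show ?thesis unfolding Diff_iff of_real_eq_iff singleton_iff by blast
      qed
      have "(\<lambda>n. c + 1 + 1 / real (Suc n)) \<longlonglongrightarrow> c + 1" by real_asymp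
      then show "(\<lambda>n. complex_of_real (c + 1 + 1 / Suc n)) \<longlonglongrightarrow> of_real (c + 1)"
        by (intro tendsto_of_real)
    qed
  qed (use eq z in auto)
  then show ?thesis by simp
qed

text \<open>
  The transforms agree on the half-plane by the identity theorem, hence so do their boundary values
  on the imaginary axis, which are the characteristic functions.
\<close>

theorem laplace_unique:
  assumes D: "nonneg_distribution D" and E: "nonneg_distribution E"
    and eq: "\<And>u. 0 < u \<Longrightarrow> (LINT x|D. exp (- u * x)) = (LINT x|E. exp (- u * x))"
  shows "D = E"
proof -
  interpret D: nonneg_distribution D by fact
  interpret E: nonneg_distribution E by fact
  have eqz: "D.laplace z = E.laplace z" if "0 < Re z" for z
    by (rule laplace_eq_on_halfplane[OF D.laplace_holomorphic E.laplace_holomorphic _ that])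
       (use eq in \<open>simp add: D.laplace_of_real E.laplace_of_real\<close>)
  have "char D t = char E t" for t
  proof (rule LIMSEQ_unique[OF D.char_eq_lim_laplace])
    show "(\<lambda>n. D.laplace (of_real (1 / Suc n) - \<i> * of_real t)) \<longlonglongrightarrow> char E t"
      using E.char_eq_lim_laplace[of t] by (subst eqz) auto
  qed
  then show ?thesis
    by (intro Levy_uniqueness D.real_distribution_axioms E.real_distribution_axioms) auto
qed

lemma cesaro_mean_zero:
  fixes a :: "nat \<Rightarrow> complex"
  assumes a: "a \<longlonglongrightarrow> 0"
  shows "(\<lambda>N. (\<Sum>n<N. a n) / of_nat N) \<longlonglongrightarrow> 0"
proof (rule LIMSEQ_I)
  fix e :: real assume e: "e > 0"
  obtain n0 where n0: "\<And>n. n \<ge> n0 \<Longrightarrow> norm (a n) < e / 2"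
    using LIMSEQ_D[OF a, of "e / 2"] e by auto
  define S where "S = (\<Sum>n<n0. norm (a n))"
  have S: "S \<ge> 0" unfolding S_def by (intro sum_nonneg) auto
  obtain m :: nat where m: "2 * S / e < real m" using reals_Archimedean2 by blast
  have "norm ((\<Sum>n<N. a n) / of_nat N - 0) < e" if N: "N \<ge> Suc (max n0 m)" for N
  proof -
    have un: "{..<N} = {..<n0} \<union> {n0..<N}" using N by auto
    have "norm (\<Sum>n<N. a n) \<le> (\<Sum>n<N. norm (a n))" by (rule norm_sum)
    also have "(\<Sum>n<N. norm (a n)) = S + (\<Sum>n=n0..<N. norm (a n))"
      unfolding S_def un by (rule sum.union_disjoint) auto
    also have "(\<Sum>n=n0..<N. norm (a n)) \<le> (\<Sum>n=n0..<N. e / 2)"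
      using n0 by (intro sum_mono) (auto intro: less_imp_le)
    also have "\<dots> \<le> real N * (e / 2)" using e by (simp add: mult_right_mono)
    also have "S < real N * (e / 2)"
    proof -
      have "2 * S / e < real N" using m N by simp
      then show ?thesis using e by (simp add: field_simps)
    qed
    finally have "norm (\<Sum>n<N. a n) < real N * e" by (simp add: mult.commute)
    then show ?thesis using N by (simp add: norm_divide divide_less_eq mult.commute)
  qed
  then show "\<exists>no. \<forall>n\<ge>no. norm ((\<Sum>n<n. a n) / of_nat n - 0) < e" by blast
qed

lemma mean_power_tendsto:
  fixes w :: complex
  assumes w: "norm w = 1"
  shows "(\<lambda>N. (\<Sum>n<N. w ^ n) / of_nat N) \<longlonglongrightarrow> (if w = 1 then 1 else 0)"
proof (cases "w = 1")
  case True
  have "eventually (\<lambda>N. (\<Sum>n<N. w ^ n) / of_nat N = 1) sequentially"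
    using eventually_gt_at_top[of "0::nat"] by eventually_elim (simp add: True)
  then show ?thesis using True by (simp add: tendsto_eventually)
next
  case False
  have "(\<lambda>N. (\<Sum>n<N. w ^ n) / of_nat N) \<longlonglongrightarrow> 0"
  proof (rule Lim_null_comparison)
    show "eventually (\<lambda>N. norm ((\<Sum>n<N. w ^ n) / of_nat N) \<le> 2 / norm (1 - w) * (1 / real N)) sequentially"
    proof (intro always_eventually allI)
      fix N
      have "norm (\<Sum>n<N. w ^ n) = norm (1 - w ^ N) / norm (1 - w)"
        using False by (simp add: sum_gp_strict norm_divide)
      also have "\<dots> \<le> 2 / norm (1 - w)"
        using norm_triangle_ineq4[of 1 "w ^ N"] w by (intro divide_right_mono) (auto simp: norm_power)
      finally have "norm (\<Sum>n<N. w ^ n) / real N \<le> 2 / norm (1 - w) / real N"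
        by (rule divide_right_mono) simp
      then show "norm ((\<Sum>n<N. w ^ n) / of_nat N) \<le> 2 / norm (1 - w) * (1 / real N)"
        by (simp add: norm_divide)
    qed
    have "(\<lambda>N. 2 / norm (1 - w) * (1 / real N)) \<longlonglongrightarrow> 2 / norm (1 - w) * 0"
      by (intro tendsto_intros)
    then show "(\<lambda>N. 2 / norm (1 - w) * (1 / real N)) \<longlonglongrightarrow> 0" by simp
  qed
  then show ?thesis using False by simp
qed

text \<open>
  This is the mean formula for the atoms of a finite measure, applied to the measure with density
  \<open>exp (- c * x)\<close> relative to the distribution: the averages of \<open>exp (\<i> * n * (x0 - x))\<close> over \<open>n < N\<close>
  converge to the indicator of \<open>x - x0 \<in> 2 \<pi> \<int>\<close>, while the averages of their integrals converge to 0.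
\<close>

theorem (in nonneg_distribution) no_atoms_if_laplace_vanishes:
  assumes c: "0 < c" and lim: "(\<lambda>n. laplace (of_real c + \<i> * of_nat n)) \<longlonglongrightarrow> 0"
  shows "measure M {x0} = 0"
proof -
  define a where "a n = exp (\<i> * of_real x0) ^ n * laplace (of_real c + \<i> * of_nat n)" for n :: nat
  have "a \<longlonglongrightarrow> 0"
    by (rule tendsto_norm_zero_cancel) (use tendsto_norm_zero[OF lim] in \<open>simp add: a_def norm_mult norm_power\<close>)
  then have mean0: "(\<lambda>N. (\<Sum>n<N. a n) / of_nat N) \<longlonglongrightarrow> 0" by (rule cesaro_mean_zero)
  define w where "w x = exp (\<i> * of_real (x0 - x))" for x
  have w1: "norm (w x) = 1" for x unfolding w_def by simp
  have [measurable]: "w \<in> borel_measurable borel" unfolding w_def by measurable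
  define g where "g x = exp (- c * x) * (if w x = 1 then 1 else 0 :: real)" for x
  have [measurable]: "g \<in> borel_measurable borel" unfolding g_def by measurable
  have a_eq: "a n = (CLINT x|M. of_real (exp (- c * x)) * w x ^ n)" for n
  proof -
    have "a n = (CLINT x|M. exp (\<i> * of_real x0) ^ n * exp (- (of_real c + \<i> * of_nat n) * of_real x))"
      unfolding a_def laplace_def by simp
    also have "\<dots> = (CLINT x|M. of_real (exp (- c * x)) * w x ^ n)"
      by (intro Bochner_Integration.integral_cong refl)
         (simp add: w_def algebra_simps flip: exp_add exp_of_nat_mult exp_of_real)
    finally show ?thesis .
  qed
  have int: "integrable M (\<lambda>x. of_real (exp (- c * x)) * w x ^ n)" for n
    using AE_nonneg c
    by (intro integrable_const_bound[where B=1]) (auto elim!: eventually_mono simp: norm_mult norm_power w1)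
  have "(\<lambda>N. CLINT x|M. of_real (exp (- c * x)) * ((\<Sum>n<N. w x ^ n) / of_nat N)) \<longlonglongrightarrow> (CLINT x|M. of_real (g x))"
  proof (rule integral_dominated_convergence[where w="\<lambda>_. 1"])
    show "AE x in M. (\<lambda>N. of_real (exp (- c * x)) * ((\<Sum>n<N. w x ^ n) / of_nat N)) \<longlonglongrightarrow> complex_of_real (g x)"
    proof (intro AE_I2)
      fix x
      have "(\<lambda>N. of_real (exp (- c * x)) * ((\<Sum>n<N. w x ^ n) / of_nat N)) \<longlonglongrightarrow>
          of_real (exp (- c * x)) * (if w x = 1 then 1 else 0)"
        by (intro tendsto_mult tendsto_const mean_power_tendsto w1)
      then show "(\<lambda>N. of_real (exp (- c * x)) * ((\<Sum>n<N. w x ^ n) / of_nat N)) \<longlonglongrightarrow> complex_of_real (g x)"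
        by (simp add: g_def split: if_splits)
    qed
    show "AE x in M. norm (of_real (exp (- c * x)) * ((\<Sum>n<N. w x ^ n) / of_nat N)) \<le> 1" for N
      using AE_nonneg
    proof eventually_elim
      case (elim x)
      have "norm (\<Sum>n<N. w x ^ n) \<le> (\<Sum>n<N. norm (w x ^ n))" by (rule norm_sum)
      then have "norm (\<Sum>n<N. w x ^ n) \<le> real N" by (simp add: norm_power w1)
      then have 1: "norm ((\<Sum>n<N. w x ^ n) / of_nat N) \<le> 1" by (simp add: norm_divide divide_le_eq)
      have "norm (complex_of_real (exp (- c * x))) \<le> 1" using c elim by simp
      then show ?case unfolding norm_mult using 1 by (intro mult_le_one) auto
    qed
  qed (auto simp: g_def)
  moreover have "(CLINT x|M. of_real (exp (- c * x)) * ((\<Sum>n<N. w x ^ n) / of_nat N)) = (\<Sum>n<N. a n) / of_nat N" for N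
  proof -
    have "(CLINT x|M. of_real (exp (- c * x)) * ((\<Sum>n<N. w x ^ n) / of_nat N)) =
        (CLINT x|M. (\<Sum>n<N. of_real (exp (- c * x)) * w x ^ n) / of_nat N)"
      by (simp only: sum_distrib_left times_divide_eq_right)
    also have "\<dots> = (\<Sum>n<N. a n) / of_nat N"
      unfolding a_eq using int by (simp only: integral_divide_zero Bochner_Integration.integral_sum)
    finally show ?thesis .
  qed
  ultimately have "(\<lambda>N. (\<Sum>n<N. a n) / of_nat N) \<longlonglongrightarrow> (CLINT x|M. of_real (g x))" by (simp only:)
  then have "(CLINT x|M. complex_of_real (g x)) = 0" using mean0 LIMSEQ_unique by blast
  then have "(LINT x|M. g x) = 0" by (simp add: integral_complex_of_real)
  moreover have "integrable M g"
    using AE_nonneg c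
    by (intro integrable_const_bound[where B=1]) (auto elim!: eventually_mono simp: g_def)
  ultimately have "AE x in M. g x = 0"
    by (subst (asm) integral_nonneg_eq_0_iff_AE) (auto simp: g_def)
  then have "AE x in M. x \<notin> {x0}"
    by eventually_elim (auto simp: g_def w_def)
  then show ?thesis
    by (subst (asm) AE_iff_measurable[of "{x0}"]) (auto simp: emeasure_eq_measure)
qed


section \<open>The limit law\<close>

lemma (in real_distribution) nonneg_distributionI:
  assumes "AE x in M. 0 \<le> x"
  shows "nonneg_distribution M"
proof
  have "AE x in M. x \<notin> {..<0}" using assms by eventually_elim auto
  then show "measure M {..<0} = 0"
    by (subst (asm) AE_iff_measurable[of "{..<0}"]) (auto simp: emeasure_eq_measure)
qed

text \<open>
  The function \<open>exp (- u * x)\<close> is bounded only on the half-line, so it is replaced by a bounded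
  continuous one that agrees with it there. The test function \<open>h\<close> detects negative values.
\<close>

lemma nonneg_distribution_weak_limit:
  assumes \<mu>: "\<And>n. nonneg_distribution (\<mu> n)" and D: "real_distribution D" and conv: "weak_conv_m \<mu> D"
  shows "nonneg_distribution D"
    and "0 < u \<Longrightarrow> (\<lambda>n. LINT x|\<mu> n. exp (- u * x)) \<longlonglongrightarrow> (LINT x|D. exp (- u * x))"
proof -
  interpret \<mu>: nonneg_distribution "\<mu> n" for n by fact
  interpret D: real_distribution D by fact
  note lim = weak_conv_imp_integral_bdd_continuous_conv[OF \<mu>.real_distribution_axioms D conv]
  define h :: "real \<Rightarrow> real" where "h x = min 1 (max 0 (- x))" for x
  have "(\<lambda>n. LINT x|\<mu> n. h x) \<longlonglongrightarrow> (LINT x|D. h x)"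
  proof (rule lim[where B=1])
    show "isCont h x" for x unfolding h_def by (intro continuous_intros)
  qed (auto simp: h_def)
  moreover have "(LINT x|\<mu> n. h x) = 0" for n
    using \<mu>.AE_nonneg[of n] by (intro integral_eq_zero_AE) (auto elim!: eventually_mono simp: h_def)
  ultimately have "(LINT x|D. h x) = 0" by (simp add: LIMSEQ_const_iff)
  moreover have [measurable]: "h \<in> borel_measurable borel" unfolding h_def by measurable
  moreover have "integrable D h"
    by (intro D.integrable_const_bound[where B=1]) (auto simp: h_def)
  ultimately have "AE x in D. h x = 0"
    by (subst (asm) integral_nonneg_eq_0_iff_AE) (auto simp: h_def)
  then have "AE x in D. 0 \<le> x" by eventually_elim (auto simp: h_def min_def max_def split: if_splits)
  then show nD: "nonneg_distribution D" by (rule D.nonneg_distributionI)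
  interpret D: nonneg_distribution D by fact
  assume u: "0 < u"
  define k where "k x = exp (- u * max 0 x)" for x
  have [measurable]: "k \<in> borel_measurable borel" unfolding k_def by measurable
  have "(\<lambda>n. LINT x|\<mu> n. k x) \<longlonglongrightarrow> (LINT x|D. k x)"
  proof (rule lim[where B=1])
    show "isCont k x" for x unfolding k_def by (intro continuous_intros)
  qed (use u in \<open>auto simp: k_def\<close>)
  moreover have "(LINT x|\<mu> n. k x) = (LINT x|\<mu> n. exp (- u * x))" for n
    using \<mu>.AE_nonneg[of n] by (intro integral_cong_AE) (auto elim!: eventually_mono simp: k_def max_def)
  moreover have "(LINT x|D. k x) = (LINT x|D. exp (- u * x))"
    using D.AE_nonneg by (intro integral_cong_AE) (auto elim!: eventually_mono simp: k_def max_def)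
  ultimately show "(\<lambda>n. LINT x|\<mu> n. exp (- u * x)) \<longlonglongrightarrow> (LINT x|D. exp (- u * x))" by simp
qed

text \<open>
  Beyond \<open>ln 2 / u\<close> the integrand \<open>1 - exp (- u * x)\<close> is at least \<open>1 / 2\<close>.
\<close>

lemma (in nonneg_distribution) tail_le_laplace:
  assumes "0 < u"
  shows "1 - cdf M (ln 2 / u) \<le> 2 * (1 - (LINT x|M. exp (- u * x)))"
proof -
  let ?K = "ln 2 / u"
  have int: "integrable M (\<lambda>x. exp (- u * x))"
    using AE_nonneg assms by (intro integrable_const_bound[where B=1]) (auto elim!: eventually_mono)
  have "1 - cdf M ?K = prob {?K<..}"
    using prob_compl[of "{..?K}"] by (simp add: cdf_def Compl_eq_Diff_UNIV[symmetric] Compl_atMost)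
  also have "\<dots> = (LINT x|M. indicator {?K<..} x)" by simp
  also have "\<dots> \<le> (LINT x|M. 2 * (1 - exp (- u * x)))"
  proof (rule integral_mono_AE)
    show "AE x in M. indicator {?K<..} x \<le> 2 * (1 - exp (- u * x))"
      using AE_nonneg
    proof eventually_elim
      case (elim x)
      have "exp (- u * x) \<le> 1 / 2" if "?K < x"
      proof -
        have "ln 2 < u * x" using that assms by (simp add: field_simps)
        then have "exp (ln 2) < exp (u * x)" by (simp only: exp_less_cancel_iff)
        then have "2 < exp (u * x)" by simp
        then show ?thesis by (simp add: exp_minus field_simps)
      qed
      then show ?case using elim assms by (auto simp: indicator_def)
    qed
  qed (use int in \<open>auto simp: integrable_indicator_iff emeasure_eq_measure\<close>)
  also have "\<dots> = 2 * (1 - (LINT x|M. exp (- u * x)))"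
    using int prob_space by simp
  finally show ?thesis .
qed

lemma tight_of_laplace:
  assumes \<mu>: "\<And>n. nonneg_distribution (\<mu> n)"
    and lim: "\<And>u. 0 < u \<Longrightarrow> (\<lambda>n. LINT x|\<mu> n. exp (- u * x)) \<longlonglongrightarrow> \<psi> u"
    and \<psi>: "(\<psi> \<longlongrightarrow> 1) (at_right 0)"
  shows "tight \<mu>"
  unfolding tight_def
proof safe
  interpret \<mu>: nonneg_distribution "\<mu> n" for n by fact
  show "real_distribution (\<mu> n)" for n by (rule \<mu>.real_distribution_axioms)
  fix \<epsilon> :: real assume \<epsilon>: "0 < \<epsilon>"
  have "eventually (\<lambda>u. 1 - \<epsilon> / 2 < \<psi> u) (at_right 0)"
    using \<epsilon> by (intro order_tendstoD(1)[OF \<psi>]) auto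
  moreover have "eventually (\<lambda>u. u \<in> {0<..<1}) (at_right (0::real))" by (rule eventually_at_right_real) simp
  ultimately have "eventually (\<lambda>u. 1 - \<epsilon> / 2 < \<psi> u \<and> u \<in> {0<..<1}) (at_right 0)" by (rule eventually_conj)
  then obtain u where u: "1 - \<epsilon> / 2 < \<psi> u" "0 < u"
    using eventually_happens'[OF trivial_limit_at_right_real] by auto
  have "eventually (\<lambda>n. 1 - \<epsilon> / 2 < (LINT x|\<mu> n. exp (- u * x))) sequentially"
    by (rule order_tendstoD(1)[OF lim[OF u(2)] u(1)])
  then obtain N where N: "\<And>n. n \<ge> N \<Longrightarrow> 1 - \<epsilon> / 2 < (LINT x|\<mu> n. exp (- u * x))"
    unfolding eventually_sequentially by blast
  have "\<exists>b. 1 - \<epsilon> < cdf (\<mu> n) b" for n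
  proof -
    have "eventually (\<lambda>b. 1 - \<epsilon> < cdf (\<mu> n) b) at_top"
      using \<epsilon> by (intro order_tendstoD(1)[OF \<mu>.cdf_lim_at_top_prob]) auto
    then show ?thesis using eventually_happens'[OF trivial_limit_at_top_linorder] by blast
  qed
  then obtain K where K: "\<And>n. 1 - \<epsilon> < cdf (\<mu> n) (K n)" by metis
  define b where "b = Max (insert (ln 2 / u) (K ` {..<N}))"
  have b: "ln 2 / u \<le> b" "\<And>n. n < N \<Longrightarrow> K n \<le> b" unfolding b_def by (auto intro!: Max_ge)
  have b0: "0 < b" using b(1) u by (smt (verit) divide_pos_pos ln_gt_zero)
  have cdf_b: "1 - \<epsilon> < cdf (\<mu> n) b" for n
  proof (cases "n < N")
    case True
    then show ?thesis using K[of n] \<mu>.cdf_nondecreasing[OF b(2)[OF True], of n] by simp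
  next
    case False
    then have "1 - cdf (\<mu> n) (ln 2 / u) < \<epsilon>" using N[of n] \<mu>.tail_le_laplace[OF u(2), of n] by simp
    then show ?thesis using \<mu>.cdf_nondecreasing[OF b(1), of n] by simp
  qed
  have "1 - \<epsilon> < measure (\<mu> n) {-1<..b}" for n
  proof -
    have "measure (\<mu> n) {..-1} \<le> measure (\<mu> n) {..<0}" by (intro \<mu>.finite_measure_mono) auto
    then have "cdf (\<mu> n) (-1) = 0" using \<mu>.measure_neg[of n] by (simp add: cdf_def measure_le_0_iff)
    then show ?thesis using \<mu>.cdf_diff_eq[of "-1" b n] b0 cdf_b[of n] by simp
  qed
  then show "\<exists>a b. a < b \<and> (\<forall>n. 1 - \<epsilon> < measure (\<mu> n) {a<..b})"
    using b0 by (intro exI[of _ "-1"] exI[of _ b]) auto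
qed

text \<open>
  Continuity of the limit transform at 0 gives tightness. By uniqueness of the transform all
  subsequential limits agree, which yields both the existence of the limit law and convergence of the
  whole sequence.
\<close>

theorem laplace_continuity:
  assumes \<mu>: "\<And>n. nonneg_distribution (\<mu> n)"
    and lim: "\<And>u. 0 < u \<Longrightarrow> (\<lambda>n. LINT x|\<mu> n. exp (- u * x)) \<longlonglongrightarrow> \<psi> u"
    and \<psi>: "(\<psi> \<longlongrightarrow> 1) (at_right 0)"
  shows "\<exists>D. nonneg_distribution D \<and> (\<forall>u>0. (LINT x|D. exp (- u * x)) = \<psi> u) \<and> weak_conv_m \<mu> D"
proof -
  interpret \<mu>: nonneg_distribution "\<mu> n" for n by fact
  have tight: "tight \<mu>" by (rule tight_of_laplace[OF assms])
  have sub: "nonneg_distribution D \<and> (\<forall>u>0. (LINT x|D. exp (- u * x)) = \<psi> u)"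
    if "strict_mono s" "real_distribution D" "weak_conv_m (\<mu> \<circ> s) D" for s D
  proof -
    have \<mu>s: "nonneg_distribution ((\<mu> \<circ> s) n)" for n using \<mu> by simp
    have "(LINT x|D. exp (- u * x)) = \<psi> u" if u: "0 < u" for u
    proof (rule LIMSEQ_unique)
      show "(\<lambda>n. LINT x|(\<mu> \<circ> s) n. exp (- u * x)) \<longlonglongrightarrow> (LINT x|D. exp (- u * x))"
        by (rule nonneg_distribution_weak_limit(2)[OF \<mu>s \<open>real_distribution D\<close> \<open>weak_conv_m (\<mu> \<circ> s) D\<close> u])
      show "(\<lambda>n. LINT x|(\<mu> \<circ> s) n. exp (- u * x)) \<longlonglongrightarrow> \<psi> u"
        using LIMSEQ_subseq_LIMSEQ[OF lim[OF u] \<open>strict_mono s\<close>] by (simp add: o_def)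
    qed
    then show ?thesis
      using nonneg_distribution_weak_limit(1)[OF \<mu>s \<open>real_distribution D\<close> \<open>weak_conv_m (\<mu> \<circ> s) D\<close>] by blast
  qed
  obtain s D where s: "strict_mono s" and D: "real_distribution D" "weak_conv_m (\<mu> \<circ> id \<circ> s) D"
    using tight_imp_convergent_subsubsequence[OF tight strict_mono_id] by blast
  then have D': "nonneg_distribution D" "\<And>u. 0 < u \<Longrightarrow> (LINT x|D. exp (- u * x)) = \<psi> u"
    using sub[OF s D(1)] by auto
  have "weak_conv_m \<mu> D"
  proof (rule tight_subseq_weak_converge[OF \<mu>.real_distribution_axioms D(1) tight])
    fix s' \<nu> assume *: "strict_mono s'" "real_distribution \<nu>" "weak_conv_m (\<mu> \<circ> s') \<nu>"
    then have "nonneg_distribution \<nu>" "\<And>u. 0 < u \<Longrightarrow> (LINT x|\<nu>. exp (- u * x)) = \<psi> u"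
      using sub by auto
    then have "\<nu> = D" using D' by (intro laplace_unique) auto
    then show "weak_conv_m (\<mu> \<circ> s') D" using * by simp
  qed
  then show ?thesis using D' by blast
qed

lemma D_law_iff:
  "D_law \<alpha> \<gamma> D \<longleftrightarrow> nonneg_distribution D \<and>
    (\<forall>u>0. (LINT x|D. exp (- u * x)) = 1 - u powr \<alpha> / (1 + u powr \<gamma>) powr (\<alpha> / \<gamma>))"
  by (auto simp: D_law_def nonneg_distribution_def nonneg_distribution_axioms_def)

lemma D_law_unique: "D_law \<alpha> \<gamma> D \<Longrightarrow> D_law \<alpha> \<gamma> E \<Longrightarrow> D = E"
  unfolding D_law_iff by (intro laplace_unique) auto

lemma D_transform_eq:
  fixes u :: real
  assumes "0 < u" "\<gamma> \<noteq> 0"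
  shows "u powr \<alpha> / (1 + u powr \<gamma>) powr (\<alpha> / \<gamma>) = (1 + u powr (- \<gamma>)) powr (- (\<alpha> / \<gamma>))"
proof -
  have "1 + u powr (- \<gamma>) = (1 + u powr \<gamma>) / u powr \<gamma>"
    using assms by (simp add: powr_minus field_simps)
  then have "(1 + u powr (- \<gamma>)) powr (- (\<alpha> / \<gamma>)) = (1 + u powr \<gamma>) powr (- (\<alpha> / \<gamma>)) / (u powr \<gamma>) powr (- (\<alpha> / \<gamma>))"
    by (simp add: powr_divide add_nonneg_nonneg)
  also have "(u powr \<gamma>) powr (- (\<alpha> / \<gamma>)) = u powr (- \<alpha>)" using assms by (simp add: powr_powr)
  finally show ?thesis by (simp add: powr_minus field_simps)
qed

text \<open>
  By analytic continuation the transform of \<open>D\<close> is \<open>1 - (1 + z powr (- \<gamma>)) powr (- \<alpha> / \<gamma>)\<close> in a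
  half-plane, and this tends to 0 as \<open>\<bar>z\<bar>\<close> tends to infinity. The half-plane \<open>Re z > 1\<close> is chosen
  because there \<open>\<bar>z powr (- \<gamma>)\<bar> < 1\<close> keeps the outer power away from its branch cut.
\<close>

theorem D_law_no_atoms:
  assumes D: "D_law \<alpha> \<gamma> D" and \<gamma>: "0 < \<gamma>"
  shows "measure D {x0} = 0"
proof -
  interpret nonneg_distribution D using D by (simp add: D_law_iff)
  define \<beta> where "\<beta> = \<alpha> / \<gamma>"
  define \<Psi> where "\<Psi> z = 1 - exp (- of_real \<beta> * Ln (1 + exp (- of_real \<gamma> * Ln z)))" for z :: complex
  have norm_pow: "norm (exp (- of_real \<gamma> * Ln z)) = norm z powr (- \<gamma>)" if "z \<noteq> 0" for z :: complex
    using that by (simp add: norm_exp_eq_Re powr_def)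
  have Re_pos: "0 < Re (1 + exp (- of_real \<gamma> * Ln z))" if z: "1 < Re z" for z :: complex
  proof -
    have "1 < norm z" using z complex_Re_le_cmod[of z] by linarith
    then have "norm z powr (- \<gamma>) < 1" using \<gamma> powr_less_mono[of "- \<gamma>" 0 "norm z"] by (auto split: if_splits)
    moreover have "z \<noteq> 0" using z by auto
    ultimately have "norm (exp (- of_real \<gamma> * Ln z)) < 1" using norm_pow by simp
    then have "\<bar>Re (exp (- of_real \<gamma> * Ln z))\<bar> < 1" using abs_Re_le_cmod le_less_trans by blast
    then show ?thesis by simp
  qed
  have eq: "laplace z = \<Psi> z" if "1 < Re z" for z
  proof (rule laplace_eq_on_halfplane[OF _ _ _ that])
    show "laplace holomorphic_on {z. 1 < Re z}"
      by (rule holomorphic_on_subset[OF laplace_holomorphic]) auto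
    show "\<Psi> holomorphic_on {z. 1 < Re z}"
    proof -
      have "z \<notin> \<real>\<^sub>\<le>\<^sub>0" "1 + exp (- of_real \<gamma> * Ln z) \<notin> \<real>\<^sub>\<le>\<^sub>0" if "1 < Re z" for z
        using Re_pos[of z] that unfolding complex_nonpos_Reals_iff by auto
      then show ?thesis
        unfolding \<Psi>_def by (intro holomorphic_intros) auto
    qed
    fix u :: real assume u: "1 < u"
    have "laplace (of_real u) = of_real (1 - (1 + u powr (- \<gamma>)) powr (- \<beta>))"
      using D u \<gamma> D_transform_eq[of u \<gamma> \<alpha>] by (subst laplace_of_real) (auto simp: D_law_iff \<beta>_def)
    also have "\<dots> = \<Psi> (of_real u)"
    proof -
      have "exp (- of_real \<gamma> * Ln (of_real u)) = complex_of_real (u powr (- \<gamma>))"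
        using u by (simp add: Ln_of_real powr_def flip: exp_of_real)
      moreover have "exp (- of_real \<beta> * Ln (1 + complex_of_real (u powr (- \<gamma>)))) = of_real ((1 + u powr (- \<gamma>)) powr (- \<beta>))"
      proof -
        have "0 < 1 + u powr (- \<gamma>)" by (simp add: add_pos_nonneg)
        then have "Ln (of_real (1 + u powr (- \<gamma>))) = of_real (ln (1 + u powr (- \<gamma>)))" by (rule Ln_of_real)
        then show ?thesis using \<open>0 < 1 + u powr (- \<gamma>)\<close> by (simp add: powr_def exp_of_real[symmetric])
      qed
      ultimately show ?thesis by (simp add: \<Psi>_def)
    qed
    finally show "laplace (of_real u) = \<Psi> (of_real u)" .
  qed
  \<comment> \<open>any vertical line to the right of 1 would do\<close>
  define z where "z n = of_real 3 + \<i> * of_nat n" for n :: nat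
  have "(\<lambda>n. \<Psi> (z n)) \<longlonglongrightarrow> 1 - exp (- of_real \<beta> * Ln (1 + 0))"
    unfolding \<Psi>_def
  proof (intro tendsto_intros)
    show "(\<lambda>n. exp (- of_real \<gamma> * Ln (z n))) \<longlonglongrightarrow> 0"
    proof (rule tendsto_norm_zero_cancel)
      have nz: "z n \<noteq> 0" for n by (auto simp: z_def complex_eq_iff)
      have "filterlim (\<lambda>n. norm (z n)) at_top sequentially"
      proof (rule filterlim_at_top_mono[OF filterlim_real_sequentially], intro always_eventually allI)
        show "real n \<le> norm (z n)" for n using abs_Im_le_cmod[of "z n"] by (simp add: z_def)
      qed
      then have "(\<lambda>n. norm (z n) powr (- \<gamma>)) \<longlonglongrightarrow> 0"
        using \<gamma> by (intro tendsto_neg_powr) auto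
      then show "(\<lambda>n. norm (exp (- of_real \<gamma> * Ln (z n)))) \<longlonglongrightarrow> 0"
        using norm_pow[OF nz] by simp
    qed
  qed auto
  then have "(\<lambda>n. \<Psi> (z n)) \<longlonglongrightarrow> 0" by simp
  then have "(\<lambda>n. laplace (z n)) \<longlonglongrightarrow> 0" by (subst eq) (auto simp: z_def)
  then show ?thesis unfolding z_def by (intro no_atoms_if_laplace_vanishes[of 3]) auto
qed

text \<open>
  The absence of atoms makes every point a continuity point of the limit distribution function.
\<close>

theorem D_law_limit:
  fixes \<mu> :: "nat \<Rightarrow> real measure"
  assumes \<mu>: "\<And>n. nonneg_distribution (\<mu> n)" and \<gamma>: "0 < \<gamma>" and \<alpha>: "0 < \<alpha>"
    and lim: "\<And>u. 0 < u \<Longrightarrow> (\<lambda>n. LINT x|\<mu> n. exp (- u * x)) \<longlonglongrightarrow> 1 - u powr \<alpha> / (1 + u powr \<gamma>) powr (\<alpha> / \<gamma>)"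
  shows "\<exists>D. D_law \<alpha> \<gamma> D" and "D_law \<alpha> \<gamma> D \<Longrightarrow> (\<lambda>n. cdf (\<mu> n) x) \<longlonglongrightarrow> cdf D x"
proof -
  have "((\<lambda>u. 1 - u powr \<alpha> / (1 + u powr \<gamma>) powr (\<alpha> / \<gamma>)) \<longlongrightarrow> 1 - 0 / (1 + 0) powr (\<alpha> / \<gamma>)) (at_right 0)"
    using \<alpha> \<gamma>
    by (intro tendsto_diff tendsto_divide tendsto_powr tendsto_add tendsto_const)
       (auto intro!: tendsto_eq_intros intro: eventually_mono[OF eventually_at_right_less[of "0::real"]])
  then have "((\<lambda>u. 1 - u powr \<alpha> / (1 + u powr \<gamma>) powr (\<alpha> / \<gamma>)) \<longlongrightarrow> 1) (at_right 0)" by simp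
  from laplace_continuity[OF \<mu> lim this] obtain D0 where
    D0: "D_law \<alpha> \<gamma> D0" "weak_conv_m \<mu> D0" unfolding D_law_iff by blast
  then show "\<exists>D. D_law \<alpha> \<gamma> D" by blast
  assume D: "D_law \<alpha> \<gamma> D"
  then have "D = D0" using D0 D_law_unique by blast
  interpret D: real_distribution D using D by (simp add: D_law_def)
  have "isCont (cdf D) x" using D_law_no_atoms[OF D \<gamma>] by (simp add: D.isCont_cdf)
  then show "(\<lambda>n. cdf (\<mu> n) x) \<longlonglongrightarrow> cdf D x"
    using D0(2) \<open>D = D0\<close> by (simp add: weak_conv_m_def weak_conv_def)
qed


section \<open>Product functionals of a Poisson process\<close>

context nonhomogeneous_poisson_process
begin

text \<open>
  The intensity may take any value at the origin; changing it there makes it nonnegative without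
  affecting integrals.
\<close>

definition r0 :: "real \<Rightarrow> real" where "r0 u = (if u \<le> 0 then 0 else r u)"

lemma integral_r0: "0 \<le> a \<Longrightarrow> integral {a..b} (\<lambda>u. r u * g u) = integral {a..b} (\<lambda>u. r0 u * g u)"
  by (rule integral_spike[of "{0}"]) (auto simp: r0_def)

sublocale rate: intensity r0
proof
  show "0 \<le> r0 t" for t using intensity_nonneg[of t] by (auto simp: r0_def)
  show "r0 integrable_on {0..t}" if "t \<ge> 0" for t
    by (rule integrable_spike[OF intensity_integrable[OF that], of "{0}"]) (auto simp: r0_def)
qed

lemma mean_measure_eq: "mean_measure r t = rate.R t"
  using integral_r0[of 0 t "\<lambda>_. 1"] by (simp add: mean_measure_def rate.R_def)

lemma expectation_power_increment:
  assumes "0 \<le> s" "s \<le> t" and c: "0 \<le> c" "c \<le> 1"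
  shows "expectation (\<lambda>\<omega>. c ^ (\<nu> t \<omega> - \<nu> s \<omega>)) = exp (- ((1 - c) * (rate.R t - rate.R s)))"
proof -
  define N where "N \<omega> = \<nu> t \<omega> - \<nu> s \<omega>" for \<omega>
  define \<Lambda> where "\<Lambda> = rate.R t - rate.R s"
  have [measurable]: "\<nu> t \<in> M \<rightarrow>\<^sub>M count_space UNIV" "\<nu> s \<in> M \<rightarrow>\<^sub>M count_space UNIV"
    using assms by (auto intro: measurable_count)
  have [measurable]: "N \<in> M \<rightarrow>\<^sub>M count_space UNIV" unfolding N_def by measurable
  have prob_N: "prob {\<omega> \<in> space M. N \<omega> = n} = \<Lambda> ^ n / fact n * exp (- \<Lambda>)" for n
    using poisson_increment[OF assms(1,2), of n] by (simp add: N_def \<Lambda>_def mean_measure_eq)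
  have "(\<integral>\<^sup>+\<omega>. ennreal (c ^ N \<omega>) \<partial>M) = (\<integral>\<^sup>+\<omega>. (\<Sum>n. ennreal (c ^ n) * indicator {\<omega> \<in> space M. N \<omega> = n} \<omega>) \<partial>M)"
  proof (intro nn_integral_cong)
    fix \<omega> assume \<omega>: "\<omega> \<in> space M"
    have "(\<Sum>n. ennreal (c ^ n) * indicator {\<omega> \<in> space M. N \<omega> = n} \<omega>) =
        (\<Sum>n\<in>{N \<omega>}. ennreal (c ^ n) * indicator {\<omega> \<in> space M. N \<omega> = n} \<omega>)"
      by (rule suminf_finite) auto
    then show "ennreal (c ^ N \<omega>) = (\<Sum>n. ennreal (c ^ n) * indicator {\<omega> \<in> space M. N \<omega> = n} \<omega>)"
      using \<omega> by simp
  qed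
  also have "\<dots> = (\<Sum>n. \<integral>\<^sup>+\<omega>. ennreal (c ^ n) * indicator {\<omega> \<in> space M. N \<omega> = n} \<omega> \<partial>M)"
    by (rule nn_integral_suminf) measurable
  also have "\<dots> = (\<Sum>n. ennreal (c ^ n * prob {\<omega> \<in> space M. N \<omega> = n}))"
  proof (intro suminf_cong)
    fix n
    have "(\<integral>\<^sup>+\<omega>. ennreal (c ^ n) * indicator {\<omega> \<in> space M. N \<omega> = n} \<omega> \<partial>M) = ennreal (c ^ n) * emeasure M {\<omega> \<in> space M. N \<omega> = n}"
      by (rule nn_integral_cmult_indicator) measurable
    then show "(\<integral>\<^sup>+\<omega>. ennreal (c ^ n) * indicator {\<omega> \<in> space M. N \<omega> = n} \<omega> \<partial>M) = ennreal (c ^ n * prob {\<omega> \<in> space M. N \<omega> = n})"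
      using c by (simp add: emeasure_eq_measure ennreal_mult'')
  qed
  also have "\<dots> = ennreal (exp (- ((1 - c) * \<Lambda>)))"
  proof (rule suminf_ennreal_eq)
    show "0 \<le> c ^ n * prob {\<omega> \<in> space M. N \<omega> = n}" for n using c by simp
    have "(\<lambda>n. exp (- \<Lambda>) * ((c * \<Lambda>) ^ n /\<^sub>R fact n)) sums (exp (- \<Lambda>) * exp (c * \<Lambda>))"
      by (intro sums_mult exp_converges)
    also have "(\<lambda>n. exp (- \<Lambda>) * ((c * \<Lambda>) ^ n /\<^sub>R fact n)) = (\<lambda>n. c ^ n * prob {\<omega> \<in> space M. N \<omega> = n})"
      unfolding prob_N by (auto simp: power_mult_distrib divide_inverse ac_simps)
    also have "exp (- \<Lambda>) * exp (c * \<Lambda>) = exp (- ((1 - c) * \<Lambda>))"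
      unfolding exp_add[symmetric] by (simp add: algebra_simps)
    finally show "(\<lambda>n. c ^ n * prob {\<omega> \<in> space M. N \<omega> = n}) sums exp (- ((1 - c) * \<Lambda>))" .
  qed
  finally have nn: "(\<integral>\<^sup>+\<omega>. ennreal (c ^ N \<omega>) \<partial>M) = ennreal (exp (- ((1 - c) * \<Lambda>)))" .
  have "expectation (\<lambda>\<omega>. c ^ N \<omega>) = enn2real (\<integral>\<^sup>+\<omega>. ennreal (c ^ N \<omega>) \<partial>M)"
    using c by (intro integral_eq_nn_integral) auto
  then show ?thesis unfolding nn by (simp add: N_def \<Lambda>_def)
qed

text \<open>
  By right-continuity the infimum in the definition of a jump point is attained.
\<close>

lemma jump_point_props:
  assumes \<omega>: "\<omega> \<in> space M" and t: "0 \<le> t" and k: "k < \<nu> t \<omega>"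
  shows "0 < jump_point \<nu> k \<omega>" "jump_point \<nu> k \<omega> \<le> t"
    and "\<And>u. 0 \<le> u \<Longrightarrow> k < \<nu> u \<omega> \<longleftrightarrow> jump_point \<nu> k \<omega> \<le> u"
proof -
  let ?A = "{u. 0 \<le> u \<and> k < \<nu> u \<omega>}" and ?S = "jump_point \<nu> k \<omega>"
  have S: "?S = Inf ?A" by (simp add: jump_point_def)
  have ne: "?A \<noteq> {}" using t k by auto
  have bdd: "bdd_below ?A" by (rule bdd_belowI[of _ 0]) auto
  have mono: "\<nu> u \<omega> \<le> \<nu> v \<omega>" if "0 \<le> u" "u \<le> v" for u v
    using count_mono[OF \<omega>] that by (auto simp: mono_on_def)
  have S0: "0 \<le> ?S" unfolding S using ne by (intro cInf_greatest) auto
  have below: "?S \<le> u" if "0 \<le> u" "k < \<nu> u \<omega>" for u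
    unfolding S using that bdd by (intro cInf_lower) auto
  show "?S \<le> t" by (rule below[OF t k])
  have at_S: "k < \<nu> ?S \<omega>"
  proof -
    have "eventually (\<lambda>u. \<nu> u \<omega> = \<nu> ?S \<omega>) (at_right ?S)" by (rule count_right_continuous[OF \<omega> S0])
    then obtain b where b: "b > ?S" "\<And>u. ?S < u \<Longrightarrow> u < b \<Longrightarrow> \<nu> u \<omega> = \<nu> ?S \<omega>"
      unfolding eventually_at_right_field by blast
    obtain v where v: "v \<in> ?A" "v < b" using b(1) cInf_lessD[OF ne] unfolding S by blast
    then have "?S \<le> v" using below by auto
    then show ?thesis using v b(2)[of v] by (cases "v = ?S") auto
  qed
  show iff: "k < \<nu> u \<omega> \<longleftrightarrow> ?S \<le> u" if "0 \<le> u" for u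
    using below[OF that] at_S mono[OF S0, of u] by auto
  show "0 < ?S" using iff[of 0] count_0[OF \<omega>] S0 by (cases "?S = 0") auto
qed

text \<open>
  Jump points are rounded up to a grid of mesh \<open>t / (n + 1)\<close>. The rounded product factorises over
  the increments of the counting process, so its expectation is the exponential of a Riemann--Stieltjes
  sum. Letting \<open>n\<close> tend to infinity, the products converge pathwise, as there are finitely many jumps
  and \<open>h\<close> is continuous.
\<close>

theorem poisson_functional:
  assumes t: "0 \<le> t" and h: "continuous_on {0..t} h" and h01: "\<And>u. u \<in> {0..t} \<Longrightarrow> 0 \<le> h u \<and> h u \<le> 1"
  shows "expectation (\<lambda>\<omega>. \<Prod>k<\<nu> t \<omega>. h (jump_point \<nu> k \<omega>)) = exp (- integral {0..t} (\<lambda>u. r u * (1 - h u)))"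
proof (cases "t = 0")
  case True
  have "expectation (\<lambda>\<omega>. \<Prod>k<\<nu> t \<omega>. h (jump_point \<nu> k \<omega>)) = expectation (\<lambda>\<omega>. 1)"
    using count_0 True by (intro Bochner_Integration.integral_cong) auto
  then show ?thesis using True by (simp add: prob_space)
next
  case False
  then have tpos: "t > 0" using t by simp
  define \<tau> where "\<tau> n i = t * real i / real (Suc n)" for n i
  define P where "P n \<omega> = (\<Prod>i<Suc n. h (\<tau> n (Suc i)) ^ (\<nu> (\<tau> n (Suc i)) \<omega> - \<nu> (\<tau> n i) \<omega>))" for n \<omega>
  have \<tau>0: "\<tau> n 0 = 0" and \<tau>n: "\<tau> n (Suc n) = t" for n by (auto simp: \<tau>_def)
  have \<tau>_mono: "\<tau> n i \<le> \<tau> n j" if "i \<le> j" for n i j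
    using that t by (auto simp: \<tau>_def intro!: divide_right_mono mult_left_mono)
  have \<tau>_in: "0 \<le> \<tau> n i" for n i
    using \<tau>_mono[of 0 i n] \<tau>0 by simp
  have \<tau>_le: "\<tau> n i \<le> t" if "i \<le> Suc n" for n i
    using \<tau>_mono[OF that, of n] \<tau>n by simp
  have \<tau>_step: "\<tau> n (Suc i) = \<tau> n i + t / real (Suc n)" for n i
    by (simp add: \<tau>_def algebra_simps add_divide_distrib)
  have h\<tau>: "0 \<le> h (\<tau> n i)" "h (\<tau> n i) \<le> 1" if "i \<le> Suc n" for n i
    using h01[of "\<tau> n i"] \<tau>_in[of n i] \<tau>_le[OF that] by auto
  have [measurable]: "\<nu> (\<tau> n i) \<in> M \<rightarrow>\<^sub>M count_space UNIV" for n i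
    by (intro measurable_count \<tau>_in)
  have P_meas[measurable]: "P n \<in> borel_measurable M" for n
    unfolding P_def by measurable
  have EP: "expectation (P n) = exp (- (\<Sum>i<Suc n. (1 - h (\<tau> n (Suc i))) * (rate.R (\<tau> n (Suc i)) - rate.R (\<tau> n i))))" for n
  proof -
    have "indep_vars (\<lambda>_. count_space UNIV) (\<lambda>i \<omega>. \<nu> (\<tau> n (Suc i)) \<omega> - \<nu> (\<tau> n i) \<omega>) {..<Suc n}"
      by (rule independent_increments) (auto simp: \<tau>0 intro!: monoI \<tau>_mono)
    then have ind: "indep_vars (\<lambda>_. borel) (\<lambda>i \<omega>. h (\<tau> n (Suc i)) ^ (\<nu> (\<tau> n (Suc i)) \<omega> - \<nu> (\<tau> n i) \<omega>)) {..<Suc n}"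
      by (rule indep_vars_compose2) auto
    have "expectation (P n) = (\<Prod>i<Suc n. expectation (\<lambda>\<omega>. h (\<tau> n (Suc i)) ^ (\<nu> (\<tau> n (Suc i)) \<omega> - \<nu> (\<tau> n i) \<omega>)))"
      unfolding P_def
    proof (rule indep_vars_lebesgue_integral[OF _ ind])
      show "integrable M (\<lambda>\<omega>. h (\<tau> n (Suc i)) ^ (\<nu> (\<tau> n (Suc i)) \<omega> - \<nu> (\<tau> n i) \<omega>))" if "i \<in> {..<Suc n}" for i
        using h\<tau>[of "Suc i" n] that by (intro integrable_const_bound[where B=1]) (auto simp: power_le_one)
    qed auto
    also have "\<dots> = (\<Prod>i<Suc n. exp (- ((1 - h (\<tau> n (Suc i))) * (rate.R (\<tau> n (Suc i)) - rate.R (\<tau> n i)))))"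
      using h\<tau> by (intro prod.cong refl expectation_power_increment \<tau>_in \<tau>_mono) auto
    also have "\<dots> = exp (- (\<Sum>i<Suc n. (1 - h (\<tau> n (Suc i))) * (rate.R (\<tau> n (Suc i)) - rate.R (\<tau> n i))))"
      by (simp only: exp_sum[symmetric] finite_lessThan sum_negf)
    finally show ?thesis .
  qed
  \<comment> \<open>\<open>c n x\<close> is the right end of the subinterval that contains \<open>x\<close>\<close>
  define c where "c n x = t * real_of_int \<lceil>real (Suc n) * x / t\<rceil> / real (Suc n)" for n x
  have c_eq: "c n x = \<tau> n (Suc i)" if "\<tau> n i < x" "x \<le> \<tau> n (Suc i)" for n i x
  proof -
    have "\<lceil>real (Suc n) * x / t\<rceil> = int (Suc i)"
      using that tpos by (intro ceiling_unique) (auto simp: \<tau>_def field_simps)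
    then show ?thesis by (simp add: c_def \<tau>_def)
  qed
  have P_eq: "P n \<omega> = (\<Prod>k<\<nu> t \<omega>. h (c n (jump_point \<nu> k \<omega>)))" if \<omega>: "\<omega> \<in> space M" for n \<omega>
  proof -
    have mono: "\<nu> u \<omega> \<le> \<nu> v \<omega>" if "0 \<le> u" "u \<le> v" for u v
      using count_mono[OF \<omega>] that by (auto simp: mono_on_def)
    have "(\<Prod>i<m. h (\<tau> n (Suc i)) ^ (\<nu> (\<tau> n (Suc i)) \<omega> - \<nu> (\<tau> n i) \<omega>)) =
      (\<Prod>k<\<nu> (\<tau> n m) \<omega>. h (c n (jump_point \<nu> k \<omega>)))" for m
    proof (induction m)
      case 0
      then show ?case using count_0[OF \<omega>] by (simp add: \<tau>0)
    next
      case (Suc m)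
      have un: "{..<\<nu> (\<tau> n (Suc m)) \<omega>} = {..<\<nu> (\<tau> n m) \<omega>} \<union> {\<nu> (\<tau> n m) \<omega>..<\<nu> (\<tau> n (Suc m)) \<omega>}"
        using mono[OF \<tau>_in[of n m] \<tau>_mono[of m "Suc m" n]] by auto
      have "(\<Prod>k<\<nu> (\<tau> n (Suc m)) \<omega>. h (c n (jump_point \<nu> k \<omega>))) =
        (\<Prod>k<\<nu> (\<tau> n m) \<omega>. h (c n (jump_point \<nu> k \<omega>))) *
        (\<Prod>k=\<nu> (\<tau> n m) \<omega>..<\<nu> (\<tau> n (Suc m)) \<omega>. h (c n (jump_point \<nu> k \<omega>)))"
        unfolding un by (rule prod.union_disjoint) auto
      also have "(\<Prod>k=\<nu> (\<tau> n m) \<omega>..<\<nu> (\<tau> n (Suc m)) \<omega>. h (c n (jump_point \<nu> k \<omega>))) =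
        (\<Prod>k=\<nu> (\<tau> n m) \<omega>..<\<nu> (\<tau> n (Suc m)) \<omega>. h (\<tau> n (Suc m)))"
      proof (intro prod.cong refl)
        fix k assume "k \<in> {\<nu> (\<tau> n m) \<omega>..<\<nu> (\<tau> n (Suc m)) \<omega>}"
        then have k: "\<not> k < \<nu> (\<tau> n m) \<omega>" "k < \<nu> (\<tau> n (Suc m)) \<omega>" by auto
        note iff = jump_point_props(3)[OF \<omega> \<tau>_in k(2)]
        have "\<tau> n m < jump_point \<nu> k \<omega>" "jump_point \<nu> k \<omega> \<le> \<tau> n (Suc m)"
          using iff[OF \<tau>_in[of n m]] iff[OF \<tau>_in[of n "Suc m"]] k by auto
        then show "h (c n (jump_point \<nu> k \<omega>)) = h (\<tau> n (Suc m))" by (simp add: c_eq)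
      qed
      finally show ?case using Suc by simp
    qed
    from this[of "Suc n"] show ?thesis by (simp add: P_def \<tau>n)
  qed
  have c_lim: "(\<lambda>n. h (c n x)) \<longlonglongrightarrow> h x" if x: "0 < x" "x \<le> t" for x
  proof -
    have bnd: "x \<le> c n x" "c n x \<le> x + t * (1 / real (Suc n))" "c n x \<le> t" for n
    proof -
      let ?y = "real (Suc n) * x / t"
      have y: "?y \<le> real_of_int \<lceil>?y\<rceil>" "real_of_int \<lceil>?y\<rceil> \<le> ?y + 1" by linarith+
      have e: "t * ?y / real (Suc n) = x" "t * (?y + 1) / real (Suc n) = x + t * (1 / real (Suc n))"
      proof -
        show "t * ?y / real (Suc n) = x" using tpos by (simp del: of_nat_Suc)
        then show "t * (?y + 1) / real (Suc n) = x + t * (1 / real (Suc n))"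
          by (simp only: distrib_left add_divide_distrib mult_1_right times_divide_eq_right)
      qed
      have "t * ?y / real (Suc n) \<le> c n x" "c n x \<le> t * (?y + 1) / real (Suc n)"
        unfolding c_def using y tpos by (intro divide_right_mono mult_left_mono; simp)+
      then show "x \<le> c n x" "c n x \<le> x + t * (1 / real (Suc n))"
        unfolding e .
      have "real (Suc n) * x \<le> real (Suc n) * t" using x by (intro mult_left_mono) auto
      then have "?y \<le> real_of_int (int (Suc n))" using tpos by (simp add: divide_le_eq del: of_nat_Suc)
      then have "\<lceil>?y\<rceil> \<le> int (Suc n)" by (rule ceiling_le)
      then have "real_of_int \<lceil>?y\<rceil> \<le> real (Suc n)" by linarith
      then have "t * real_of_int \<lceil>?y\<rceil> / real (Suc n) \<le> t * real (Suc n) / real (Suc n)"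
        using tpos by (intro divide_right_mono mult_left_mono) auto
      then show "c n x \<le> t" by (simp add: c_def)
    qed
    have up: "(\<lambda>n. x + t * (1 / real (Suc n))) \<longlonglongrightarrow> x" by real_asymp
    have "(\<lambda>n. c n x) \<longlonglongrightarrow> x"
      by (rule real_tendsto_sandwich[OF _ _ tendsto_const up]) (intro always_eventually allI bnd)+
    then show ?thesis
      by (rule continuous_on_tendsto_compose[OF h]) (use x bnd in \<open>auto intro!: always_eventually order_trans[OF less_imp_le[OF x(1)]]\<close>)
  qed
  have P_lim: "(\<lambda>n. P n \<omega>) \<longlonglongrightarrow> (\<Prod>k<\<nu> t \<omega>. h (jump_point \<nu> k \<omega>))" if \<omega>: "\<omega> \<in> space M" for \<omega>
    unfolding P_eq[OF \<omega>]
    using jump_point_props(1,2)[OF \<omega> t] by (intro tendsto_prod c_lim) auto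
  have "(\<lambda>n. expectation (P n)) \<longlonglongrightarrow> expectation (\<lambda>\<omega>. \<Prod>k<\<nu> t \<omega>. h (jump_point \<nu> k \<omega>))"
  proof (rule integral_dominated_convergence[where w="\<lambda>_. 1"])
    show "(\<lambda>\<omega>. \<Prod>k<\<nu> t \<omega>. h (jump_point \<nu> k \<omega>)) \<in> borel_measurable M"
      by (rule borel_measurable_LIMSEQ_real[OF P_lim]) measurable
    show "AE \<omega> in M. norm (P n \<omega>) \<le> 1" for n
    proof (intro AE_I2)
      fix \<omega>
      have "0 \<le> P n \<omega>" unfolding P_def using h\<tau> by (intro prod_nonneg) auto
      moreover have "P n \<omega> \<le> 1" unfolding P_def using h\<tau> by (intro prod_le_1) (auto intro: power_le_one)
      ultimately show "norm (P n \<omega>) \<le> 1" by simp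
    qed
  qed (use P_lim in auto)
  moreover have "(\<lambda>n. expectation (P n)) \<longlonglongrightarrow> exp (- integral {0..t} (\<lambda>u. r0 u * (1 - h u)))"
    unfolding EP
  proof (intro tendsto_exp tendsto_minus LIMSEQ_I)
    let ?g = "\<lambda>u. 1 - h u"
    fix e :: real assume e: "e > 0"
    define \<epsilon> where "\<epsilon> = e / (2 * (rate.R t + 1))"
    have \<epsilon>: "\<epsilon> > 0" "\<epsilon> * rate.R t < e"
      using e rate.R_nonneg[of t] by (auto simp: \<epsilon>_def field_simps intro: add_pos_nonneg)
    have g: "continuous_on {0..t} ?g" using h by (intro continuous_intros)
    then have "uniformly_continuous_on {0..t} ?g" by (rule compact_uniformly_continuous) simp
    then obtain d where d: "d > 0" "\<And>x y. x \<in> {0..t} \<Longrightarrow> y \<in> {0..t} \<Longrightarrow> dist y x < d \<Longrightarrow> dist (?g y) (?g x) < \<epsilon>"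
      using \<epsilon>(1) unfolding uniformly_continuous_on_def by blast
    obtain N :: nat where N: "t / d < real N" using reals_Archimedean2 by blast
    have "norm ((\<Sum>i<Suc n. ?g (\<tau> n (Suc i)) * (rate.R (\<tau> n (Suc i)) - rate.R (\<tau> n i))) -
        integral {0..t} (\<lambda>u. r0 u * ?g u)) < e" if n: "n \<ge> N" for n
    proof -
      have mesh: "t / real (Suc n) < d"
      proof -
        have "t / d < real (Suc n)" using N n by simp
        then show ?thesis using d by (simp add: field_simps)
      qed
      have piece: "\<bar>?g (\<tau> n (Suc i)) * (rate.R (\<tau> n (Suc i)) - rate.R (\<tau> n i)) - integral {\<tau> n i..\<tau> n (Suc i)} (\<lambda>u. r0 u * ?g u)\<bar>
          \<le> \<epsilon> * (rate.R (\<tau> n (Suc i)) - rate.R (\<tau> n i))" if i: "i < Suc n" for i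
      proof -
        have near: "\<bar>?g u - ?g (\<tau> n (Suc i))\<bar> \<le> \<epsilon>" if u: "\<tau> n i \<le> u" "u \<le> \<tau> n (Suc i)" for u
        proof -
          have "\<tau> n (Suc i) \<in> {0..t}" "u \<in> {0..t}" using u \<tau>_in[of n i] \<tau>_in[of n "Suc i"] \<tau>_le[of "Suc i" n] i by auto
          moreover have "dist u (\<tau> n (Suc i)) < d" using u mesh \<tau>_step[of n i] by (simp add: dist_real_def)
          ultimately have "dist (?g u) (?g (\<tau> n (Suc i))) < \<epsilon>" by (rule d(2))
          then show ?thesis by (simp add: dist_real_def)
        qed
        have near': "?g (\<tau> n (Suc i)) - \<epsilon> \<le> ?g u" "?g u \<le> ?g (\<tau> n (Suc i)) + \<epsilon>"
          if "\<tau> n i \<le> u" "u \<le> \<tau> n (Suc i)" for u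
          using near[OF that] unfolding abs_le_iff by linarith+
        have gi: "continuous_on {\<tau> n i..\<tau> n (Suc i)} ?g"
          by (rule continuous_on_subset[OF g]) (use \<tau>_in[of n i] \<tau>_in[of n "Suc i"] \<tau>_le[of "Suc i" n] i in auto)
        have "integral {\<tau> n i..\<tau> n (Suc i)} (\<lambda>u. r0 u * ?g u) \<le> (?g (\<tau> n (Suc i)) + \<epsilon>) * (rate.R (\<tau> n (Suc i)) - rate.R (\<tau> n i))"
          by (rule rate.integral_product_le[OF \<tau>_in \<tau>_mono gi near'(2)]) auto
        moreover have "(?g (\<tau> n (Suc i)) - \<epsilon>) * (rate.R (\<tau> n (Suc i)) - rate.R (\<tau> n i)) \<le> integral {\<tau> n i..\<tau> n (Suc i)} (\<lambda>u. r0 u * ?g u)"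
          by (rule rate.integral_product_ge[OF \<tau>_in \<tau>_mono gi near'(1)]) auto
        ultimately show ?thesis by (simp only: abs_le_iff) (simp add: algebra_simps)
      qed
      have split: "integral {0..\<tau> n m} (\<lambda>u. r0 u * ?g u) = (\<Sum>i<m. integral {\<tau> n i..\<tau> n (Suc i)} (\<lambda>u. r0 u * ?g u))"
        if "m \<le> Suc n" for m
        using that
      proof (induction m)
        case 0
        then show ?case by (simp add: \<tau>0)
      next
        case (Suc m)
        have "continuous_on {0..\<tau> n (Suc m)} ?g"
          by (rule continuous_on_subset[OF g]) (use \<tau>_le[of "Suc m" n] Suc in auto)
        from rate.integral_product_split[OF order_refl \<tau>_in[of n m] \<tau>_mono[of m "Suc m" n] this]
        show ?case using Suc by simp
      qed
      have "norm ((\<Sum>i<Suc n. ?g (\<tau> n (Suc i)) * (rate.R (\<tau> n (Suc i)) - rate.R (\<tau> n i))) -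
        integral {0..t} (\<lambda>u. r0 u * ?g u)) =
        \<bar>\<Sum>i<Suc n. ?g (\<tau> n (Suc i)) * (rate.R (\<tau> n (Suc i)) - rate.R (\<tau> n i)) - integral {\<tau> n i..\<tau> n (Suc i)} (\<lambda>u. r0 u * ?g u)\<bar>"
        using split[of "Suc n"] by (simp only: \<tau>n sum_subtractf real_norm_def order_refl)
      also have "\<dots> \<le> (\<Sum>i<Suc n. \<epsilon> * (rate.R (\<tau> n (Suc i)) - rate.R (\<tau> n i)))"
        by (rule order_trans[OF sum_abs]) (intro sum_mono piece, simp)
      also have "\<dots> = \<epsilon> * (rate.R t - rate.R 0)"
        using sum_lessThan_telescope[of "\<lambda>i. rate.R (\<tau> n i)" "Suc n"]
        by (simp only: \<tau>n \<tau>0 sum_distrib_left[symmetric])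
      also have "\<dots> < e" using \<epsilon>(2) by (simp add: rate.R_def)
      finally show ?thesis .
    qed
    then show "\<exists>N. \<forall>n\<ge>N. norm ((\<Sum>i<Suc n. ?g (\<tau> n (Suc i)) * (rate.R (\<tau> n (Suc i)) - rate.R (\<tau> n i))) -
        integral {0..t} (\<lambda>u. r0 u * ?g u)) < e" by blast
  qed
  ultimately have "expectation (\<lambda>\<omega>. \<Prod>k<\<nu> t \<omega>. h (jump_point \<nu> k \<omega>)) = exp (- integral {0..t} (\<lambda>u. r0 u * (1 - h u)))"
    by (rule LIMSEQ_unique)
  then show ?thesis by (simp add: integral_r0)
qed

end


section \<open>The generating function of the process with immigration\<close>

definition rational_times :: "real \<Rightarrow> real set" where "rational_times t = \<rat> \<inter> {0..t}"

text \<open>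
  The jump points as a function of the whole path. The infimum runs over rational times only, in order
  to be measurable on the product space, whose elements need not be right-continuous; the value
  \<open>t\<close> before the jump gives the correct result when the jump happens at an irrational time \<open>t\<close>.
\<close>

definition path_jump :: "real \<Rightarrow> (real \<Rightarrow> nat) \<Rightarrow> nat \<Rightarrow> real" where
  "path_jump t x k = (INF u\<in>rational_times t. if k < x u then u else t)"

lemma countable_rational_times: "countable (rational_times t)"
  unfolding rational_times_def by (intro countable_Int1 countable_rat)

lemma (in nonhomogeneous_poisson_process) path_jump_eq:
  assumes \<omega>: "\<omega> \<in> space M" and t: "0 \<le> t" and k: "k < \<nu> t \<omega>"
  shows "path_jump t (\<lambda>u\<in>{0..}. \<nu> u \<omega>) k = jump_point \<nu> k \<omega>"
proof -
  let ?S = "jump_point \<nu> k \<omega>" and ?f = "\<lambda>u. if k < (\<lambda>u\<in>{0..}. \<nu> u \<omega>) u then u else t"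
  note S = jump_point_props[OF \<omega> t k]
  have ge: "?S \<le> ?f u" if "u \<in> rational_times t" for u
    using that S(2) S(3)[of u] by (auto simp: rational_times_def)
  have bdd: "bdd_below (?f ` rational_times t)" using ge by (intro bdd_belowI2)
  have "(INF u\<in>rational_times t. ?f u) \<le> ?S"
  proof (cases "?S < t")
    case False
    have "0 \<in> rational_times t" using t by (simp add: rational_times_def)
    moreover have "?f 0 = t" using S(1) S(3)[of 0] by auto
    ultimately show ?thesis using False cINF_lower[OF bdd, of 0] by simp
  next
    case True
    show ?thesis
    proof (rule dense_ge_bounded[OF True])
      fix v assume v: "?S < v" "v < t"
      obtain q where q: "q \<in> \<rat>" "?S < q" "q < v" using Rats_dense_in_real[OF v(1)] by blast
      then have "q \<in> rational_times t" using v S(1) by (auto simp: rational_times_def)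
      moreover have "?f q = q" using S(1) S(3)[of q] q by auto
      ultimately show "(INF u\<in>rational_times t. ?f u) \<le> v"
        using cINF_lower[OF bdd, of q] q by linarith
    qed
  qed
  moreover have "?S \<le> (INF u\<in>rational_times t. ?f u)"
  proof (rule cINF_greatest)
    have "0 \<in> rational_times t" using t by (simp add: rational_times_def)
    then show "rational_times t \<noteq> {}" by blast
  qed (rule ge)
  ultimately show ?thesis unfolding path_jump_def by (rule antisym)
qed

context mbp_with_immigration
begin

abbreviation "path_space \<equiv> PiM {0..} (\<lambda>_::real. count_space (UNIV :: nat set))"
abbreviation "sizes_space \<equiv> PiM UNIV (\<lambda>_::nat. count_space (UNIV :: nat set))"
abbreviation "trees_space \<equiv> PiM UNIV (\<lambda>_::nat \<times> nat. genealogy_law \<mu> offspring)"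

definition total :: "real \<Rightarrow> (real \<Rightarrow> nat) \<times> (nat \<Rightarrow> nat) \<times> (nat \<times> nat \<Rightarrow> genealogy) \<Rightarrow> nat" where
  "total t = (\<lambda>(x, y, z). \<Sum>k<x t. \<Sum>j<y k. population (z (k, j)) (t - path_jump t x k))"

definition path :: "'a \<Rightarrow> real \<Rightarrow> nat" where "path \<omega> = (\<lambda>u\<in>{0..}. \<nu> u \<omega>)"
definition sizes :: "'a \<Rightarrow> nat \<Rightarrow> nat" where "sizes \<omega> = (\<lambda>k. I k \<omega>)"
definition trees :: "'a \<Rightarrow> nat \<times> nat \<Rightarrow> genealogy" where "trees \<omega> = (\<lambda>kj. G kj \<omega>)"

lemma total_population_eq:
  assumes "\<omega> \<in> space M" "0 \<le> t"
  shows "total_population \<nu> I G t \<omega> = total t (path \<omega>, sizes \<omega>, trees \<omega>)"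
  using assms path_jump_eq[OF assms]
  by (auto simp: total_population_def total_def path_def sizes_def trees_def intro!: sum.cong)

lemma measurable_G[measurable]: "G kj \<in> M \<rightarrow>\<^sub>M genealogy_law \<mu> offspring"
  using G_indep unfolding indep_vars_def by blast

lemma measurable_I[measurable]: "I k \<in> M \<rightarrow>\<^sub>M count_space UNIV"
  using I_indep unfolding indep_vars_def by blast

lemma measurable_path[measurable]: "path \<in> M \<rightarrow>\<^sub>M path_space"
  unfolding path_def by (rule measurable_restrict) (use measurable_count in auto)

lemma measurable_sizes[measurable]: "sizes \<in> M \<rightarrow>\<^sub>M sizes_space"
  unfolding sizes_def by (rule measurable_PiM_single') (auto simp: space_PiM)

lemma measurable_trees[measurable]: "trees \<in> M \<rightarrow>\<^sub>M trees_space"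
  unfolding trees_def by (rule measurable_PiM_single') (auto simp: space_PiM)

lemma measurable_path_jump[measurable]:
  assumes "0 \<le> t"
  shows "(\<lambda>x. path_jump t x k) \<in> borel_measurable path_space"
  unfolding path_jump_def
proof (rule borel_measurable_cINF_real[OF countable_rational_times])
  fix u assume "u \<in> rational_times t"
  then have [measurable]: "(\<lambda>x. x u) \<in> path_space \<rightarrow>\<^sub>M count_space UNIV"
    by (intro measurable_component_singleton) (auto simp: rational_times_def)
  show "(\<lambda>x. if k < x u then u else t) \<in> borel_measurable path_space" by measurable
qed

lemma measurable_total[measurable]:
  assumes t: "0 \<le> t"
  shows "total t \<in> path_space \<Otimes>\<^sub>M (sizes_space \<Otimes>\<^sub>M trees_space) \<rightarrow>\<^sub>M count_space UNIV"
proof -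
  let ?N = "path_space \<Otimes>\<^sub>M (sizes_space \<Otimes>\<^sub>M trees_space)"
  note [measurable] = measurable_path_jump[OF t]
  have 1: "(\<lambda>w. fst w t) \<in> ?N \<rightarrow>\<^sub>M count_space UNIV"
    using t by (intro measurable_compose[OF measurable_fst measurable_component_singleton]) auto
  have 2: "(\<lambda>w. fst (snd w) k) \<in> ?N \<rightarrow>\<^sub>M count_space UNIV" for k
    by (intro measurable_compose[OF measurable_compose[OF measurable_snd measurable_fst] measurable_component_singleton]) auto
  have 3: "(\<lambda>w. snd (snd w) kj) \<in> ?N \<rightarrow>\<^sub>M genealogy_law \<mu> offspring" for kj
    by (intro measurable_compose[OF measurable_compose[OF measurable_snd measurable_snd] measurable_component_singleton]) auto
  have 4: "(\<lambda>w. t - path_jump t (fst w) k) \<in> borel_measurable ?N" for k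
    by (intro borel_measurable_diff borel_measurable_const measurable_compose[OF measurable_fst measurable_path_jump[OF t]])
  have 5: "(\<lambda>w. population (snd (snd w) (k, j)) (t - path_jump t (fst w) k)) \<in> ?N \<rightarrow>\<^sub>M count_space UNIV" for k j
    using measurable_compose[OF measurable_Pair[OF 3[of "(k, j)"] 4[of k]] measurable_population] by simp
  have 6: "(\<lambda>w. \<Sum>j<fst (snd w) k. population (snd (snd w) (k, j)) (t - path_jump t (fst w) k)) \<in> ?N \<rightarrow>\<^sub>M count_space UNIV" for k
    by (rule measurable_compose_countable[where g="\<lambda>w. fst (snd w) k"
          and f="\<lambda>n w. \<Sum>j<n. population (snd (snd w) (k, j)) (t - path_jump t (fst w) k)"])
       (use 2 5 in \<open>auto intro!: measurable_sum_nat\<close>)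
  have 7: "(\<lambda>w. \<Sum>k<fst w t. \<Sum>j<fst (snd w) k. population (snd (snd w) (k, j)) (t - path_jump t (fst w) k)) \<in> ?N \<rightarrow>\<^sub>M count_space UNIV"
    by (rule measurable_compose_countable[where g="\<lambda>w. fst w t"
          and f="\<lambda>n w. \<Sum>k<n. \<Sum>j<fst (snd w) k. population (snd (snd w) (k, j)) (t - path_jump t (fst w) k)"])
       (use 1 6 in \<open>auto intro!: measurable_sum_nat\<close>)
  show ?thesis
    unfolding total_def using 7 by (simp add: split_beta')
qed

lemma measurable_total_population[measurable]:
  assumes "0 \<le> t"
  shows "total_population \<nu> I G t \<in> M \<rightarrow>\<^sub>M count_space UNIV"
proof -
  have "(\<lambda>\<omega>. total t (path \<omega>, sizes \<omega>, trees \<omega>)) \<in> M \<rightarrow>\<^sub>M count_space UNIV"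
    by (rule measurable_compose[OF _ measurable_total[OF assms]]) measurable
  then show ?thesis
    by (subst measurable_cong[OF total_population_eq[OF _ assms]]) auto
qed

lemma joint_law:
  "distr M (path_space \<Otimes>\<^sub>M (sizes_space \<Otimes>\<^sub>M trees_space)) (\<lambda>\<omega>. (path \<omega>, sizes \<omega>, trees \<omega>)) =
     distr M path_space path \<Otimes>\<^sub>M (distr M sizes_space sizes \<Otimes>\<^sub>M distr M trees_space trees)"
  using components_indep unfolding Let_def path_def sizes_def trees_def .

text \<open>
  Given the jump points and the sizes of the waves, the descendants of different immigrants are
  independent.
\<close>

lemma expectation_trees:
  assumes s: "0 \<le> s" "s \<le> 1"
  shows "expectation (\<lambda>\<omega>. s ^ (\<Sum>k<n. \<Sum>j<i k. population (trees \<omega> (k, j)) (\<tau> k))) =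
    (\<Prod>k<n. mbp_F \<mu> offspring (\<tau> k) s ^ i k)"
proof -
  let ?J = "Sigma {..<n} (\<lambda>k. {..<i k})"
  have "expectation (\<lambda>\<omega>. s ^ (\<Sum>k<n. \<Sum>j<i k. population (trees \<omega> (k, j)) (\<tau> k))) =
    expectation (\<lambda>\<omega>. \<Prod>kj\<in>?J. s ^ population (G kj \<omega>) (\<tau> (fst kj)))"
    by (intro Bochner_Integration.integral_cong refl)
       (simp add: trees_def power_sum prod.Sigma split_beta')
  also have "\<dots> = (\<Prod>kj\<in>?J. expectation (\<lambda>\<omega>. s ^ population (G kj \<omega>) (\<tau> (fst kj))))"
  proof (rule indep_vars_lebesgue_integral)
    show "indep_vars (\<lambda>_. borel) (\<lambda>kj \<omega>. s ^ population (G kj \<omega>) (\<tau> (fst kj))) ?J"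
      by (rule indep_vars_compose2[OF indep_vars_subset[OF G_indep]]) auto
    show "integrable M (\<lambda>\<omega>. s ^ population (G kj \<omega>) (\<tau> (fst kj)))" for kj
      using s by (intro integrable_const_bound[where B=1]) (auto simp: power_le_one)
  qed auto
  also have "\<dots> = (\<Prod>kj\<in>?J. mbp_F \<mu> offspring (\<tau> (fst kj)) s)"
  proof (intro prod.cong refl)
    fix kj
    have "mbp_F \<mu> offspring (\<tau> (fst kj)) s = (LINT T|distr M (genealogy_law \<mu> offspring) (G kj). s ^ population T (\<tau> (fst kj)))"
      unfolding mbp_F_def G_law ..
    also have "\<dots> = expectation (\<lambda>\<omega>. s ^ population (G kj \<omega>) (\<tau> (fst kj)))"
      by (rule integral_distr) measurable
    finally show "expectation (\<lambda>\<omega>. s ^ population (G kj \<omega>) (\<tau> (fst kj))) = mbp_F \<mu> offspring (\<tau> (fst kj)) s" ..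
  qed
  also have "\<dots> = (\<Prod>k<n. \<Prod>j<i k. mbp_F \<mu> offspring (\<tau> k) s)"
    by (subst prod.Sigma) (auto simp: split_beta')
  finally show ?thesis by simp
qed

lemma expectation_sizes:
  assumes c: "\<And>k. 0 \<le> c k" "\<And>k. c k \<le> 1"
  shows "expectation (\<lambda>\<omega>. \<Prod>k<n. c k ^ sizes \<omega> k) = (\<Prod>k<n. pgf immigrants (c k))"
proof -
  have "expectation (\<lambda>\<omega>. \<Prod>k<n. c k ^ sizes \<omega> k) = (\<Prod>k<n. expectation (\<lambda>\<omega>. c k ^ I k \<omega>))"
    unfolding sizes_def
  proof (rule indep_vars_lebesgue_integral)
    show "indep_vars (\<lambda>_. borel) (\<lambda>k \<omega>. c k ^ I k \<omega>) {..<n}"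
      by (rule indep_vars_compose2[OF indep_vars_subset[OF I_indep]]) auto
    show "integrable M (\<lambda>\<omega>. c k ^ I k \<omega>)" for k
      using c by (intro integrable_const_bound[where B=1]) (auto simp: power_le_one)
  qed auto
  also have "\<dots> = (\<Prod>k<n. pgf immigrants (c k))"
  proof (intro prod.cong refl)
    fix k
    have "pgf immigrants (c k) = (LINT m|distr M (count_space UNIV) (I k). c k ^ m)"
      unfolding pgf_def I_law ..
    also have "\<dots> = expectation (\<lambda>\<omega>. c k ^ I k \<omega>)"
      by (rule integral_distr) auto
    finally show "expectation (\<lambda>\<omega>. c k ^ I k \<omega>) = pgf immigrants (c k)" ..
  qed
  finally show ?thesis .
qed

text \<open>
  The law of the three components is a product, so one may integrate first over the genealogies, then
  over the sizes of the waves; what remains is a product over the jump points.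
\<close>

theorem expectation_total_population_conditional:
  assumes s: "0 \<le> s" "s \<le> 1" and t: "0 \<le> t"
  shows "expectation (\<lambda>\<omega>. s ^ total_population \<nu> I G t \<omega>) =
    expectation (\<lambda>\<omega>. \<Prod>k<\<nu> t \<omega>. pgf immigrants (mbp_F \<mu> offspring (t - jump_point \<nu> k \<omega>) s))"
proof -
  let ?A = "distr M path_space path" and ?B = "distr M sizes_space sizes" and ?C = "distr M trees_space trees"
  interpret A: prob_space ?A by (rule prob_space_distr) measurable
  interpret B: prob_space ?B by (rule prob_space_distr) measurable
  interpret C: prob_space ?C by (rule prob_space_distr) measurable
  interpret BC: pair_prob_space ?B ?C ..
  interpret ABC: pair_prob_space ?A "?B \<Otimes>\<^sub>M ?C" ..
  let ?f = "\<lambda>w. s ^ total t w"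
  let ?F = "\<lambda>\<tau>. mbp_F \<mu> offspring \<tau> s"
  note [measurable] = measurable_total[OF t]
  have meas: "?f \<in> borel_measurable (?A \<Otimes>\<^sub>M (?B \<Otimes>\<^sub>M ?C))"
  proof -
    have "?f \<in> borel_measurable (path_space \<Otimes>\<^sub>M (sizes_space \<Otimes>\<^sub>M trees_space))" by measurable
    then show ?thesis
      by (subst measurable_cong_sets[OF sets_pair_measure_cong[OF sets_distr sets_pair_measure_cong[OF sets_distr sets_distr]] refl])
  qed
  have F01: "0 \<le> ?F \<tau>" "?F \<tau> \<le> 1" for \<tau> using mbp_F_bounds[OF \<mu>_pos s] by auto
  have "expectation (\<lambda>\<omega>. s ^ total_population \<nu> I G t \<omega>) = expectation (\<lambda>\<omega>. ?f (path \<omega>, sizes \<omega>, trees \<omega>))"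
    by (intro Bochner_Integration.integral_cong refl) (simp add: total_population_eq t)
  also have "\<dots> = (LINT w|distr M (path_space \<Otimes>\<^sub>M (sizes_space \<Otimes>\<^sub>M trees_space)) (\<lambda>\<omega>. (path \<omega>, sizes \<omega>, trees \<omega>)). ?f w)"
    by (rule integral_distr[symmetric]) measurable
  also have "\<dots> = (LINT w|(?A \<Otimes>\<^sub>M (?B \<Otimes>\<^sub>M ?C)). ?f w)"
    unfolding joint_law ..
  also have "\<dots> = (LINT x|?A. LINT yz|(?B \<Otimes>\<^sub>M ?C). ?f (x, yz))"
    using s meas
    by (intro ABC.integral_fst'[symmetric] ABC.integrable_const_bound[where B=1]) (auto simp: power_le_one)
  also have "\<dots> = (LINT x|?A. (\<Prod>k<x t. pgf immigrants (?F (t - path_jump t x k))))"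
  proof (intro Bochner_Integration.integral_cong refl)
    fix x assume x: "x \<in> space ?A"
    have meas_x: "(\<lambda>yz. ?f (x, yz)) \<in> borel_measurable (?B \<Otimes>\<^sub>M ?C)"
      by (rule measurable_compose[OF measurable_Pair1'[OF x] meas])
    have "(LINT yz|(?B \<Otimes>\<^sub>M ?C). ?f (x, yz)) = (LINT y|?B. LINT z|?C. ?f (x, y, z))"
      using s meas_x
      by (intro BC.integral_fst'[symmetric] BC.integrable_const_bound[where B=1]) (auto simp: power_le_one)
    also have "\<dots> = (LINT y|?B. (\<Prod>k<x t. ?F (t - path_jump t x k) ^ y k))"
    proof (intro Bochner_Integration.integral_cong refl)
      fix y assume y: "y \<in> space ?B"
      have meas_xy: "(\<lambda>z. ?f (x, y, z)) \<in> borel_measurable ?C"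
        by (rule measurable_compose[OF measurable_Pair1'[OF y] meas_x])
      have "(LINT z|?C. ?f (x, y, z)) = expectation (\<lambda>\<omega>. ?f (x, y, trees \<omega>))"
        using meas_xy by (intro integral_distr) auto
      also have "\<dots> = (\<Prod>k<x t. ?F (t - path_jump t x k) ^ y k)"
        unfolding total_def using expectation_trees[OF s] by simp
      finally show "(LINT z|?C. ?f (x, y, z)) = (\<Prod>k<x t. ?F (t - path_jump t x k) ^ y k)" .
    qed
    also have "\<dots> = expectation (\<lambda>\<omega>. \<Prod>k<x t. ?F (t - path_jump t x k) ^ sizes \<omega> k)"
    proof (rule integral_distr)
      have "(\<lambda>y. y k) \<in> sizes_space \<rightarrow>\<^sub>M count_space UNIV" for k
        by (rule measurable_component_singleton) simp
      note [measurable] = this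
      show "(\<lambda>y. \<Prod>k<x t. ?F (t - path_jump t x k) ^ y k) \<in> borel_measurable sizes_space"
        by measurable
    qed measurable
    also have "\<dots> = (\<Prod>k<x t. pgf immigrants (?F (t - path_jump t x k)))"
      using F01 by (rule expectation_sizes)
    finally show "(LINT yz|(?B \<Otimes>\<^sub>M ?C). ?f (x, yz)) = (\<Prod>k<x t. pgf immigrants (?F (t - path_jump t x k)))" .
  qed
  also have "\<dots> = expectation (\<lambda>\<omega>. \<Prod>k<path \<omega> t. pgf immigrants (?F (t - path_jump t (path \<omega>) k)))"
  proof (rule integral_distr)
    note [measurable] = measurable_path_jump[OF t] measurable_mbp_F[OF \<mu>_pos]
    have comp: "(\<lambda>x. x t) \<in> path_space \<rightarrow>\<^sub>M count_space UNIV"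
      using t by (intro measurable_component_singleton) auto
    show "(\<lambda>x. \<Prod>k<x t. pgf immigrants (?F (t - path_jump t x k))) \<in> borel_measurable path_space"
      by (rule measurable_compose_countable[OF _ comp, where f="\<lambda>n x. \<Prod>k<n. pgf immigrants (?F (t - path_jump t x k))"]) measurable
  qed measurable
  also have "\<dots> = expectation (\<lambda>\<omega>. \<Prod>k<\<nu> t \<omega>. pgf immigrants (?F (t - jump_point \<nu> k \<omega>)))"
  proof (intro Bochner_Integration.integral_cong refl)
    fix \<omega> assume \<omega>: "\<omega> \<in> space M"
    show "(\<Prod>k<path \<omega> t. pgf immigrants (?F (t - path_jump t (path \<omega>) k))) =
        (\<Prod>k<\<nu> t \<omega>. pgf immigrants (?F (t - jump_point \<nu> k \<omega>)))"
      using path_jump_eq[OF \<omega> t] t by (auto simp: path_def intro!: prod.cong)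
  qed
  finally show ?thesis .
qed

theorem expectation_total_population:
  assumes mean: "(\<integral>\<^sup>+k. of_nat k \<partial>measure_pmf offspring) \<le> 1" and s: "0 \<le> s" "s \<le> 1" and t: "0 \<le> t"
  shows "expectation (\<lambda>\<omega>. s ^ total_population \<nu> I G t \<omega>) =
    exp (- integral {0..t} (\<lambda>u. r u * mbp_q \<mu> offspring immigrants (t - u) s))"
proof -
  let ?h = "\<lambda>u. pgf immigrants (mbp_F \<mu> offspring (t - u) s)"
  have F01: "mbp_F \<mu> offspring \<tau> s \<in> {0..1}" for \<tau> using mbp_F_bounds[OF \<mu>_pos s] by auto
  have cont: "continuous_on {0..t} (\<lambda>u. mbp_F \<mu> offspring (t - u) s)"
    by (rule continuous_on_compose2[OF mbp_F_continuous_derivative(2)[OF \<mu>_pos mean s, of 0 t]])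
       (use t in \<open>auto intro!: continuous_intros\<close>)
  have "continuous_on {0..t} ?h"
    by (rule continuous_on_compose2[OF continuous_on_pgf cont]) (use F01 in auto)
  then have "expectation (\<lambda>\<omega>. \<Prod>k<\<nu> t \<omega>. ?h (jump_point \<nu> k \<omega>)) = exp (- integral {0..t} (\<lambda>u. r u * (1 - ?h u)))"
    using F01 pgf_bounds[of _ immigrants] by (intro poisson_functional[OF t]) auto
  then show ?thesis
    by (simp add: expectation_total_population_conditional[OF s t] mbp_q_def)
qed

end


section \<open>The asymptotic scales\<close>

lemma (in prob_space) integral_uniform_measure:
  fixes f :: "'a \<Rightarrow> real"
  assumes [measurable]: "f \<in> borel_measurable M" "A \<in> events" and A: "prob A > 0"
  shows "(LINT x|uniform_measure M A. f x) = (LINT x|M. indicator A x * f x) / prob A"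
proof -
  have "uniform_measure M A = density M (\<lambda>x. ennreal (indicator A x / prob A))"
    unfolding uniform_measure_def
  proof (intro density_cong AE_I2)
    show "indicator A x / emeasure M A = ennreal (indicator A x / prob A)" for x
      using A by (auto simp: indicator_def emeasure_eq_measure divide_ennreal simp flip: ennreal_1)
  qed auto
  then have "(LINT x|uniform_measure M A. f x) = (LINT x|density M (\<lambda>x. ennreal (indicator A x / prob A)). f x)"
    by simp
  also have "\<dots> = (LINT x|M. indicator A x / prob A * f x)"
    using A by (subst integral_density) auto
  also have "\<dots> = (LINT x|M. (indicator A x * f x) / prob A)" by simp
  finally show ?thesis by (simp only: integral_divide_zero)
qed

text \<open>
  \<open>1 - exp (- x)\<close> is \<open>x\<close> times a function that is continuous with value 1 at 0. The numerator \<open>x t\<close> may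
  vanish, hence the function \<open>\<phi>\<close> extended to 0.
\<close>

lemma one_minus_exp_ratio_tendsto:
  fixes x y :: "real \<Rightarrow> real"
  assumes y: "(y \<longlongrightarrow> 0) F" "eventually (\<lambda>t. y t > 0) F" and xy: "((\<lambda>t. x t / y t) \<longlongrightarrow> c) F"
  shows "((\<lambda>t. (1 - exp (- x t)) / (1 - exp (- y t))) \<longlongrightarrow> c) F"
proof -
  define \<phi> where "\<phi> x = (if x = 0 then 1 else (1 - exp (- x)) / x)" for x :: real
  have "((\<lambda>x::real. (1 - exp (- x)) / x) \<longlongrightarrow> 1) (at 0)" by real_asymp
  then have "(\<phi> \<longlongrightarrow> 1) (at 0)"
    by (rule Lim_transform_eventually) (auto simp: \<phi>_def eventually_at_filter)
  then have "isCont \<phi> 0" by (simp add: isCont_def \<phi>_def)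
  then have \<phi>: "((\<lambda>t. \<phi> (z t)) \<longlongrightarrow> 1) F" if "(z \<longlongrightarrow> 0) F" for z
    using isCont_tendsto_compose[of 0 \<phi> z F] that by (simp add: \<phi>_def)
  have "((\<lambda>t. x t / y t * y t) \<longlongrightarrow> c * 0) F" by (intro tendsto_mult xy y)
  moreover have "eventually (\<lambda>t. x t / y t * y t = x t) F" using y(2) by eventually_elim simp
  ultimately have x: "(x \<longlongrightarrow> 0) F" using Lim_transform_eventually by fastforce
  have "((\<lambda>t. x t / y t * (\<phi> (x t) / \<phi> (y t))) \<longlongrightarrow> c * (1 / 1)) F"
    by (intro tendsto_mult tendsto_divide xy \<phi> x y) auto
  moreover have "eventually (\<lambda>t. x t / y t * (\<phi> (x t) / \<phi> (y t)) = (1 - exp (- x t)) / (1 - exp (- y t))) F"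
    using y(2) by eventually_elim (auto simp: \<phi>_def)
  ultimately show ?thesis using Lim_transform_eventually by fastforce
qed

lemma continuous_on_half_line:
  fixes f :: "real \<Rightarrow> real"
  assumes "\<And>b. continuous_on {0..b} f"
  shows "continuous_on {0..} f"
  unfolding continuous_on_eq_continuous_within
proof
  fix x :: real assume x: "x \<in> {0..}"
  have "continuous (at x within {0..x + 1}) f"
    using assms[of "x + 1"] x by (simp add: continuous_on_eq_continuous_within)
  moreover have "at x within {0..x + 1} = at x within {0..}"
    by (rule at_within_nhd[of x "{..<x + 1}"]) auto
  ultimately show "continuous (at x within {0..}) f" by simp
qed

locale critical_immigration = mbp_with_immigration M r \<nu> \<mu> offspring immigrants I G
  for M :: "'a measure" and r \<nu> \<mu> offspring immigrants I and G :: "nat \<times> nat \<Rightarrow> 'a \<Rightarrow> genealogy" +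
  fixes L l L\<^sub>R :: "real \<Rightarrow> real" and \<alpha> \<gamma> \<theta> :: real
  assumes critical: "measure_pmf.expectation offspring real = 1"
    and \<gamma>: "0 < \<gamma>" and \<alpha>: "0 < \<alpha>" and \<theta>: "0 < \<theta>"
    and L: "slowly_varying L" and l: "slowly_varying l" and L\<^sub>R: "slowly_varying L\<^sub>R"
    and f: "\<And>s. 0 \<le> s \<Longrightarrow> s < 1 \<Longrightarrow>
              pgf offspring s = s + (1 - s) powr (\<gamma> + 1) * L (1 / (1 - s))"
    and g: "\<And>s. 0 \<le> s \<Longrightarrow> s < 1 \<Longrightarrow>
              pgf immigrants s = 1 - (1 - s) powr \<alpha> * l (1 / (1 - s))"
    and r: "\<And>t. t > 0 \<Longrightarrow> r t = t powr (- \<theta>) * L\<^sub>R t"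
begin

abbreviation "F \<equiv> mbp_F \<mu> offspring"
abbreviation "V \<equiv> mbp_V offspring"
abbreviation "W \<equiv> mbp_W offspring"
abbreviation "q \<equiv> mbp_q \<mu> offspring immigrants"
abbreviation "Y \<equiv> total_population \<nu> I G"
abbreviation "\<beta> \<equiv> \<alpha> / \<gamma>"

lemma mean: "(\<integral>\<^sup>+k. of_nat k \<partial>measure_pmf offspring) \<le> 1"
  by (rule critical_mean(2)[OF critical])

sublocale rate: power_intensity r0 L\<^sub>R \<theta>
proof
  show "r0 t = t powr - \<theta> * L\<^sub>R t" if "t > 0" for t using r[OF that] that by (simp add: r0_def)
qed (use L\<^sub>R \<theta> in auto)

text \<open>
  A slowly varying function is positive only near infinity, so convexity and monotonicity have to
  transport the strict inequalities from a neighbourhood of 1 to the whole interval.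
\<close>

lemma ex_positive_near_1:
  assumes "slowly_varying K" "0 \<le> x" "x < 1"
  shows "\<exists>y. x \<le> y \<and> 0 \<le> y \<and> y < 1 \<and> 0 < K (1 / (1 - y))"
proof -
  obtain a where a: "\<And>x. x \<ge> a \<Longrightarrow> K x > 0" using assms(1) unfolding slowly_varying_def by blast
  define X where "X = max (max a 2) (1 / (1 - x))"
  have X: "X \<ge> a" "X \<ge> 2" "1 / (1 - x) \<le> X" by (auto simp: X_def)
  have "1 / X \<le> 1 - x" using X assms by (simp add: field_simps)
  then show ?thesis
    using X a[of X] by (intro exI[of _ "1 - 1 / X"]) (auto simp: field_simps)
qed

lemma offspring_gt: "x < pgf offspring x" if x: "0 \<le> x" "x < 1"
proof -
  obtain y where y: "x \<le> y" "0 \<le> y" "y < 1" "0 < L (1 / (1 - y))" using ex_positive_near_1[OF L x] by blast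
  then have "y < pgf offspring y" using f[of y] by simp
  then show ?thesis using critical_pgf_gt[OF critical x y(1,3)] by simp
qed

lemma immigrants_less: "pgf immigrants x < 1" if x: "0 \<le> x" "x < 1"
proof -
  obtain y where y: "x \<le> y" "0 \<le> y" "y < 1" "0 < l (1 / (1 - y))" using ex_positive_near_1[OF l x] by blast
  then have "pgf immigrants y < 1" using g[of y] by simp
  then show ?thesis using pgf_mono[of x y immigrants] x y by simp
qed

lemma V_props:
  shows "V 1 = 0" and "\<And>x y. 1 \<le> x \<Longrightarrow> x < y \<Longrightarrow> V x < V y"
    and "\<And>x. 1 < x \<Longrightarrow> (V has_real_derivative 1 / (x\<^sup>2 * (pgf offspring (1 - 1 / x) - (1 - 1 / x)))) (at x)"
    and "\<And>y. 0 \<le> y \<Longrightarrow> \<exists>x\<ge>1. V x = y"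
  using mbp_V_properties[of offspring] mean offspring_gt by blast+

lemma V_mono: "1 \<le> x \<Longrightarrow> x \<le> y \<Longrightarrow> V x \<le> V y"
  using V_props(2)[of x y] by (cases "x = y") auto

lemma V_nonneg: "1 \<le> x \<Longrightarrow> 0 \<le> V x"
  using V_mono[of 1 x] V_props(1) by simp

lemma V_inj: "inj_on V {1..}"
proof (rule inj_onI)
  fix x y assume "x \<in> {1..}" "y \<in> {1..}" "V x = V y"
  then show "x = y" using V_props(2)[of x y] V_props(2)[of y x] by (cases x y rule: linorder_cases) auto
qed

lemma W_ge_1: "0 \<le> y \<Longrightarrow> 1 \<le> W y" and V_W: "0 \<le> y \<Longrightarrow> V (W y) = y"
proof -
  assume "0 \<le> y"
  then have "y \<in> V ` {1..}" using V_props(4)[of y] by auto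
  from inv_into_into[OF this] f_inv_into_f[OF this]
  show "1 \<le> W y" "V (W y) = y" by (auto simp: mbp_W_def)
qed

lemma W_V: "1 \<le> x \<Longrightarrow> W (V x) = x"
  unfolding mbp_W_def by (rule inv_into_f_f[OF V_inj]) simp

lemma W_mono: "0 \<le> x \<Longrightarrow> x \<le> y \<Longrightarrow> W x \<le> W y"
  using V_props(2)[of "W y" "W x"] W_ge_1[of y] V_W[of x] V_W[of y] by fastforce

lemma V_tendsto_top: "filterlim V at_top at_top"
  unfolding filterlim_at_top
proof
  fix B
  obtain x where x: "1 \<le> x" "V x = max 0 B" using V_props(4)[of "max 0 B"] by auto
  show "eventually (\<lambda>y. B \<le> V y) at_top"
    using eventually_ge_at_top[of x] by eventually_elim (use V_mono[OF x(1)] x in fastforce)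
qed

lemma V_derivative: "(V has_real_derivative x powr (\<gamma> - 1) / L x) (at x)" if x: "1 < x"
proof -
  have "(1 / x) powr (\<gamma> + 1) = x powr (- (\<gamma> + 1))"
    unfolding powr_minus using x by (simp add: powr_divide inverse_eq_divide)
  then have "pgf offspring (1 - 1 / x) - (1 - 1 / x) = x powr (- (\<gamma> + 1)) * L x"
    using f[of "1 - 1 / x"] x by simp
  moreover have "x\<^sup>2 = x powr 2" using x by simp
  ultimately have "x\<^sup>2 * (pgf offspring (1 - 1 / x) - (1 - 1 / x)) = x powr (2 + - (\<gamma> + 1)) * L x"
    by (simp only: powr_add mult.assoc)
  also have "2 + - (\<gamma> + 1) = - (\<gamma> - 1)" by simp
  finally have "1 / (x\<^sup>2 * (pgf offspring (1 - 1 / x) - (1 - 1 / x))) = x powr (\<gamma> - 1) / L x"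
    by (simp only: powr_minus_divide) simp
  then show ?thesis using V_props(3)[OF x] by simp
qed

text \<open>
  L'Hospital's rule, as \<open>V\<close> has the derivative \<open>x powr (\<gamma> - 1) / L x\<close> and tends to infinity.
\<close>

lemma V_rv: "regularly_varying \<gamma> V"
  unfolding regularly_varying_def
proof safe
  fix c :: real assume c: "c > 0"
  obtain a where a: "\<And>x. x \<ge> a \<Longrightarrow> L x > 0" and lim: "((\<lambda>x. L (c * x) / L x) \<longlongrightarrow> 1) at_top"
    using L c unfolding slowly_varying_def by blast
  have big: "eventually (\<lambda>x. x > 1 \<and> x \<ge> a \<and> c * x > 1 \<and> c * x \<ge> a) at_top"
  proof -
    have "filterlim (\<lambda>x. c * x) at_top at_top" using c by real_asymp
    then have "eventually (\<lambda>x. c * x > 1) at_top" "eventually (\<lambda>x. c * x \<ge> a) at_top"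
      unfolding filterlim_at_top_dense by (blast, blast intro: eventually_mono less_imp_le)
    then show ?thesis by (intro eventually_conj eventually_gt_at_top eventually_ge_at_top)
  qed
  show "((\<lambda>x. V (c * x) / V x) \<longlongrightarrow> c powr \<gamma>) at_top"
  proof (rule lhospital_at_top_at_top[OF V_tendsto_top])
    let ?f' = "\<lambda>x. (c * x) powr (\<gamma> - 1) / L (c * x) * c" and ?g' = "\<lambda>x. x powr (\<gamma> - 1) / L x"
    show "eventually (\<lambda>x. ?g' x \<noteq> 0) at_top" using big
      by eventually_elim (use a in force)
    show "eventually (\<lambda>x. (V has_real_derivative ?g' x) (at x)) at_top"
      using big by eventually_elim (rule V_derivative, simp)
    show "eventually (\<lambda>x. ((\<lambda>x. V (c * x)) has_real_derivative ?f' x) (at x)) at_top"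
      using big
    proof eventually_elim
      case (elim x)
      have "((\<lambda>x. c * x) has_real_derivative c) (at x)" by (auto intro!: derivative_eq_intros)
      with V_derivative[of "c * x"] elim show ?case by (intro DERIV_chain2) auto
    qed
    have "((\<lambda>x. c powr \<gamma> * inverse (L (c * x) / L x)) \<longlongrightarrow> c powr \<gamma> * inverse 1) at_top"
      by (intro tendsto_intros lim) auto
    then have "((\<lambda>x. c powr \<gamma> * inverse (L (c * x) / L x)) \<longlongrightarrow> c powr \<gamma>) at_top" by simp
    then show "((\<lambda>x. ?f' x / ?g' x) \<longlongrightarrow> c powr \<gamma>) at_top"
    proof (rule Lim_transform_eventually)
      show "eventually (\<lambda>x. c powr \<gamma> * inverse (L (c * x) / L x) = ?f' x / ?g' x) at_top"
        using big
      proof eventually_elim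
        case (elim x)
        have "L x > 0" "L (c * x) > 0" using a elim by auto
        moreover have "(c * x) powr (\<gamma> - 1) * c = c powr \<gamma> * x powr (\<gamma> - 1)"
          using c elim by (simp add: powr_mult powr_diff)
        ultimately show ?case using elim by (simp add: field_simps)
      qed
    qed
  qed
qed

lemma W_top: "filterlim W at_top at_top" and W_rv: "regularly_varying (1 / \<gamma>) W"
  using regularly_varying_inverse_function[OF V_rv \<gamma> V_props(2) V_props(1) W_ge_1 V_W] by blast+

text \<open>
  The probability that a wave leaves a survivor, if each immigrant has one with probability \<open>1 / y\<close>.
\<close>

definition Q :: "real \<Rightarrow> real" where "Q y = 1 - pgf immigrants (1 - 1 / y)"

lemma Q_antimono: "1 \<le> x \<Longrightarrow> x \<le> y \<Longrightarrow> Q y \<le> Q x"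
  unfolding Q_def using pgf_mono[of "1 - 1 / x" "1 - 1 / y" immigrants] by (auto simp: field_simps)

lemma Q_pos: "1 \<le> x \<Longrightarrow> 0 < Q x"
  unfolding Q_def using immigrants_less[of "1 - 1 / x"] by simp

lemma Q_rv: "regularly_varying (- \<alpha>) Q"
  unfolding regularly_varying_def
proof safe
  fix c :: real assume c: "c > 0"
  obtain a where a: "\<And>x. x \<ge> a \<Longrightarrow> l x > 0" and lim: "((\<lambda>x. l (c * x) / l x) \<longlongrightarrow> 1) at_top"
    using l c unfolding slowly_varying_def by blast
  have Q_eq: "Q x = x powr (- \<alpha>) * l x" if "1 \<le> x" for x
  proof -
    have "(1 / x) powr \<alpha> = x powr (- \<alpha>)"
      unfolding powr_minus using that by (simp add: powr_divide inverse_eq_divide)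
    then show ?thesis unfolding Q_def using g[of "1 - 1 / x"] that by simp
  qed
  have "((\<lambda>x. c powr (- \<alpha>) * (l (c * x) / l x)) \<longlongrightarrow> c powr (- \<alpha>) * 1) at_top"
    by (intro tendsto_intros lim)
  then have "((\<lambda>x. c powr (- \<alpha>) * (l (c * x) / l x)) \<longlongrightarrow> c powr (- \<alpha>)) at_top" by simp
  then show "((\<lambda>x. Q (c * x) / Q x) \<longlongrightarrow> c powr - \<alpha>) at_top"
  proof (rule Lim_transform_eventually)
    have "filterlim (\<lambda>x. c * x) at_top at_top" using c by real_asymp
    then have "eventually (\<lambda>x. c * x \<ge> 1) at_top" by (auto simp: filterlim_at_top)
    then show "eventually (\<lambda>x. c powr (- \<alpha>) * (l (c * x) / l x) = Q (c * x) / Q x) at_top"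
      using eventually_ge_at_top[of 1]
      by eventually_elim (use c in \<open>simp add: Q_eq powr_mult\<close>)
  qed
qed

lemma F_eq: "1 / (1 - F t s) = W (\<mu> * t + V (1 / (1 - s)))"
  if t: "0 \<le> t" and s: "0 \<le> s" "s < 1" for t s
proof -
  have "(1 - s) * exp (- \<mu> * t) > 0" using s by simp
  then have lt: "F t s < 1" using mbp_F_less_1[OF \<mu>_pos mean s t] by linarith
  have "0 \<le> F t s" using mbp_F_bounds(1)[OF \<mu>_pos, of s offspring t] s by simp
  then have "1 \<le> 1 / (1 - F t s)" using lt by simp
  from W_V[OF this] show "1 / (1 - F t s) = W (\<mu> * t + V (1 / (1 - s)))"
    using mbp_V_mbp_F[OF \<mu>_pos mean offspring_gt s t] by simp
qed

lemma q_eq: "q t s = Q (W (\<mu> * t + V (1 / (1 - s))))" if t: "0 \<le> t" and s: "0 \<le> s" "s < 1"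
  unfolding F_eq[OF that, symmetric] Q_def mbp_q_def by simp

lemma q_0_eq: "0 \<le> t \<Longrightarrow> q t 0 = Q (W (\<mu> * t))"
  using q_eq[of t 0] V_props(1) by simp

text \<open>
  Starting from \<open>s\<close> instead of 0 only shifts the argument of \<open>W\<close>, that is, it acts as a delay.
\<close>

lemma q_delay:
  assumes "0 \<le> t" "0 \<le> s" "s < 1"
  shows "q t s = q (t + V (1 / (1 - s)) / \<mu>) 0" "0 \<le> V (1 / (1 - s)) / \<mu>"
proof -
  have "1 \<le> 1 / (1 - s)" using assms by simp
  then show 0: "0 \<le> V (1 / (1 - s)) / \<mu>" using V_nonneg \<mu>_pos by simp
  show "q t s = q (t + V (1 / (1 - s)) / \<mu>) 0"
  proof -
    have "\<mu> * (t + V (1 / (1 - s)) / \<mu>) = \<mu> * t + V (1 / (1 - s))"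
      using \<mu>_pos by (simp add: distrib_left)
    then show ?thesis using q_eq[OF assms] q_0_eq[of "t + V (1 / (1 - s)) / \<mu>"] 0 assms by simp
  qed
qed

lemma q_pos: "0 \<le> t \<Longrightarrow> 0 \<le> s \<Longrightarrow> s < 1 \<Longrightarrow> 0 < q t s"
  using q_eq[of t s] Q_pos W_ge_1 V_nonneg[of "1 / (1 - s)"] \<mu>_pos by simp

lemma q_antimono: "0 \<le> t \<Longrightarrow> t \<le> t' \<Longrightarrow> q t' 0 \<le> q t 0"
  using q_0_eq[of t] q_0_eq[of t'] Q_antimono[of "W (\<mu> * t)" "W (\<mu> * t')"] W_mono[of "\<mu> * t" "\<mu> * t'"]
    W_ge_1[of "\<mu> * t"] \<mu>_pos by simp

lemma q_continuous: "continuous_on {0..} (\<lambda>t. q t s)" if s: "0 \<le> s" "s < 1"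
proof (rule continuous_on_half_line)
  fix b
  have s1: "s \<le> 1" using s by simp
  show "continuous_on {0..b} (\<lambda>t. q t s)"
  proof (cases "0 \<le> b")
    case True
    have "F t s \<in> {0..1}" for t using mbp_F_bounds[OF \<mu>_pos s(1) s1] by auto
    then show ?thesis unfolding mbp_q_def
      by (intro continuous_intros continuous_on_compose2[OF continuous_on_pgf]
          mbp_F_continuous_derivative(2)[OF \<mu>_pos mean s(1) s1, of 0]) (use True in auto)
  qed simp
qed

text \<open>
  \<open>q(t;0) = Q(W(\<mu> t))\<close>, and the indices \<open>1 / \<gamma>\<close> of \<open>W\<close> and \<open>- \<alpha>\<close> of \<open>Q\<close> multiply.
\<close>

lemma q_rv: "regularly_varying (- \<beta>) (\<lambda>t. q t 0)"
  unfolding regularly_varying_def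
proof safe
  fix c :: real assume c: "c > 0"
  have \<mu>top: "filterlim (\<lambda>t. \<mu> * t) at_top at_top" using \<mu>_pos by real_asymp
  have "((\<lambda>t. Q (W (c * (\<mu> * t))) / Q (W (\<mu> * t))) \<longlongrightarrow> (c powr (1 / \<gamma>)) powr (- \<alpha>)) at_top"
  proof (rule regularly_varying_antimono_tendsto[OF Q_rv Q_antimono Q_pos])
    show "filterlim (\<lambda>t. W (\<mu> * t)) at_top at_top" by (rule filterlim_compose[OF W_top \<mu>top])
    show "((\<lambda>t. W (c * (\<mu> * t)) / W (\<mu> * t)) \<longlongrightarrow> c powr (1 / \<gamma>)) at_top"
      by (rule filterlim_compose[OF regularly_varyingD[OF W_rv c] \<mu>top])
  qed (use c in auto)
  then show "((\<lambda>t. q (c * t) 0 / q t 0) \<longlongrightarrow> c powr - \<beta>) at_top"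
  proof (rule Lim_transform_eventually[THEN tendsto_eq_rhs])
    show "eventually (\<lambda>t. Q (W (c * (\<mu> * t))) / Q (W (\<mu> * t)) = q (c * t) 0 / q t 0) at_top"
      using eventually_ge_at_top[of "0::real"]
      by eventually_elim (use c in \<open>simp add: q_0_eq ac_simps\<close>)
    show "(c powr (1 / \<gamma>)) powr (- \<alpha>) = c powr - \<beta>" by (simp add: powr_powr)
  qed
qed

definition J :: "real \<Rightarrow> real \<Rightarrow> real" where "J t s = integral {0..t} (\<lambda>u. r0 u * q (t - u) s)"

lemma expectation_Y: "0 \<le> t \<Longrightarrow> 0 \<le> s \<Longrightarrow> s < 1 \<Longrightarrow> expectation (\<lambda>\<omega>. s ^ Y t \<omega>) = exp (- J t s)"
  using expectation_total_population[OF mean, of s t] integral_r0[of 0 t "\<lambda>u. q (t - u) s"] by (simp add: J_def)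

lemma measurable_Y[measurable]: "0 \<le> t \<Longrightarrow> Y t \<in> M \<rightarrow>\<^sub>M count_space UNIV"
  by (rule measurable_total_population)

lemma prob_Y_pos: "0 \<le> t \<Longrightarrow> prob {\<omega> \<in> space M. 0 < Y t \<omega>} = 1 - exp (- J t 0)"
proof -
  assume t: "0 \<le> t"
  note [measurable] = measurable_Y[OF t]
  have "expectation (\<lambda>\<omega>. (0::real) ^ Y t \<omega>) = expectation (indicator {\<omega> \<in> space M. \<not> 0 < Y t \<omega>})"
    by (intro Bochner_Integration.integral_cong) (auto simp: indicator_def zero_power)
  also have "\<dots> = prob {\<omega> \<in> space M. \<not> 0 < Y t \<omega>}" by simp
  also have "\<dots> = 1 - prob {\<omega> \<in> space M. 0 < Y t \<omega>}" by (rule prob_neg) measurable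
  finally show ?thesis using expectation_Y[OF t, of 0] by simp
qed

lemma conditional_pgf:
  assumes t: "0 \<le> t" and s: "0 \<le> s" "s < 1" and pos: "0 < J t 0"
  shows "(LINT \<omega>|uniform_measure M {\<omega> \<in> space M. 0 < Y t \<omega>}. s ^ Y t \<omega>) =
    1 - (1 - exp (- J t s)) / (1 - exp (- J t 0))"
proof -
  note [measurable] = measurable_Y[OF t]
  let ?A = "{\<omega> \<in> space M. 0 < Y t \<omega>}"
  have A: "prob ?A = 1 - exp (- J t 0)" "prob ?A > 0" using prob_Y_pos[OF t] pos by auto
  have "(LINT \<omega>|M. indicator ?A \<omega> * s ^ Y t \<omega>) = (LINT \<omega>|M. s ^ Y t \<omega> - (1 - indicator ?A \<omega>))"
    by (intro Bochner_Integration.integral_cong) (auto simp: indicator_def)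
  also have "\<dots> = exp (- J t s) - (1 - prob ?A)"
  proof -
    have "integrable M (\<lambda>\<omega>. s ^ Y t \<omega>)"
      using s by (intro integrable_const_bound[where B=1]) (auto simp: power_le_one)
    moreover have "integrable M (indicator ?A :: 'a \<Rightarrow> real)"
      by (intro integrable_const_bound[where B=1]) auto
    ultimately show ?thesis using expectation_Y[OF t s] by (simp add: prob_space)
  qed
  finally have num: "(LINT \<omega>|M. indicator ?A \<omega> * s ^ Y t \<omega>) = exp (- J t s) - (1 - prob ?A)" .
  have "(LINT \<omega>|uniform_measure M ?A. s ^ Y t \<omega>) = (LINT \<omega>|M. indicator ?A \<omega> * s ^ Y t \<omega>) / prob ?A"
    by (rule integral_uniform_measure) (use A in auto)
  also have "\<dots> = ((1 - exp (- J t 0)) - (1 - exp (- J t s))) / (1 - exp (- J t 0))"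
    unfolding num A(1) by simp
  also have "\<dots> = 1 - (1 - exp (- J t s)) / (1 - exp (- J t 0))"
  proof -
    have "1 - exp (- J t 0) \<noteq> 0" using pos by simp
    then have "(1 - exp (- J t 0)) / (1 - exp (- J t 0)) = 1" by (rule divide_self)
    then show ?thesis unfolding diff_divide_distrib[of "1 - exp (- J t 0)"] by simp
  qed
  finally show ?thesis .
qed

end


section \<open>The two limit theorems\<close>

context critical_immigration
begin

text \<open>
  Both exponents \<open>J(t, s)\<close> and \<open>J(t, 0)\<close> are asymptotically \<open>r t\<close> times the integral of the
  respective \<open>q\<close>, and they tend to 0 because \<open>r\<close> does.
\<close>

lemma integrable_q_limit:
  assumes \<theta>1: "\<theta> < 1" and int: "(\<lambda>u. q u 0) integrable_on {0..}" and s: "0 \<le> s" "s < 1"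
  shows "((\<lambda>t. LINT \<omega>|uniform_measure M {\<omega> \<in> space M. 0 < Y t \<omega>}. s ^ Y t \<omega>) \<longlongrightarrow>
    1 - mbp_Delta \<mu> offspring immigrants s / integral {0..} (\<lambda>u. q u 0)) at_top"
proof -
  have q_le: "q u s' \<le> q u 0" if "0 \<le> u" "0 \<le> s'" "s' < 1" for u s'
    using q_delay[OF that] q_antimono[OF that(1), of "u + V (1 / (1 - s')) / \<mu>"] by simp
  have conv: "((\<lambda>t. J t s' / r0 t) \<longlongrightarrow> integral {0..} (\<lambda>u. q u s')) at_top" if s': "0 \<le> s'" "s' < 1" for s'
    unfolding J_def
    by (rule rate.convolution_integrable_asymptotics[OF \<theta>1 q_antimono q_continuous int])
       (use s' q_pos q_le q_continuous[OF s'] in \<open>auto intro: less_imp_le\<close>)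
  let ?Q = "integral {0..} (\<lambda>u. q u 0)"
  have Q_pos: "0 < ?Q"
  proof -
    have i01: "(\<lambda>u. q u 0) integrable_on {0..1}"
      by (rule integrable_continuous_interval[OF continuous_on_subset[OF q_continuous]]) auto
    have "integral {0..1::real} (\<lambda>_. q 1 0) \<le> integral {0..1} (\<lambda>u. q u 0)"
      using q_antimono by (intro integral_le i01) auto
    also have "\<dots> \<le> ?Q"
      using q_pos[of _ 0] by (intro integral_subset_le i01 int) (auto intro: less_imp_le)
    finally show ?thesis using q_pos[of 1 0] by simp
  qed
  have ratio: "((\<lambda>t. J t s / J t 0) \<longlongrightarrow> integral {0..} (\<lambda>u. q u s) / ?Q) at_top"
  proof (rule Lim_transform_eventually)
    show "((\<lambda>t. (J t s / r0 t) / (J t 0 / r0 t)) \<longlongrightarrow> integral {0..} (\<lambda>u. q u s) / ?Q) at_top"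
      using Q_pos by (intro tendsto_divide conv s) auto
    show "eventually (\<lambda>t. (J t s / r0 t) / (J t 0 / r0 t) = J t s / J t 0) at_top"
      using rate.r_eventually_pos by eventually_elim simp
  qed
  have J0_pos: "eventually (\<lambda>t. 0 < J t 0) at_top"
    using order_tendstoD(1)[OF conv[of 0] Q_pos, simplified] rate.r_eventually_pos
    by eventually_elim (simp add: zero_less_divide_iff)
  have J0_lim: "((\<lambda>t. J t 0) \<longlongrightarrow> 0) at_top"
  proof (rule Lim_transform_eventually)
    show "((\<lambda>t. J t 0 / r0 t * r0 t) \<longlongrightarrow> 0) at_top"
      using tendsto_mult[OF conv[of 0] rate.r_tendsto_0] by simp
    show "eventually (\<lambda>t. J t 0 / r0 t * r0 t = J t 0) at_top"
      using rate.r_eventually_pos by eventually_elim simp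
  qed
  have "((\<lambda>t. 1 - (1 - exp (- J t s)) / (1 - exp (- J t 0))) \<longlongrightarrow> 1 - integral {0..} (\<lambda>u. q u s) / ?Q) at_top"
    by (intro tendsto_diff tendsto_const one_minus_exp_ratio_tendsto J0_lim J0_pos ratio)
  then have "((\<lambda>t. LINT \<omega>|uniform_measure M {\<omega> \<in> space M. 0 < Y t \<omega>}. s ^ Y t \<omega>) \<longlongrightarrow>
      1 - integral {0..} (\<lambda>u. q u s) / ?Q) at_top"
  proof (rule Lim_transform_eventually)
    show "eventually (\<lambda>t. 1 - (1 - exp (- J t s)) / (1 - exp (- J t 0)) =
        (LINT \<omega>|uniform_measure M {\<omega> \<in> space M. 0 < Y t \<omega>}. s ^ Y t \<omega>)) at_top"
      using J0_pos eventually_ge_at_top[of "0::real"]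
      by eventually_elim (simp add: conditional_pgf[OF _ s])
  qed
  then show ?thesis by (simp add: mbp_Delta_def)
qed

definition scaled_law :: "real \<Rightarrow> real measure" where
  "scaled_law t = distr (uniform_measure M {\<omega> \<in> space M. 0 < Y t \<omega>}) borel (\<lambda>\<omega>. real (Y t \<omega>) / W (\<mu> * t))"

lemma W_mu_ge_1: "0 \<le> t \<Longrightarrow> 1 \<le> W (\<mu> * t)"
  using W_ge_1[of "\<mu> * t"] \<mu>_pos by simp

lemma scaled_law_props:
  assumes t: "0 \<le> t" and pos: "0 < J t 0"
  shows scaled_law_nonneg: "nonneg_distribution (scaled_law t)"
    and scaled_law_cdf: "cdf (scaled_law t) x = \<P>(\<omega> in M. real (Y t \<omega>) / W (\<mu> * t) \<le> x \<bar> 0 < Y t \<omega>)"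
    and scaled_law_laplace: "0 < u \<Longrightarrow> (LINT x|scaled_law t. exp (- u * x)) =
      1 - (1 - exp (- J t (exp (- u / W (\<mu> * t))))) / (1 - exp (- J t 0))"
proof -
  note [measurable] = measurable_Y[OF t]
  let ?A = "{\<omega> \<in> space M. 0 < Y t \<omega>}" and ?Z = "\<lambda>\<omega>. real (Y t \<omega>) / W (\<mu> * t)"
  have W1: "1 \<le> W (\<mu> * t)" by (rule W_mu_ge_1[OF t])
  have pA: "prob ?A > 0" using prob_Y_pos[OF t] pos by simp
  have eA: "emeasure M ?A \<noteq> 0" "emeasure M ?A \<noteq> \<infinity>" using pA by (auto simp: emeasure_eq_measure)
  interpret U: prob_space "uniform_measure M ?A" using eA by (intro prob_space_uniform_measure) auto
  have [measurable]: "?Z \<in> borel_measurable (uniform_measure M ?A)" by measurable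
  interpret D: real_distribution "scaled_law t"
    unfolding scaled_law_def by (rule U.real_distribution_distr) measurable
  have "AE x in scaled_law t. 0 \<le> x"
    unfolding scaled_law_def using W1 by (subst AE_distr_iff) auto
  then show "nonneg_distribution (scaled_law t)" by (rule D.nonneg_distributionI)
  have "cdf (scaled_law t) x = measure (uniform_measure M ?A) {\<omega> \<in> space M. ?Z \<omega> \<le> x}"
    unfolding cdf_def scaled_law_def
    by (subst measure_distr) (auto intro!: arg_cong[where f="measure _"])
  also have "\<dots> = prob (?A \<inter> {\<omega> \<in> space M. ?Z \<omega> \<le> x}) / prob ?A"
    by (rule measure_uniform_measure[OF eA]) measurable
  also have "?A \<inter> {\<omega> \<in> space M. ?Z \<omega> \<le> x} = {\<omega> \<in> space M. ?Z \<omega> \<le> x \<and> 0 < Y t \<omega>}" by auto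
  finally show "cdf (scaled_law t) x = \<P>(\<omega> in M. ?Z \<omega> \<le> x \<bar> 0 < Y t \<omega>)"
    by (simp add: cond_prob_def)
  assume u: "0 < u"
  define s where "s = exp (- u / W (\<mu> * t))"
  have s: "0 \<le> s" "s < 1" using u W1 by (auto simp: s_def divide_neg_pos)
  have "(LINT x|scaled_law t. exp (- u * x)) = (LINT \<omega>|uniform_measure M ?A. exp (- u * ?Z \<omega>))"
    unfolding scaled_law_def by (rule integral_distr) measurable
  also have "\<dots> = (LINT \<omega>|uniform_measure M ?A. s ^ Y t \<omega>)"
    by (intro Bochner_Integration.integral_cong refl) (simp add: s_def field_simps flip: exp_of_nat_mult)
  also have "\<dots> = 1 - (1 - exp (- J t s)) / (1 - exp (- J t 0))"
    by (rule conditional_pgf[OF t s pos])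
  finally show "(LINT x|scaled_law t. exp (- u * x)) =
      1 - (1 - exp (- J t (exp (- u / W (\<mu> * t))))) / (1 - exp (- J t 0))"
    by (simp add: s_def)
qed

text \<open>
  At \<open>s = exp (- u / W(\<mu> t))\<close> the argument \<open>1 / (1 - s)\<close> is asymptotically \<open>W(\<mu> t) / u\<close>, and \<open>V\<close> has
  index \<open>\<gamma>\<close> with \<open>V (W (\<mu> t)) = \<mu> t\<close>. So the delay is comparable to \<open>t\<close> itself.
\<close>

lemma scaled_delay_tendsto:
  assumes u: "0 < u"
  shows "((\<lambda>t. V (1 / (1 - exp (- u / W (\<mu> * t)))) / \<mu> / t) \<longlongrightarrow> u powr (- \<gamma>)) at_top"
proof -
  have \<mu>top: "filterlim (\<lambda>t. \<mu> * t) at_top at_top" using \<mu>_pos by real_asymp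
  have Wtop: "filterlim (\<lambda>t. W (\<mu> * t)) at_top at_top" by (rule filterlim_compose[OF W_top \<mu>top])
  have "((\<lambda>b. 1 / (1 - exp (- u / b)) / b) \<longlongrightarrow> inverse u) at_top"
    using u by real_asymp
  then have "((\<lambda>b. 1 / (1 - exp (- u / b)) / b) \<longlongrightarrow> 1 / u) at_top"
    by (simp only: inverse_eq_divide)
  then have "((\<lambda>t. 1 / (1 - exp (- u / W (\<mu> * t))) / W (\<mu> * t)) \<longlongrightarrow> 1 / u) at_top"
    by (rule filterlim_compose[OF _ Wtop])
  note arg_ratio = this
  have "((\<lambda>t. V (1 / (1 - exp (- u / W (\<mu> * t)))) / V (W (\<mu> * t))) \<longlongrightarrow> (1 / u) powr \<gamma>) at_top"
  proof (rule regularly_varying_mono_tendsto[OF V_rv _ _ Wtop arg_ratio])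
    show "V x \<le> V y" if "2 \<le> x" "x \<le> y" for x y using V_mono that by simp
    show "0 < V x" if "2 \<le> x" for x using V_props(1) V_props(2)[of 1 x] that by simp
  qed (use u in auto)
  then show ?thesis
  proof (rule Lim_transform_eventually[THEN tendsto_eq_rhs])
    show "eventually (\<lambda>t. V (1 / (1 - exp (- u / W (\<mu> * t)))) / V (W (\<mu> * t)) =
        V (1 / (1 - exp (- u / W (\<mu> * t)))) / \<mu> / t) at_top"
      using eventually_ge_at_top[of "0::real"] by eventually_elim (use \<mu>_pos in \<open>simp add: V_W\<close>)
    show "(1 / u) powr \<gamma> = u powr (- \<gamma>)" unfolding powr_minus using u by (simp add: powr_divide inverse_eq_divide)
  qed
qed

lemma divide_divide_cancel: "c \<noteq> 0 \<Longrightarrow> (a / c) / (b / c) = a / (b::real)"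
  by simp

context
  assumes \<theta>1: "\<theta> \<ge> 1" and \<beta>1: "\<beta> < 1"
begin

interpretation kernel: power_intensity_kernel r0 L\<^sub>R \<theta> "\<lambda>t. q t 0" \<beta>
proof
  show "0 < \<beta>" using \<alpha> \<gamma> by simp
qed (use \<theta>1 \<beta>1 q_rv q_antimono q_pos q_continuous in auto)

text \<open>
  A generating function at \<open>s t\<close> is the one at 0 with a delay, so that the convolution theorem
  for delayed kernels applies.
\<close>

lemma J_asymptotics:
  assumes s: "\<And>t. 0 \<le> s t" "\<And>t. s t < 1" and w: "((\<lambda>t. V (1 / (1 - s t)) / \<mu> / t) \<longlongrightarrow> \<kappa>) at_top" and \<kappa>: "0 \<le> \<kappa>"
  shows "((\<lambda>t. J t (s t) / (rate.R t * q t 0)) \<longlongrightarrow> (1 + \<kappa>) powr (- \<beta>)) at_top"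
proof -
  define w' where "w' t = V (1 / (1 - s t)) / \<mu>" for t
  have "J t (s t) = integral {0..t} (\<lambda>u. r0 u * q (t - u + w' t) 0)" for t
    unfolding J_def
    by (intro Henstock_Kurzweil_Integration.integral_cong) (use q_delay(1)[OF _ s] in \<open>auto simp: w'_def\<close>)
  then show ?thesis
    using kernel.convolution_asymptotics[of w' \<kappa>] q_delay(2)[OF order_refl s] w \<kappa> by (simp add: w'_def)
qed

lemma J0_ratio: "((\<lambda>t. J t 0 / (rate.R t * q t 0)) \<longlongrightarrow> 1) at_top"
  using J_asymptotics[of "\<lambda>_. 0" 0] V_props(1) by simp

lemma Rq_pos: "eventually (\<lambda>t. 0 < rate.R t * q t 0) at_top"
  using rate.R_eventually_pos eventually_ge_at_top[of "0::real"] by eventually_elim (simp add: q_pos)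

lemma J0_pos: "eventually (\<lambda>t. 0 < J t 0) at_top"
  using order_tendstoD(1)[OF J0_ratio zero_less_one] Rq_pos
  by eventually_elim (simp add: zero_less_divide_iff)

lemma J0_tendsto_0: "((\<lambda>t. J t 0) \<longlongrightarrow> 0) at_top"
proof (rule Lim_transform_eventually)
  show "((\<lambda>t. J t 0 / (rate.R t * q t 0) * (rate.R t * q t 0)) \<longlongrightarrow> 0) at_top"
    using tendsto_mult[OF J0_ratio kernel.Rp_tendsto_0] by simp
  show "eventually (\<lambda>t. J t 0 / (rate.R t * q t 0) * (rate.R t * q t 0) = J t 0) at_top"
    using Rq_pos by eventually_elim (unfold times_divide_eq_left, rule nonzero_mult_div_cancel_right[OF less_imp_neq[symmetric]])
qed

lemma scaled_law_laplace_tendsto: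
  assumes u: "0 < u"
  shows "((\<lambda>t. LINT x|scaled_law t. exp (- u * x)) \<longlongrightarrow> 1 - u powr \<alpha> / (1 + u powr \<gamma>) powr \<beta>) at_top"
proof -
  \<comment> \<open>for negative times \<open>W\<close> need not be at least 1, so \<open>s t\<close> would not be a valid argument\<close>
  define s where "s t = exp (- u / W (\<mu> * max 0 t))" for t
  have s: "0 \<le> s t" "s t < 1" for t using u W_mu_ge_1[of "max 0 t"] by (auto simp: s_def divide_neg_pos)
  have s_eq: "eventually (\<lambda>t. s t = exp (- u / W (\<mu> * t))) at_top"
    using eventually_ge_at_top[of "0::real"] by eventually_elim (simp add: s_def)
  have "((\<lambda>t. V (1 / (1 - s t)) / \<mu> / t) \<longlongrightarrow> u powr (- \<gamma>)) at_top"
    by (rule Lim_transform_eventually[OF scaled_delay_tendsto[OF u]]) (use s_eq in eventually_elim, simp)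
  from J_asymptotics[OF s this] have Js: "((\<lambda>t. J t (s t) / (rate.R t * q t 0)) \<longlongrightarrow> (1 + u powr (- \<gamma>)) powr (- \<beta>)) at_top"
    by simp
  have ratio: "((\<lambda>t. J t (s t) / J t 0) \<longlongrightarrow> (1 + u powr (- \<gamma>)) powr (- \<beta>)) at_top"
  proof (rule Lim_transform_eventually)
    show "((\<lambda>t. (J t (s t) / (rate.R t * q t 0)) / (J t 0 / (rate.R t * q t 0))) \<longlongrightarrow> (1 + u powr (- \<gamma>)) powr (- \<beta>)) at_top"
      using tendsto_divide[OF Js J0_ratio] by simp
    show "eventually (\<lambda>t. (J t (s t) / (rate.R t * q t 0)) / (J t 0 / (rate.R t * q t 0)) = J t (s t) / J t 0) at_top"
      using Rq_pos by eventually_elim (rule divide_divide_cancel[OF less_imp_neq[symmetric]])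
  qed
  have "((\<lambda>t. 1 - (1 - exp (- J t (s t))) / (1 - exp (- J t 0))) \<longlongrightarrow> 1 - (1 + u powr (- \<gamma>)) powr (- \<beta>)) at_top"
    by (intro tendsto_diff tendsto_const one_minus_exp_ratio_tendsto J0_tendsto_0 J0_pos ratio)
  then have "((\<lambda>t. 1 - (1 - exp (- J t (s t))) / (1 - exp (- J t 0))) \<longlongrightarrow> 1 - u powr \<alpha> / (1 + u powr \<gamma>) powr \<beta>) at_top"
    using D_transform_eq[of u \<gamma> \<alpha>] u \<gamma> by simp
  then show ?thesis
  proof (rule Lim_transform_eventually)
    show "eventually (\<lambda>t. 1 - (1 - exp (- J t (s t))) / (1 - exp (- J t 0)) = (LINT x|scaled_law t. exp (- u * x))) at_top"
      using J0_pos s_eq eventually_ge_at_top[of "0::real"]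
    proof eventually_elim
      case (elim t)
      show ?case unfolding scaled_law_laplace[OF elim(3,1) u] elim(2) ..
    qed
  qed
qed

text \<open>
  The continuity theorem needs genuine distributions, and conditioning on survival makes sense only
  for large \<open>t\<close>; hence the truncation of the times at \<open>T\<close>.
\<close>

theorem scaled_limit:
  shows "\<exists>!D. D_law \<alpha> \<gamma> D"
    and "D_law \<alpha> \<gamma> D \<Longrightarrow>
      ((\<lambda>t. \<P>(\<omega> in M. real (Y t \<omega>) / W (\<mu> * t) \<le> x \<bar> 0 < Y t \<omega>)) \<longlongrightarrow> cdf D x) at_top"
proof -
  have "eventually (\<lambda>t. 0 \<le> t \<and> 0 < J t 0) at_top"
    by (intro eventually_conj J0_pos eventually_ge_at_top)
  then obtain T where T: "\<And>t. t \<ge> T \<Longrightarrow> 0 \<le> t \<and> 0 < J t 0"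
    unfolding eventually_at_top_linorder by blast
  have limit: "(\<exists>D. D_law \<alpha> \<gamma> D) \<and> (\<forall>D. D_law \<alpha> \<gamma> D \<longrightarrow> (\<lambda>n. cdf (scaled_law (max T (X n))) x) \<longlonglongrightarrow> cdf D x)"
    if X: "filterlim X at_top sequentially" for X :: "nat \<Rightarrow> real" and x
  proof -
    have X': "filterlim (\<lambda>n. max T (X n)) at_top sequentially"
      by (rule filterlim_at_top_mono[OF X]) auto
    have "nonneg_distribution (scaled_law (max T (X n)))" for n
      using T[of "max T (X n)"] by (intro scaled_law_nonneg) auto
    note * = D_law_limit[OF this \<gamma> \<alpha> filterlim_compose[OF scaled_law_laplace_tendsto X']]
    show ?thesis using *(1) *(2)[of _ x] by blast
  qed
  have "\<exists>D. D_law \<alpha> \<gamma> D" using limit[OF filterlim_real_sequentially] by blast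
  then show "\<exists>!D. D_law \<alpha> \<gamma> D" using D_law_unique by blast
  assume D: "D_law \<alpha> \<gamma> D"
  show "((\<lambda>t. \<P>(\<omega> in M. real (Y t \<omega>) / W (\<mu> * t) \<le> x \<bar> 0 < Y t \<omega>)) \<longlongrightarrow> cdf D x) at_top"
  proof (rule tendsto_at_topI_sequentially)
    fix X :: "nat \<Rightarrow> real" assume X: "filterlim X at_top sequentially"
    have "(\<lambda>n. cdf (scaled_law (max T (X n))) x) \<longlonglongrightarrow> cdf D x" using limit[OF X] D by blast
    then show "(\<lambda>n. \<P>(\<omega> in M. real (Y (X n) \<omega>) / W (\<mu> * X n) \<le> x \<bar> 0 < Y (X n) \<omega>)) \<longlonglongrightarrow> cdf D x"
    proof (rule Lim_transform_eventually)
      have "eventually (\<lambda>n. T \<le> X n) sequentially" using X by (simp add: filterlim_at_top)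
      then show "eventually (\<lambda>n. cdf (scaled_law (max T (X n))) x =
          \<P>(\<omega> in M. real (Y (X n) \<omega>) / W (\<mu> * X n) \<le> x \<bar> 0 < Y (X n) \<omega>)) sequentially"
        by eventually_elim (use T in \<open>simp add: scaled_law_cdf max_absorb2\<close>)
    qed
  qed
qed

end

end

theorem theorem5p4:
  fixes M :: "'a measure" and r L l L\<^sub>R :: "real \<Rightarrow> real" and \<nu> :: "real \<Rightarrow> 'a \<Rightarrow> nat"
    and \<mu> \<alpha> \<gamma> \<theta> :: real and offspring immigrants :: "nat pmf"
    and I :: "nat \<Rightarrow> 'a \<Rightarrow> nat" and G :: "nat \<times> nat \<Rightarrow> 'a \<Rightarrow> genealogy"
    and Y :: "real \<Rightarrow> 'a \<Rightarrow> nat"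
  assumes model: "mbp_with_immigration M r \<nu> \<mu> offspring immigrants I G"
    and Y_def: "Y = total_population \<nu> I G"
    and critical: "measure_pmf.expectation offspring real = 1"
    and \<gamma>: "0 < \<gamma>" "\<gamma> \<le> 1" and \<alpha>: "0 < \<alpha>" "\<alpha> \<le> 1" and \<theta>: "0 < \<theta>"
    and L: "slowly_varying L" and l: "slowly_varying l" and L\<^sub>R: "slowly_varying L\<^sub>R"
    and f: "\<And>s. 0 \<le> s \<Longrightarrow> s < 1 \<Longrightarrow>
              pgf offspring s = s + (1 - s) powr (\<gamma> + 1) * L (1 / (1 - s))"
    and g: "\<And>s. 0 \<le> s \<Longrightarrow> s < 1 \<Longrightarrow>
              pgf immigrants s = 1 - (1 - s) powr \<alpha> * l (1 / (1 - s))"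
    and r: "\<And>t. t > 0 \<Longrightarrow> r t = t powr (- \<theta>) * L\<^sub>R t"
  shows
    "(\<theta> \<ge> 1 \<and> 0 < \<alpha> / \<gamma> \<and> \<alpha> / \<gamma> < 1 \<longrightarrow>
        (\<exists>!D. D_law \<alpha> \<gamma> D) \<and>
        (\<forall>D. D_law \<alpha> \<gamma> D \<longrightarrow> (\<forall>x\<ge>0.
          ((\<lambda>t. \<P>(\<omega> in M. real (Y t \<omega>) / mbp_W offspring (\<mu> * t) \<le> x \<bar> Y t \<omega> > 0))
            \<longlongrightarrow> cdf D x) at_top)))
     \<and>
     (\<theta> < 1 \<and> \<alpha> / \<gamma> \<ge> 1 \<and>
        (\<lambda>u. mbp_q \<mu> offspring immigrants u 0) integrable_on {0..} \<longrightarrow>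
        (\<forall>s. 0 \<le> s \<and> s < 1 \<longrightarrow>
          ((\<lambda>t. LINT \<omega>|uniform_measure M {\<omega> \<in> space M. Y t \<omega> > 0}. s ^ Y t \<omega>)
            \<longlongrightarrow> 1 - mbp_Delta \<mu> offspring immigrants s
                      / integral {0..} (\<lambda>u. mbp_q \<mu> offspring immigrants u 0)) at_top))"
proof -
  interpret critical_immigration M r \<nu> \<mu> offspring immigrants I G L l L\<^sub>R \<alpha> \<gamma> \<theta>
    unfolding critical_immigration_def critical_immigration_axioms_def using assms by blast
  show ?thesis
    unfolding Y_def using scaled_limit integrable_q_limit by blast
qed

end
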